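(* There is an absolute constant $c_0>0$ such that the following holds for $\lambda=\lambda(d)>0$, as $d\to\infty$. 1. If $\lambda\ge1+\frac{\omega(1)}{d}$ then $$Z_\lambda(Q_d)=(2+o(1))(1+\lambda)^{2^{d-1}}.$$ 2. If either $|\lambda-1|\le\frac{O(1)}{d}$ or $\sqrt2-1+\frac{(\sqrt2+\Omega(1))\log d}{d}\le\lambda\le1-\frac{\omega(1)}{d}$ then $$Z_\lambda(Q_d)=(2+o(1))(1+\lambda)^{2^{d-1}}\exp\left\{\frac{\lambda}{2}\left(\frac{2}{1+\lambda}\right)^d\right\}.$$ 3. If $\frac{c_0\log d}{d^{1/3}}\le\lambda\le\sqrt2-1+\frac{(\sqrt2+o(1))\log d}{d}$ then $$Z_\lambda(Q_d)=(1+\lambda)^{2^{d-1}}\exp\left\{\frac{\lambda}{2}\left(\frac{2}{1+\lambda}\right)^d(1+o(1))\right\}.$$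
   Context: $Q_d$ is the discrete hypercube: the graph on vertex set $\{0,1\}^d$ in which two strings are adjacent iff they differ in exactly one coordinate. $\mathcal{I}(Q_d)$ is the set of independent sets of $Q_d$ (including the empty set), and $Z_\lambda(Q_d)=\sum_{I\in\mathcal{I}(Q_d)}\lambda^{|I|}$. The parameter $\lambda$ may vary with $d$; $\omega(1)$ denotes a function of $d$ tending to infinity, $o(1)$ a function tending to $0$, $\Omega(1)$ a function eventually greater than some positive constant, and $O(1)$ a function bounded above by a constant. Logarithms are to base $e$. *)

theory Defs
  imports Complex_Main "HOL-Library.FuncSet"
begin

definition cube_verts :: "nat \<Rightarrow> (nat \<Rightarrow> nat) set" where
  "cube_verts d = {..<d} \<rightarrow>\<^sub>E {0, 1}"

definition cube_adj :: "nat \<Rightarrow> (nat \<Rightarrow> nat) \<Rightarrow> (nat \<Rightarrow> nat) \<Rightarrow> bool" where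
  "cube_adj d x y \<longleftrightarrow> card {i \<in> {..<d}. x i \<noteq> y i} = 1"

definition indep_sets :: "'a set \<Rightarrow> ('a \<Rightarrow> 'a \<Rightarrow> bool) \<Rightarrow> 'a set set" where
  "indep_sets V adj = {I. I \<subseteq> V \<and> (\<forall>x\<in>I. \<forall>y\<in>I. \<not> adj x y)}"

definition cube_Z :: "real \<Rightarrow> nat \<Rightarrow> real" where
  "cube_Z l d = (\<Sum>I \<in> indep_sets (cube_verts d) (cube_adj d). l ^ card I)"

end

theory Submission
  imports Defs "HOL-Real_Asymp.Real_Asymp" "HOL-Analysis.Convex"
begin

text \<open>Let \<open>X\<close>, \<open>Y\<close> be the even and odd vertices, \<open>M = 2^(d-1)\<close>. Summing over \<open>I \<inter> Y\<close> first gives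
  \<open>Z = (1+\<lambda>)^M \<Sum>A\<subseteq>X. wt A\<close> with \<open>wt A = \<lambda>^|A| (1+\<lambda>)^(-|N(A)|)\<close>. The weight is multiplicative over the
  2-linked components of \<open>A\<close>. Call a 2-linked set a polymer if its closure has size at most \<open>M/2\<close>.
  For every independent set, all components on one of the two sides are polymers, so
  \<open>Z \<le> 2 (1+\<lambda>)^M exp (\<Sum>polymers wt)\<close>. Singletons contribute \<open>(\<lambda>/2) (2/(1+\<lambda>))^d\<close>. The remaining
  polymers are negligible: small ones expand so well that they can be enumerated, and large ones are
  handled by Sapozhenko's graph containers, for which the edge-isoperimetric inequality supplies
  \<open>|N(A)| - |[A]| = \<Omega>(|N(A)|/d)\<close>. The matching lower bound comes from sets
  whose vertices have pairwise disjoint neighbourhoods.\<close>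

section \<open>Counting lemmas\<close>

text \<open>The upper bound forgets that polymers must be compatible, the lower bound keeps only
  separated sets, and both have the same first-order exponent. They differ by terms of the size of
  the pairs, about \<open>d^2 2^d (1+l)^(-2d)\<close>. This tends to 0 once \<open>l\<close> exceeds
  sqrt 2 - 1 + (sqrt 2 + eps) log d / d, which explains the border between parts 2 and 3. Below the
  border it is small only relative to the first-order exponent, which is then exponentially large
  and absorbs the factor 2 as well. Polymers with three or more vertices get the bound
  \<open>(1+l)^(-5d/2)\<close> per vertex of the side. The exponent must exceed 2: at
  \<open>1 + l\<close> = sqrt 2 the total is about \<open>2^(-d/4)\<close>. Small and large polymers
  are separated at size \<open>d^4\<close> of closure plus neighbourhood. Up to there isoperimetry
  gives expansion of order d / log d, and linked sets can simply be counted. Beyond it,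
  \<open>|N(A)| - |[A]|\<close> is at least \<open>d^3 / 5\<close>, so that the container gain beats
  both the number of possible sizes and the required exponent.\<close>

lemma one_le_ln: "d \<ge> 2 \<Longrightarrow> 1 \<le> ln (real d + 1)"
proof -
  assume "d \<ge> 2"
  then have "exp 1 \<le> real d + 1" using exp_le by linarith
  then show ?thesis by (simp add: ln_ge_iff)
qed

lemma sum_Pow_prod:
  fixes f :: "'a \<Rightarrow> real"
  assumes "finite A"
  shows "(\<Sum>B\<in>Pow A. \<Prod>x\<in>B. f x) = (\<Prod>x\<in>A. 1 + f x)"
  using assms
proof (induction A rule: finite_induct)
  case (insert a A)
  have inj: "inj_on (insert a) (Pow A)"
    using insert(2) by (auto simp: inj_on_def)
  have disj: "Pow A \<inter> insert a ` Pow A = {}"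
    using insert(2) by auto
  have "(\<Sum>B\<in>Pow (insert a A). \<Prod>x\<in>B. f x)
      = (\<Sum>B\<in>Pow A. \<Prod>x\<in>B. f x) + (\<Sum>B\<in>Pow A. \<Prod>x\<in>insert a B. f x)"
    using insert(1) disj by (simp add: Pow_insert sum.union_disjoint sum.reindex[OF inj])
  also have "(\<Sum>B\<in>Pow A. \<Prod>x\<in>insert a B. f x) = (\<Sum>B\<in>Pow A. f a * (\<Prod>x\<in>B. f x))"
  proof (rule sum.cong)
    fix B assume "B \<in> Pow A"
    then have "finite B" "a \<notin> B" using insert(1,2) by (auto intro: finite_subset)
    then show "(\<Prod>x\<in>insert a B. f x) = f a * (\<Prod>x\<in>B. f x)" by simp
  qed simp
  finally show ?case
    using insert by (simp add: sum_distrib_left[symmetric] algebra_simps)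
qed simp

lemma sum_Pow_power:
  fixes x :: real
  assumes "finite A"
  shows "(\<Sum>B\<in>Pow A. x ^ card B) = (1 + x) ^ card A"
  using sum_Pow_prod[OF assms, of "\<lambda>_. x"] by simp

text \<open>Exponential tilting: a set of size at most \<open>k\<close> gets the weight
  \<open>D^(k - |B|)\<close>, which is at least 1, and the weights of all subsets of
  \<open>Z\<close> sum to \<open>D^k (1 + 1/D)^|Z|\<close>. In the container count \<open>D\<close>
  is a power of \<open>d + 1\<close> bounding the growth of \<open>Z\<close> from a seed set, so
  that \<open>n / D\<close> is at most the bound on the seed.\<close>

lemma card_small_subsets:
  fixes k D n :: real
  assumes fin: "finite Z" and n: "real (card Z) \<le> n" and D: "D \<ge> 1"
  shows "real (card {B. B \<subseteq> Z \<and> real (card B) \<le> k}) \<le> exp (k * ln D + n / D)"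
proof -
  let ?B = "{B. B \<subseteq> Z \<and> real (card B) \<le> k}"
  have "real (card ?B) = (\<Sum>B\<in>?B. 1)" by simp
  also have "\<dots> \<le> (\<Sum>B\<in>?B. exp (k * ln D) * (1 / D) ^ card B)"
  proof (rule sum_mono)
    fix B assume "B \<in> ?B"
    then have "real (card B) * ln D \<le> k * ln D" using D by (intro mult_right_mono) auto
    then have "1 \<le> exp (k * ln D - real (card B) * ln D)" by simp
    also have "\<dots> = exp (k * ln D) * (1 / D) ^ card B"
      using D by (simp add: exp_diff exp_of_nat_mult power_one_over divide_inverse power_inverse)
    finally show "1 \<le> exp (k * ln D) * (1 / D) ^ card B" .
  qed
  also have "\<dots> \<le> (\<Sum>B\<in>Pow Z. exp (k * ln D) * (1 / D) ^ card B)"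
    using fin D by (intro sum_mono2) auto
  also have "\<dots> = exp (k * ln D) * (1 + 1 / D) ^ card Z"
    using fin by (simp add: sum_distrib_left[symmetric] sum_Pow_power)
  also have "\<dots> \<le> exp (k * ln D) * exp (1 / D) ^ card Z"
    using D by (intro mult_left_mono power_mono) (auto intro: exp_ge_add_one_self)
  also have "\<dots> = exp (k * ln D + real (card Z) / D)"
    by (simp add: exp_add exp_of_nat_mult[symmetric])
  also have "\<dots> \<le> exp (k * ln D + n / D)"
    using n D by (simp add: divide_right_mono)
  finally show ?thesis .
qed

text \<open>The right-hand side is the expectation of the left-hand side for a \<open>p\<close>-random subset \<open>T\<close>;
  the induction is the method of conditional expectations.\<close>

lemma exists_cheap_cover:
  fixes c :: "'a \<Rightarrow> real" and b p :: real
  assumes "finite V" and "finite U" and p: "0 \<le> p" "p \<le> 1"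
  shows "\<exists>T\<subseteq>V. sum c T + b * real (card {u\<in>U. W u \<inter> T = {}})
           \<le> p * sum c V + b * (\<Sum>u\<in>U. (1 - p) ^ card (W u \<inter> V))"
  using assms(1,2)
proof (induction V arbitrary: U rule: finite_induct)
  case empty
  then show ?case by simp
next
  case (insert v V)
  let ?U = "{u\<in>U. v \<notin> W u}"
  let ?r = "\<lambda>U. p * sum c V + b * (\<Sum>u\<in>U. (1 - p) ^ card (W u \<inter> V))"
  obtain T0 where T0: "T0 \<subseteq> V"
    "sum c T0 + b * real (card {u\<in>U. W u \<inter> T0 = {}}) \<le> ?r U"
    using insert.IH[OF insert.prems] by blast
  have "finite ?U" using insert.prems by simp
  from insert.IH[OF this] obtain T1 where T1: "T1 \<subseteq> V"
    "sum c T1 + b * real (card {u\<in>?U. W u \<inter> T1 = {}}) \<le> ?r ?U"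
    by blast
  let ?goal = "p * sum c (insert v V) + b * (\<Sum>u\<in>U. (1 - p) ^ card (W u \<inter> insert v V))"
  have c: "card (W u \<inter> insert v V) = (if v \<in> W u then Suc (card (W u \<inter> V)) else card (W u \<inter> V))" for u
    using insert.hyps by (simp add: Int_insert_right)
  have split: "sum f U = sum f ?U + sum f {u\<in>U. v \<in> W u}" for f :: "'b \<Rightarrow> real"
    using insert.prems by (subst sum.union_disjoint[symmetric]) (auto intro!: sum.cong)
  have S: "(\<Sum>u\<in>U. (1 - p) ^ card (W u \<inter> insert v V)) = p * (\<Sum>u\<in>?U. (1 - p) ^ card (W u \<inter> V))
      + (1 - p) * (\<Sum>u\<in>U. (1 - p) ^ card (W u \<inter> V))"
  proof -
    have "(\<Sum>u\<in>U. (1 - p) ^ card (W u \<inter> insert v V)) =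
       (\<Sum>u\<in>?U. (1 - p) ^ card (W u \<inter> V)) + (1 - p) * (\<Sum>u\<in>{u\<in>U. v \<in> W u}. (1 - p) ^ card (W u \<inter> V))"
      by (subst split) (simp add: c sum_distrib_left del: Int_insert_right_if0 Int_insert_right_if1 Int_insert_right)
    also have "\<dots> = p * (\<Sum>u\<in>?U. (1 - p) ^ card (W u \<inter> V)) + (1 - p) * (\<Sum>u\<in>U. (1 - p) ^ card (W u \<inter> V))"
      using split[of "\<lambda>u. (1 - p) ^ card (W u \<inter> V)"] by (simp add: algebra_simps)
    finally show ?thesis .
  qed
  \<comment> \<open>Putting \<open>v\<close> into \<open>T\<close> costs \<open>c v\<close> and
    settles every \<open>u\<close> with \<open>v\<close> in \<open>W u\<close>; leaving it out
    settles none. The target is the average of these two outcomes with weights \<open>p\<close> and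
    \<open>1 - p\<close>, so one of them does not exceed it.\<close>
  have eq: "?goal = p * (c v + ?r ?U) + (1 - p) * ?r U"
    using insert.hyps unfolding S by (simp add: algebra_simps)
  have "{u\<in>U. W u \<inter> insert v T1 = {}} = {u\<in>?U. W u \<inter> T1 = {}}" by auto
  moreover have "sum c (insert v T1) = c v + sum c T1"
    using T1(1) insert.hyps by (subst sum.insert) (auto intro: finite_subset)
  ultimately have T1': "sum c (insert v T1) + b * real (card {u\<in>U. W u \<inter> insert v T1 = {}}) \<le> c v + ?r ?U"
    using T1(2) by simp
  consider "c v + ?r ?U \<le> ?goal" | "?r U \<le> ?goal"
  proof -
    have "c v + ?r ?U \<le> ?goal \<or> ?r U \<le> ?goal"
    proof (rule ccontr)
      let ?x = "c v + ?r ?U" and ?y = "?r U"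
      assume "\<not> ?thesis"
      then have "?x > ?goal" "?y > ?goal" by auto
      then have "p * ?x + (1 - p) * ?y > p * ?goal + (1 - p) * ?goal"
        using p by (cases "p = 0") (auto intro!: add_less_le_mono mult_strict_left_mono mult_left_mono)
      then have "p * ?x + (1 - p) * ?y > ?goal" by (simp add: algebra_simps)
      then show False using eq by simp
    qed
    then show ?thesis using that by blast
  qed
  then show ?case
  proof cases
    case 1
    then show ?thesis using T1' T1(1)
      by (intro exI[of _ "insert v T1"] conjI order.trans[OF T1']) auto
  next
    case 2
    then show ?thesis using T0
      by (intro exI[of _ T0] conjI order.trans[OF T0(2)]) auto
  qed
qed

text \<open>Connectivity in cut form, which spares us paths and components. Taking for \<open>R u\<close> the vertices within
  distance \<open>k\<close> of \<open>u\<close> gives \<open>k\<close>-linkedness.\<close>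

definition linked :: "('a \<Rightarrow> 'a set) \<Rightarrow> 'a set \<Rightarrow> bool" where
  "linked R C \<longleftrightarrow> (\<forall>D. D \<subset> C \<and> D \<noteq> {} \<longrightarrow> (\<exists>u\<in>D. \<exists>w\<in>C - D. w \<in> R u))"

section \<open>Walks as codes for linked sets\<close>

fun walks :: "('a \<Rightarrow> 'a set) \<Rightarrow> nat \<Rightarrow> 'a \<Rightarrow> 'a list set" where
  "walks R 0 v = {[v]}"
| "walks R (Suc n) v = (\<Union>u\<in>R v. (#) v ` walks R n u)"

lemma walks_count:
  assumes "\<And>u. u \<in> V \<Longrightarrow> R u \<subseteq> V \<and> finite (R u) \<and> card (R u) \<le> K" and "v \<in> V"
  shows "finite (walks R n v) \<and> card (walks R n v) \<le> K ^ n"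
  using assms(2)
proof (induction n arbitrary: v)
  case (Suc n)
  have R: "R v \<subseteq> V" "finite (R v)" "card (R v) \<le> K" using assms(1)[OF Suc.prems] by auto
  have "card (walks R (Suc n) v) \<le> (\<Sum>u\<in>R v. card ((#) v ` walks R n u))"
    using card_UN_le[OF R(2)] by auto
  also have "\<dots> \<le> (\<Sum>u\<in>R v. K ^ n)"
    using Suc.IH R(1) by (intro sum_mono) (simp add: card_image subset_iff)
  also have "\<dots> \<le> K ^ Suc n" using R(3) by simp
  finally show ?case using R Suc.IH by auto
qed simp

text \<open>At a visit of \<open>u\<close>, the walk steps to \<open>w\<close> and back before it
  goes on, hence the two extra steps.\<close>

lemma walks_detour:
  assumes "xs \<in> walks R n v" "u \<in> set xs" "w \<in> R u" "u \<in> R w"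
  shows "\<exists>ys\<in>walks R (n + 2) v. set ys = insert w (set xs)"
  using assms(1,2)
proof (induction n arbitrary: v xs)
  case 0
  then show ?case using assms(3,4) by (auto simp: numeral_2_eq_2)
next
  case (Suc n)
  then obtain v' xs' where xs: "xs = v # xs'" "v' \<in> R v" "xs' \<in> walks R n v'" by auto
  show ?case
  proof (cases "u = v")
    case True
    have "w # xs \<in> walks R (Suc (Suc n)) w"
      using True assms(4) Suc.prems(1) unfolding walks.simps(2)[of R "Suc n"] by blast
    then have "v # w # xs \<in> walks R (Suc (Suc (Suc n))) v"
      using True assms(3) unfolding walks.simps(2)[of R "Suc (Suc n)"] by blast
    then have "v # w # xs \<in> walks R (Suc n + 2) v" by simp
    then show ?thesis using xs by (intro bexI[of _ "v # w # xs"]) auto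
  next
    case False
    then have "u \<in> set xs'" using Suc.prems xs by simp
    from Suc.IH[OF xs(3) this] obtain ys where "ys \<in> walks R (n + 2) v'" "set ys = insert w (set xs')"
      by metis
    moreover from this have "v # ys \<in> walks R (Suc n + 2) v"
      using xs(2) by (simp only: add_Suc walks.simps) blast
    ultimately show ?thesis using xs by (intro bexI[of _ "v # ys"]) auto
  qed
qed

text \<open>Repeating the start vertex lengthens a walk without changing what it visits, so walks of
  one length encode all sets up to a given size.\<close>

lemma walks_pad:
  assumes "xs \<in> walks R n v" "v \<in> R v"
  shows "\<exists>ys\<in>walks R (n + k) v. set ys = set xs"
proof (induction k)
  case (Suc k)
  then obtain ys where ys: "ys \<in> walks R (n + k) v" "set ys = set xs" by auto
  have "v \<in> set ys"
    using ys(1) by (cases "n + k") auto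
  then show ?case using ys assms(2) by (intro bexI[of _ "v # ys"]) auto
qed (use assms in auto)

text \<open>By the cut condition a visited part smaller than \<open>C\<close> can be extended by one
  more vertex, and each extension is a detour of two steps. This replaces the traversal of a
  spanning tree.\<close>

lemma linked_walk:
  assumes lk: "linked R C" and fin: "finite C" and v: "v \<in> C"
    and sym: "\<And>u w. u \<in> C \<Longrightarrow> w \<in> C \<Longrightarrow> w \<in> R u \<Longrightarrow> u \<in> R w"
  shows "\<exists>xs\<in>walks R (2 * card C - 2) v. set xs = C"
proof -
  have "\<exists>D\<subseteq>C. card D = Suc j \<and> (\<exists>xs\<in>walks R (2 * j) v. set xs = D)" if "Suc j \<le> card C" for j
    using that
  proof (induction j)
    case 0
    then show ?case using v by (intro exI[of _ "{v}"]) auto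
  next
    case (Suc j)
    then obtain D xs where D: "D \<subseteq> C" "card D = Suc j" "xs \<in> walks R (2 * j) v" "set xs = D" by auto
    have "D \<subset> C" "D \<noteq> {}" using D Suc.prems by auto
    then obtain u w where uw: "u \<in> D" "w \<in> C - D" "w \<in> R u"
      using lk unfolding linked_def by metis
    then have "u \<in> R w" using sym D(1) by blast
    from walks_detour[OF D(3) _ uw(3) this] obtain ys
      where "ys \<in> walks R (2 * j + 2) v" "set ys = insert w D"
      using uw(1) D(4) by metis
    then have "ys \<in> walks R (2 * Suc j) v" "set ys = insert w D" by simp_all
    moreover have "card (insert w D) = Suc (Suc j)"
      using uw(2) D(1,2) fin by (subst card_insert_disjoint) (auto intro: finite_subset)
    ultimately show ?case using D(1) uw(2) by (intro exI[of _ "insert w D"]) blast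
  qed
  moreover obtain j where j: "card C = Suc j"
    using v fin by (cases "card C") auto
  ultimately obtain D xs where "D \<subseteq> C" "card D = card C" "xs \<in> walks R (2 * j) v" "set xs = D"
    by (metis order_refl)
  then show ?thesis using j fin by (metis card_subset_eq diff_Suc_1 mult_Suc_right add_diff_cancel_left')
qed

lemma card_linked_sets:
  assumes R: "\<And>u. u \<in> V \<Longrightarrow> R u \<subseteq> V \<and> finite (R u) \<and> card (R u) \<le> K \<and> u \<in> R u"
    and sym: "\<And>u w. u \<in> V \<Longrightarrow> w \<in> V \<Longrightarrow> w \<in> R u \<Longrightarrow> u \<in> R w"
    and v: "v \<in> V" and fin: "finite V"
  shows "card {C. C \<subseteq> V \<and> v \<in> C \<and> linked R C \<and> card C \<le> m} \<le> K ^ (2 * m)"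
proof -
  have K: "K \<ge> 1" using R[OF v] by (metis One_nat_def Suc_leI card_gt_0_iff empty_iff le_trans)
  have W: "finite (walks R (2 * m) v)" "card (walks R (2 * m) v) \<le> K ^ (2 * m)"
    using walks_count[of V R K v] R v by auto
  have "{C. C \<subseteq> V \<and> v \<in> C \<and> linked R C \<and> card C \<le> m} \<subseteq> set ` walks R (2 * m) v"
  proof
    fix C assume "C \<in> {C. C \<subseteq> V \<and> v \<in> C \<and> linked R C \<and> card C \<le> m}"
    then have C: "C \<subseteq> V" "v \<in> C" "linked R C" "card C \<le> m" by auto
    have "finite C" using C(1) fin finite_subset by auto
    then obtain xs where xs: "xs \<in> walks R (2 * card C - 2) v" "set xs = C"
      using linked_walk[OF C(3) _ C(2)] sym C(1) by blast
    have "v \<in> R v" using R v by auto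
    from walks_pad[OF xs(1) this, of "2 * m - (2 * card C - 2)"] obtain ys
      where "ys \<in> walks R (2 * m) v" "set ys = C" using C(4) xs(2) by auto
    then show "C \<in> set ` walks R (2 * m) v" by auto
  qed
  then have "card {C. C \<subseteq> V \<and> v \<in> C \<and> linked R C \<and> card C \<le> m} \<le> card (set ` walks R (2 * m) v)"
    using W(1) by (intro card_mono) auto
  also have "\<dots> \<le> card (walks R (2 * m) v)" using W(1) by (rule card_image_le)
  finally show ?thesis using W(2) by simp
qed

lemma sum_le_sum_cover:
  fixes f :: "'a \<Rightarrow> real"
  assumes "finite I" "\<And>i. i \<in> I \<Longrightarrow> finite (B i)" "A \<subseteq> (\<Union>i\<in>I. B i)" "\<And>x. f x \<ge> 0"
  shows "sum f A \<le> (\<Sum>i\<in>I. sum f (B i))"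
proof -
  have "sum f A \<le> sum f (\<Union>i\<in>I. B i)"
    using assms by (intro sum_mono2) auto
  also have "\<dots> \<le> (\<Sum>i\<in>I. sum f (B i))"
    using assms(1,2)
  proof (induction I rule: finite_induct)
    case (insert i I)
    have "sum f (\<Union>i\<in>insert i I. B i) + sum f (B i \<inter> (\<Union>i\<in>I. B i)) = sum f (B i) + sum f (\<Union>i\<in>I. B i)"
      using insert by (simp add: sum.union_inter)
    moreover have "sum f (B i \<inter> (\<Union>i\<in>I. B i)) \<ge> 0" using assms(4) by (intro sum_nonneg)
    ultimately show ?case using insert by simp
  qed simp
  finally show ?thesis .
qed

lemma power_div_power_exp:
  fixes l :: real
  assumes "l > 0"
  shows "(1 + l) ^ s / (1 + l) ^ g = exp (ln (1 + l) * (real s - real g))"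
  using assms by (simp add: right_diff_distrib exp_diff mult.commute[of "ln _"] exp_of_nat_mult)

lemma sum_Un_le:
  fixes f :: "'b \<Rightarrow> real"
  assumes "finite A" "finite B" "\<And>x. f x \<ge> 0"
  shows "sum f (A \<union> B) \<le> sum f A + sum f B"
proof -
  have "sum f (A \<inter> B) \<ge> 0" using assms(3) by (rule sum_nonneg)
  then show ?thesis using sum.union_inter[OF assms(1,2), of f] by linarith
qed

section \<open>Biregular bipartite graphs of small codegree\<close>

locale biregular =
  fixes X Y :: "'a set" and N :: "'a \<Rightarrow> 'a set" and d :: nat
  assumes finite_X: "finite X" and finite_Y: "finite Y" and disjoint_XY: "X \<inter> Y = {}"
    and N_X: "x \<in> X \<Longrightarrow> N x \<subseteq> Y" and N_Y: "y \<in> Y \<Longrightarrow> N y \<subseteq> X"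
    and card_N: "u \<in> X \<union> Y \<Longrightarrow> card (N u) = d"
    and N_sym: "u \<in> X \<union> Y \<Longrightarrow> w \<in> N u \<Longrightarrow> u \<in> N w"
    and codegree: "u \<in> X \<union> Y \<Longrightarrow> w \<in> X \<union> Y \<Longrightarrow> u \<noteq> w \<Longrightarrow> card (N u \<inter> N w) \<le> 2"
    and d_ge_2: "d \<ge> 2"
begin

definition nbhd :: "'a set \<Rightarrow> 'a set" where
  "nbhd A = \<Union> (N ` A)"

definition cl :: "'a set \<Rightarrow> 'a set" where
  "cl A = {u \<in> X. N u \<subseteq> nbhd A}"

definition wt :: "real \<Rightarrow> 'a set \<Rightarrow> real" where
  "wt l A = l ^ card A / (1 + l) ^ card (nbhd A)"

text \<open>The axioms are symmetric in the two sides, so whatever is proved for \<open>X\<close>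
  transfers to \<open>Y\<close> by interpreting the locale with the sides exchanged.\<close>

lemma swap: "biregular Y X N d"
  using finite_X finite_Y disjoint_XY N_X N_Y card_N N_sym codegree d_ge_2
  by unfold_locales (auto simp: Un_commute)

lemma finite_N: "u \<in> X \<union> Y \<Longrightarrow> finite (N u)"
  using card_N d_ge_2 by (metis card.infinite not_numeral_le_zero)

lemma nbhd_X: "A \<subseteq> X \<Longrightarrow> nbhd A \<subseteq> Y"
  using N_X unfolding nbhd_def by auto

lemma nbhd_Y: "A \<subseteq> Y \<Longrightarrow> nbhd A \<subseteq> X"
  using N_Y unfolding nbhd_def by auto

lemma nbhd_mono: "A \<subseteq> B \<Longrightarrow> nbhd A \<subseteq> nbhd B"
  unfolding nbhd_def by auto

lemma nbhdI: "u \<in> A \<Longrightarrow> w \<in> N u \<Longrightarrow> w \<in> nbhd A"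
  unfolding nbhd_def by auto

lemma finite_nbhd: "A \<subseteq> X \<union> Y \<Longrightarrow> finite (nbhd A)"
  using finite_X finite_Y finite_N unfolding nbhd_def
  by (intro finite_UN_I) (auto intro: finite_subset)

lemma card_nbhd_le: "A \<subseteq> X \<union> Y \<Longrightarrow> card (nbhd A) \<le> d * card A"
proof -
  assume A: "A \<subseteq> X \<union> Y"
  then have fin: "finite A" using finite_X finite_Y finite_subset by blast
  have "card (nbhd A) \<le> (\<Sum>u\<in>A. card (N u))" unfolding nbhd_def using card_UN_le[OF fin] by auto
  also have "\<dots> = d * card A" using card_N A by (subst sum.cong[OF refl, of A _ "\<lambda>_. d"]) auto
  finally show ?thesis .
qed

lemma N_nonempty: "u \<in> X \<union> Y \<Longrightarrow> N u \<noteq> {}"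
  using card_N[of u] d_ge_2 by auto

lemma double_count:
  assumes "P \<subseteq> X \<union> Y" "R \<subseteq> X \<union> Y"
  shows "(\<Sum>x\<in>P. card (N x \<inter> R)) = (\<Sum>y\<in>R. card (N y \<inter> P))"
proof -
  have fin: "finite P" "finite R" using assms finite_X finite_Y by (auto intro: finite_subset)
  have "(\<Sum>x\<in>P. card (N x \<inter> R)) = (\<Sum>x\<in>P. \<Sum>y\<in>R. if y \<in> N x then 1 else 0)"
    using fin by (simp add: sum.If_cases Int_def conj_commute)
  also have "\<dots> = (\<Sum>y\<in>R. \<Sum>x\<in>P. if y \<in> N x then 1 else 0)" by (rule sum.swap)
  also have "\<dots> = (\<Sum>y\<in>R. \<Sum>x\<in>P. if x \<in> N y then 1 else 0)"
    using assms N_sym by (intro sum.cong refl) (auto simp: subset_iff)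
  also have "\<dots> = (\<Sum>y\<in>R. card (N y \<inter> P))"
    using fin by (simp add: sum.If_cases Int_def conj_commute)
  finally show ?thesis .
qed

lemma card_Y_eq: "card Y = card X"
proof -
  have "d * card X = (\<Sum>x\<in>X. card (N x \<inter> Y))"
    using card_N N_X by (subst sum.cong[OF refl, of X _ "\<lambda>_. d"]) (auto simp: Int_absorb2)
  also have "\<dots> = (\<Sum>y\<in>Y. card (N y \<inter> X))" by (rule double_count) auto
  also have "\<dots> = d * card Y"
    using card_N N_Y by (subst sum.cong[OF refl, of Y _ "\<lambda>_. d"]) (auto simp: Int_absorb2)
  finally show ?thesis using d_ge_2 by simp
qed

lemma subset_cl: "A \<subseteq> X \<Longrightarrow> A \<subseteq> cl A"
  unfolding cl_def nbhd_def by auto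

lemma cl_X: "cl A \<subseteq> X" unfolding cl_def by auto

lemma nbhd_cl: "A \<subseteq> X \<Longrightarrow> nbhd (cl A) = nbhd A"
  using nbhd_mono[OF subset_cl[of A]] unfolding cl_def nbhd_def by auto

section \<open>Balls and distances\<close>

fun ball :: "nat \<Rightarrow> 'a set \<Rightarrow> 'a set" where
  "ball 0 S = S"
| "ball (Suc k) S = ball k S \<union> nbhd (ball k S)"

lemma ball_XY: "S \<subseteq> X \<union> Y \<Longrightarrow> ball k S \<subseteq> X \<union> Y"
proof (induction k)
  case (Suc k)
  then have "ball k S \<subseteq> X \<union> Y" by auto
  then show ?case using N_X N_Y unfolding ball.simps nbhd_def by blast
qed auto

lemma card_ball: "S \<subseteq> X \<union> Y \<Longrightarrow> card (ball k S) \<le> (d + 1) ^ k * card S"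
proof (induction k)
  case (Suc k)
  then have b: "ball k S \<subseteq> X \<union> Y" using ball_XY by auto
  have "card (ball (Suc k) S) \<le> card (ball k S) + card (nbhd (ball k S))"
    by (simp add: card_Un_le)
  also have "\<dots> \<le> (d + 1) * card (ball k S)" using card_nbhd_le[OF b] by simp
  also have "\<dots> \<le> (d + 1) * ((d + 1) ^ k * card S)" using Suc by (intro mult_left_mono) auto
  finally show ?case by (simp only: power_Suc mult.assoc)
qed simp

lemma finite_ball: "S \<subseteq> X \<union> Y \<Longrightarrow> finite (ball k S)"
  using ball_XY finite_X finite_Y by (metis finite_Un finite_subset)

lemma ball_mono: "S \<subseteq> T \<Longrightarrow> ball k S \<subseteq> ball k T"
proof (induction k)
  case (Suc k)
  then have "ball k S \<subseteq> ball k T" by simp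
  then show ?case using nbhd_mono[of "ball k S" "ball k T"] unfolding ball.simps by blast
qed simp

lemma subset_ball: "S \<subseteq> ball k S"
  by (induction k) auto

lemma ball_le: "j \<le> k \<Longrightarrow> ball j S \<subseteq> ball k S"
  by (induction k) (auto simp: le_Suc_eq)

lemma ball_ball: "ball j (ball k S) = ball (j + k) S"
  by (induction j) auto

lemma ball_iff: "u \<in> ball k S \<longleftrightarrow> (\<exists>s\<in>S. u \<in> ball k {s})"
proof (induction k arbitrary: u)
  case (Suc k)
  then show ?case unfolding ball.simps nbhd_def by blast
qed auto

lemma ball_in: "u \<in> ball j {s} \<Longrightarrow> j \<le> k \<Longrightarrow> s \<in> S \<Longrightarrow> u \<in> ball k S"
  using ball_le[of j k "{s}"] ball_mono[of "{s}" S k] by blast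

lemma ball_sym:
  assumes "u \<in> X \<union> Y" "w \<in> ball k {u}"
  shows "u \<in> ball k {w}"
  using assms(2)
proof (induction k arbitrary: w)
  case (Suc k)
  have "w \<in> ball k {u} \<or> (\<exists>z\<in>ball k {u}. w \<in> N z)"
    using Suc.prems by (auto simp: nbhd_def)
  then show ?case
  proof
    assume "w \<in> ball k {u}"
    then show ?thesis using Suc.IH by auto
  next
    assume "\<exists>z\<in>ball k {u}. w \<in> N z"
    then obtain z where z: "z \<in> ball k {u}" "w \<in> N z" by auto
    have "z \<in> X \<union> Y" using z(1) ball_XY[of "{u}" k] assms(1) by auto
    then have "z \<in> N w" using z(2) N_sym by auto
    then have "{z} \<subseteq> ball 1 {w}" by (auto simp: nbhd_def)
    then have "ball k {z} \<subseteq> ball k (ball 1 {w})" by (rule ball_mono)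
    then have "ball k {z} \<subseteq> ball (k + 1) {w}" by (simp only: ball_ball)
    moreover have "u \<in> ball k {z}" using Suc.IH z(1) by simp
    ultimately show ?thesis by auto
  qed
qed auto

lemma ball_trans: "u \<in> ball j {w} \<Longrightarrow> w \<in> ball k {s} \<Longrightarrow> u \<in> ball (j + k) {s}"
  using ball_mono[of "{w}" "ball k {s}" j] ball_ball by auto

lemma ball_1: "w \<in> N u \<Longrightarrow> w \<in> ball 1 {u}"
  by (auto simp: nbhd_def)

abbreviation N2 :: "'a \<Rightarrow> 'a set" where
  "N2 u \<equiv> nbhd (N u)"

lemma N2_X: "u \<in> X \<Longrightarrow> N2 u \<subseteq> X"
  using N_X nbhd_Y by simp

lemma N2_ball: "w \<in> N2 u \<Longrightarrow> w \<in> ball 2 {u}"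
  by (auto simp: nbhd_def numeral_2_eq_2)

lemma card_N2: "u \<in> X \<Longrightarrow> card (N2 u) \<le> d * d"
  using card_nbhd_le[of "N u"] card_N[of u] N_X by auto

lemma self_N2: "u \<in> X \<union> Y \<Longrightarrow> u \<in> N2 u"
  using N_nonempty[of u] N_sym unfolding nbhd_def by blast

lemma N2_sym: "u \<in> X \<Longrightarrow> w \<in> N2 u \<Longrightarrow> u \<in> N2 w"
  using N_sym N_X unfolding nbhd_def by blast

lemma cl_near:
  assumes "A \<subseteq> X" "u \<in> cl A"
  shows "\<exists>a\<in>A. a \<in> ball 2 {u}"
proof -
  have u: "u \<in> X" "N u \<subseteq> nbhd A" using assms(2) unfolding cl_def by auto
  obtain y where y: "y \<in> N u" using N_nonempty u(1) by auto
  then obtain a where a: "a \<in> A" "y \<in> N a" using u(2) unfolding nbhd_def by auto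
  have "a \<in> N y" using a assms(1) N_sym by auto
  then have "a \<in> N2 u" using y by (auto simp: nbhd_def)
  then show ?thesis using a(1) N2_ball by auto
qed

text \<open>Each member of \<open>S\<close> has \<open>d - 1\<close> neighbours other than
  \<open>u\<close>, and such a neighbour is reached at most twice because it shares at most two
  neighbours with \<open>u\<close>. For \<open>S\<close> of size at least \<open>d / 2\<close> the
  second neighbourhood is thus of order \<open>d^2\<close>.\<close>

lemma card_nbhd_ge_codegree:
  assumes u: "u \<in> X \<union> Y" and S: "S \<subseteq> N u"
  shows "card S * (d - 1) \<le> 2 * card (nbhd S)"
proof -
  have Nu: "N u \<subseteq> X \<union> Y" using u N_X N_Y by auto
  then have SXY: "S \<subseteq> X \<union> Y" using S by auto
  have nS: "nbhd S \<subseteq> X \<union> Y" using SXY ball_XY[of S 1] by auto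
  have fin: "finite (nbhd S)" by (rule finite_nbhd[OF SXY])
  have "card S * (d - 1) = (\<Sum>w\<in>S. card (N w \<inter> (nbhd S - {u})))"
  proof -
    have "card (N w \<inter> (nbhd S - {u})) = d - 1" if "w \<in> S" for w
    proof -
      have "N w \<inter> (nbhd S - {u}) = N w - {u}" using that by (auto simp: nbhd_def)
      moreover have "u \<in> N w" using N_sym[OF u] that S by auto
      ultimately show ?thesis using card_N[of w] finite_N[of w] that SXY by auto
    qed
    then show ?thesis by simp
  qed
  also have "\<dots> = (\<Sum>y\<in>nbhd S - {u}. card (N y \<inter> S))"
    using SXY nS by (intro double_count) auto
  also have "\<dots> \<le> (\<Sum>y\<in>nbhd S - {u}. 2)"
  proof (rule sum_mono)
    fix y assume y: "y \<in> nbhd S - {u}"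
    have "card (N y \<inter> S) \<le> card (N y \<inter> N u)"
      using S finite_N[of y] y nS by (intro card_mono) auto
    also have "\<dots> \<le> 2" using y nS u by (intro codegree) auto
    finally show "card (N y \<inter> S) \<le> 2" .
  qed
  also have "\<dots> \<le> 2 * card (nbhd S)" using fin by (simp add: card_mono)
  finally show ?thesis .
qed

text \<open>Greedy choice: a vertex is either added or already meets a chosen neighbourhood. The
  proviso \<open>N s \<noteq> {}\<close> covers a chosen \<open>s\<close>, which has to meet its own
  neighbourhood.\<close>

lemma packing:
  assumes "finite S"
  shows "\<exists>U\<subseteq>S. (\<forall>u\<in>U. \<forall>u'\<in>U. u \<noteq> u' \<longrightarrow> N u \<inter> N u' = {}) \<and>
     (\<forall>s\<in>S. N s \<noteq> {} \<longrightarrow> (\<exists>u\<in>U. N s \<inter> N u \<noteq> {}))"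
  using assms
proof (induction S rule: finite_induct)
  case (insert s S)
  then obtain U where U: "U \<subseteq> S" "\<forall>u\<in>U. \<forall>u'\<in>U. u \<noteq> u' \<longrightarrow> N u \<inter> N u' = {}"
    "\<forall>s\<in>S. N s \<noteq> {} \<longrightarrow> (\<exists>u\<in>U. N s \<inter> N u \<noteq> {})" by auto
  show ?case
  proof (cases "\<exists>u\<in>U. N s \<inter> N u \<noteq> {}")
    case True
    then show ?thesis using U by (intro exI[of _ U]) auto
  next
    case False
    then show ?thesis using U by (intro exI[of _ "insert s U"]) auto
  qed
qed auto

lemma card_nbhd_packing:
  assumes "U \<subseteq> X \<union> Y" "\<forall>u\<in>U. \<forall>u'\<in>U. u \<noteq> u' \<longrightarrow> N u \<inter> N u' = {}"
  shows "card (nbhd U) = d * card U"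
proof -
  have "finite U" using assms(1) finite_X finite_Y finite_subset by blast
  then have "card (nbhd U) = (\<Sum>u\<in>U. card (N u))"
    unfolding nbhd_def using assms finite_N by (intro card_UN_disjoint) auto
  also have "\<dots> = d * card U" using card_N assms(1) by (subst sum.cong[OF refl, of U _ "\<lambda>_. d"]) auto
  finally show ?thesis .
qed

text \<open>As long as some vertex covers more than \<open>\<psi>\<close> new elements, adding it
  preserves the ratio of \<open>\<psi>\<close> covered elements per chosen vertex. If this never
  stopped, there would be admissible subsets of \<open>U0\<close> larger than
  \<open>U0\<close>.\<close>

lemma greedy_cover:
  fixes \<psi> :: real
  assumes "finite U0" "finite Z" and psi: "\<psi> \<ge> 0"
  shows "\<exists>U\<subseteq>U0. \<psi> * card U \<le> card (Z \<inter> nbhd U) \<and> (\<forall>u\<in>U0. card (N u \<inter> (Z - nbhd U)) \<le> \<psi>)"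
proof (rule ccontr)
  assume neg: "\<not> ?thesis"
  let ?P = "\<lambda>U. U \<subseteq> U0 \<and> \<psi> * card U \<le> card (Z \<inter> nbhd U)"
  have "\<exists>U. ?P U \<and> card U = n" for n
  proof (induction n)
    case 0
    show ?case by (intro exI[of _ "{}"]) auto
  next
    case (Suc n)
    then obtain U where U: "?P U" "card U = n" by auto
    with neg obtain u where u: "u \<in> U0" "card (N u \<inter> (Z - nbhd U)) > \<psi>"
      by (metis not_le)
    have "N u \<inter> (Z - nbhd U) \<noteq> {}" using u(2) psi by auto
    then have uU: "u \<notin> U" by (auto simp: nbhd_def)
    have fU: "finite U" using U(1) assms(1) finite_subset by auto
    have "Z \<inter> nbhd (insert u U) = (Z \<inter> nbhd U) \<union> (N u \<inter> (Z - nbhd U))"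
      by (auto simp: nbhd_def)
    then have "card (Z \<inter> nbhd (insert u U)) = card (Z \<inter> nbhd U) + card (N u \<inter> (Z - nbhd U))"
      using assms(2) by (simp add: card_Un_disjoint disjoint_iff)
    then show ?case using U u uU fU
      by (intro exI[of _ "insert u U"]) (auto simp: algebra_simps)
  qed
  then obtain U where "?P U" "card U = Suc (card U0)" by blast
  then show False using card_mono[OF assms(1)] by (metis Suc_n_not_le_n)
qed

subsection \<open>Approximation by containers\<close>

lemma nbhd_Int_cl: "A \<subseteq> X \<Longrightarrow> u \<in> cl A \<Longrightarrow> N u \<inter> nbhd A = N u"
  unfolding cl_def by auto

text \<open>All \<open>d\<close> neighbours of a closure vertex lie in \<open>nbhd A\<close>, so of
  the \<open>d * card (nbhd A)\<close> edges at \<open>nbhd A\<close> exactly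
  \<open>d * card (cl A)\<close> lead back to the closure. The difference \<open>t\<close> of the
  two sizes measures the boundary in all that follows.\<close>

lemma edges_leaving:
  assumes A: "A \<subseteq> X"
  shows "card (cl A) \<le> card (nbhd A)"
    and "(\<Sum>v\<in>nbhd A. real (card (N v - cl A))) = real d * (real (card (nbhd A)) - real (card (cl A)))"
proof -
  have G: "nbhd A \<subseteq> Y" by (rule nbhd_X[OF A])
  have "(\<Sum>v\<in>nbhd A. card (N v \<inter> cl A)) = (\<Sum>u\<in>cl A. card (N u \<inter> nbhd A))"
    using G cl_X by (intro double_count) auto
  also have "\<dots> = (\<Sum>u\<in>cl A. d)"
    using nbhd_Int_cl[OF A] card_N cl_X by (intro sum.cong refl) (auto simp: subset_iff)
  finally have 1: "(\<Sum>v\<in>nbhd A. card (N v \<inter> cl A)) = card (cl A) * d" by simp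
  have 2: "real (card (N v - cl A)) = real d - real (card (N v \<inter> cl A))" if "v \<in> nbhd A" for v
  proof -
    have "v \<in> X \<union> Y" using that G by auto
    then have "card (N v - cl A) + card (N v \<inter> cl A) = d"
      using card_N[of v] finite_N[of v] by (subst card_Un_disjoint[symmetric]) (auto simp: Un_Diff_Int Int_commute)
    then show ?thesis by linarith
  qed
  then have "(\<Sum>v\<in>nbhd A. real (card (N v - cl A))) = real d * real (card (nbhd A)) - real (\<Sum>v\<in>nbhd A. card (N v \<inter> cl A))"
    by (simp add: sum_subtractf)
  also have "\<dots> = real d * (real (card (nbhd A)) - real (card (cl A)))"
    unfolding 1 by (simp add: algebra_simps)
  finally show 3: "(\<Sum>v\<in>nbhd A. real (card (N v - cl A))) = real d * (real (card (nbhd A)) - real (card (cl A)))" .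
  have "0 \<le> real d * (real (card (nbhd A)) - real (card (cl A)))"
    unfolding 3[symmetric] by (rule sum_nonneg) auto
  then show "card (cl A) \<le> card (nbhd A)" using d_ge_2 by (simp add: zero_le_mult_iff)
qed

definition heavy :: "'a set \<Rightarrow> 'a set" where
  "heavy A = {v \<in> nbhd A. d \<le> 2 * card (N v \<inter> cl A)}"

text \<open>A vertex that is not heavy sends more than half of its \<open>d\<close> edges out of the
  closure, and only \<open>d t\<close> edges leave it.\<close>

lemma card_light:
  assumes A: "A \<subseteq> X"
  shows "real (card (nbhd A - heavy A)) \<le> 2 * (real (card (nbhd A)) - real (card (cl A)))"
proof -
  have G: "nbhd A \<subseteq> Y" by (rule nbhd_X[OF A])
  have fin: "finite (nbhd A)" using finite_nbhd A by auto
  have "real (card (nbhd A - heavy A)) * (d / 2) = (\<Sum>v\<in>nbhd A - heavy A. real d / 2)" by simp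
  also have "\<dots> \<le> (\<Sum>v\<in>nbhd A - heavy A. real (card (N v - cl A)))"
  proof (rule sum_mono)
    fix v assume v: "v \<in> nbhd A - heavy A"
    then have "v \<in> X \<union> Y" using G by auto
    then have "card (N v - cl A) + card (N v \<inter> cl A) = d"
      using card_N[of v] finite_N[of v] by (subst card_Un_disjoint[symmetric]) (auto simp: Un_Diff_Int Int_commute)
    moreover have "2 * card (N v \<inter> cl A) < d" using v unfolding heavy_def by auto
    ultimately show "real d / 2 \<le> real (card (N v - cl A))" by linarith
  qed
  also have "\<dots> \<le> (\<Sum>v\<in>nbhd A. real (card (N v - cl A)))"
    using fin by (intro sum_mono2) auto
  also have "\<dots> = real d * (real (card (nbhd A)) - real (card (cl A)))" by (rule edges_leaving[OF A])
  finally have "real d * (real (card (nbhd A - heavy A)) / 2) \<le> real d * (real (card (nbhd A)) - real (card (cl A)))"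
    by (simp add: algebra_simps)
  then show ?thesis using d_ge_2 by simp
qed

text \<open>A set computed from \<open>Q\<close> and \<open>\<Omega>\<close> alone, so that it can
  be counted without knowing \<open>A\<close>. When \<open>P = Q \<inter> Y\<close> lies in
  \<open>N(A)\<close> and \<open>\<Omega>\<close> is \<open>N(P)\<close> minus the closure, it
  equals \<open>N(N(P) \<inter> [A])\<close> together with \<open>P\<close>, a subset of
  \<open>N(A)\<close>.\<close>

definition core :: "'a set \<Rightarrow> 'a set \<Rightarrow> 'a set" where
  "core Q \<Omega> = nbhd (nbhd (Q \<inter> Y) - \<Omega>) \<union> (Q \<inter> Y)"

text \<open>Sapozhenko's first approximation. \<open>Q\<close> consists of a cheap random-like \<open>T \<subseteq> N(A)\<close>, the heavy
  vertices not reached from \<open>T\<close> by a path of length two through the closure, and a maximal packing of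
  closure vertices without heavy neighbours. \<open>\<Omega>\<close> records which neighbours of \<open>Q\<close> leave the closure.\<close>

lemma core_set:
  fixes t :: real
  assumes A: "A \<subseteq> X"
    and t: "t = real (card (nbhd A)) - real (card (cl A))"
    and iso: "2 * real (card (nbhd A)) \<le> 5 * real d * t"
    and large: "32 * ln (real d + 1) \<le> (real d)\<^sup>2"
  defines "m \<equiv> 120 * ln (real d + 1) * t / real d"
  shows "\<exists>Q \<Omega>. Q \<subseteq> cl A \<union> nbhd A \<and> cl A \<subseteq> ball 3 Q \<and> real (card Q) \<le> m
     \<and> \<Omega> \<subseteq> nbhd (Q \<inter> Y) \<and> real (card \<Omega>) \<le> m
     \<and> core Q \<Omega> \<subseteq> nbhd A \<and> real (card (nbhd A - core Q \<Omega>)) \<le> 2 * t"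
proof -
  define G C H where "G = nbhd A" and "C = cl A" and "H = heavy A"
  define l where "l = ln (real d + 1)"
  \<comment> \<open>With this density a heavy vertex, for which \<open>W u\<close> has at least
    \<open>d^2 / 8\<close> elements, is missed by \<open>T\<close> with probability at most
    \<open>(d + 1)^(-4)\<close>.\<close>
  define p where "p = 32 * l / (real d)\<^sup>2"
  define W where "W u = nbhd (N u \<inter> C)" for u
  \<comment> \<open>The cost of \<open>v\<close> pays for \<open>v\<close> in \<open>Q\<close> and
    for its neighbours outside the closure in \<open>\<Omega>\<close>. An unreached heavy vertex is
    charged \<open>d + 1\<close>, for itself and all its neighbours.\<close>
  define c where "c v = 1 + real (card (N v - C))" for v
  have d2: "real d \<ge> 2" using d_ge_2 by simp
  have l1: "l \<ge> 1" unfolding l_def using d_ge_2 by (rule one_le_ln)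
  have p: "0 \<le> p" "p \<le> 1" using l1 large d2 unfolding p_def l_def[symmetric] by auto
  have GY: "G \<subseteq> Y" unfolding G_def by (rule nbhd_X[OF A])
  have CX: "C \<subseteq> X" unfolding C_def by (rule cl_X)
  have nC: "nbhd C = G" unfolding C_def G_def by (rule nbhd_cl[OF A])
  have HG: "H \<subseteq> G" unfolding H_def G_def heavy_def by auto
  have finG: "finite G" using GY finite_Y finite_subset by auto
  have finC: "finite C" using CX finite_X finite_subset by auto
  have WG: "W u \<subseteq> G" for u unfolding W_def nC[symmetric] by (intro nbhd_mono) auto
  have t0: "t \<ge> 0" using edges_leaving(1)[OF A] t by simp
  have g: "real (card G) \<le> 5 / 2 * real d * t" using iso unfolding G_def by simp

  obtain T where T: "T \<subseteq> G" and
    Tc: "sum c T + (real d + 1) * real (card {u\<in>H. W u \<inter> T = {}})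
       \<le> p * sum c G + (real d + 1) * (\<Sum>u\<in>H. (1 - p) ^ card (W u \<inter> G))"
    using exists_cheap_cover[OF finG finite_subset[OF HG finG] p, of c "real d + 1" W] by auto
  define H0 where "H0 = {u\<in>H. W u \<inter> T = {}}"
  have finT: "finite T" using T finG finite_subset by auto
  have "sum c G = real (card G) + real d * t"
    unfolding c_def sum.distrib using edges_leaving(2)[OF A] t by (simp add: G_def C_def)
  also have "\<dots> \<le> 7 / 2 * real d * t" using g by (simp add: algebra_simps)
  finally have "p * sum c G \<le> p * (7 / 2 * real d * t)" using p by (intro mult_left_mono)
  also have "\<dots> = 112 * l * t / real d" using d2 unfolding p_def by (simp add: field_simps power2_eq_square)
  finally have b1: "p * sum c G \<le> 112 * l * t / real d" .
  have "(1 - p) ^ card (W u \<inter> G) \<le> 1 / (real d + 1) ^ 4" if u: "u \<in> H" for u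
  proof -
    have uG: "u \<in> X \<union> Y" using u HG GY by auto
    have h: "2 * card (N u \<inter> C) \<ge> d" using u unfolding H_def heavy_def C_def by auto
    have "card (N u \<inter> C) * (d - 1) \<le> 2 * card (W u)"
      unfolding W_def by (rule card_nbhd_ge_codegree[OF uG]) auto
    then have "real (card (N u \<inter> C)) * real (d - 1) \<le> 2 * real (card (W u))"
      by (metis of_nat_le_iff of_nat_mult of_nat_numeral)
    moreover have "real d / 2 * (real d / 2) \<le> real (card (N u \<inter> C)) * real (d - 1)"
      using h d_ge_2 by (intro mult_mono) linarith+
    ultimately have cW: "(real d)\<^sup>2 / 8 \<le> real (card (W u))" by (simp add: power2_eq_square)
    have "W u \<inter> G = W u" using WG by auto
    then have "(1 - p) ^ card (W u \<inter> G) = (1 - p) ^ card (W u)" by simp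
    also have "\<dots> \<le> exp (- p) ^ card (W u)"
      using p exp_ge_add_one_self[of "- p"] by (intro power_mono) auto
    also have "\<dots> = exp (- (p * real (card (W u))))" by (simp add: exp_of_nat_mult[symmetric] mult.commute)
    also have "\<dots> \<le> exp (- (p * ((real d)\<^sup>2 / 8)))"
      using mult_left_mono[OF cW p(1)] by simp
    also have "p * ((real d)\<^sup>2 / 8) = 4 * l" using d2 unfolding p_def by simp
    also have "exp (- (4 * l)) = 1 / (real d + 1) ^ 4"
      using d2 exp_of_nat_mult[of 4 l] unfolding l_def by (simp add: exp_minus divide_inverse)
    finally show ?thesis .
  qed
  then have "(\<Sum>u\<in>H. (1 - p) ^ card (W u \<inter> G)) \<le> real (card H) * (1 / (real d + 1) ^ 4)"
    by (rule sum_bounded_above)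
  also have "\<dots> \<le> real (card G) * (1 / (real d + 1) ^ 4)"
    using HG finG by (intro mult_right_mono) (auto intro: card_mono)
  finally have "(real d + 1) * (\<Sum>u\<in>H. (1 - p) ^ card (W u \<inter> G)) \<le> (real d + 1) * (real (card G) * (1 / (real d + 1) ^ 4))"
    using d2 by (intro mult_left_mono) auto
  also have "\<dots> = real (card G) / (real d + 1) ^ 3" by (simp add: power_eq_if)
  also have "\<dots> \<le> (5 / 2 * real d * t) / (real d + 1) ^ 3"
    using g d2 by (intro divide_right_mono) auto
  also have "\<dots> \<le> (5 / 2 * real d * t) / (real d * real d)"
  proof (rule divide_left_mono)
    have "real d * real d * 1 \<le> (real d + 1) * (real d + 1) * (real d + 1)" by (intro mult_mono) auto
    then show "real d * real d \<le> (real d + 1) ^ 3" by (simp add: power3_eq_cube)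
  qed (use d2 t0 in auto)
  also have "\<dots> = 5 / 2 * t / real d" using d2 by simp
  also have "\<dots> \<le> 5 / 2 * l * t / real d" using d2 t0 l1
    by (intro divide_right_mono) (auto intro: mult_right_mono[of 1 l t, simplified])
  finally have b2: "(real d + 1) * (\<Sum>u\<in>H. (1 - p) ^ card (W u \<inter> G)) \<le> 5 / 2 * l * t / real d" .
  have TH: "sum c T + (real d + 1) * real (card H0) \<le> 115 * l * t / real d"
  proof -
    have "112 * l * t / real d + 5 / 2 * l * t / real d \<le> 115 * l * t / real d"
      unfolding add_divide_distrib[symmetric] using d2 t0 l1 by (intro divide_right_mono) auto
    then show ?thesis using Tc b1 b2 unfolding H0_def by linarith
  qed

  \<comment> \<open>Members of \<open>C'\<close> have no heavy neighbours. Disjoint neighbourhoods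
    of size \<open>d\<close> must fit into the at most \<open>2 t\<close> vertices that are not
    heavy, which bounds the packing by \<open>2 t / d\<close>.\<close>
  define C' where "C' = {u\<in>C. N u \<inter> H = {}}"
  obtain U where U: "U \<subseteq> C'" "\<forall>u\<in>U. \<forall>u'\<in>U. u \<noteq> u' \<longrightarrow> N u \<inter> N u' = {}"
     "\<forall>s\<in>C'. N s \<noteq> {} \<longrightarrow> (\<exists>u\<in>U. N s \<inter> N u \<noteq> {})"
    using packing[of C'] finC unfolding C'_def by auto
  have UC: "U \<subseteq> C" using U(1) unfolding C'_def by auto
  have "nbhd U \<subseteq> G - H"
    using U(1) nC unfolding C'_def nbhd_def by auto
  then have "card (nbhd U) \<le> card (G - H)" using finG by (intro card_mono) auto
  moreover have "U \<subseteq> X \<union> Y" using UC CX by auto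
  then have "card (nbhd U) = d * card U" using U(2) by (rule card_nbhd_packing)
  ultimately have "real (d * card U) \<le> real (card (G - H))" by (simp only: of_nat_le_iff)
  also have GH: "real (card (G - H)) \<le> 2 * t"
    using card_light[OF A] t unfolding G_def H_def by simp
  finally have "real (card U) \<le> 2 * t / real d" using d2 by (simp add: field_simps)
  also have "\<dots> \<le> 2 * l * t / real d"
    using d2 t0 l1 by (intro divide_right_mono) (auto intro: mult_right_mono[of 1 l t, simplified])
  finally have cU: "real (card U) \<le> 2 * l * t / real d" .

  define P where "P = T \<union> H0"
  define Q where "Q = P \<union> U"
  define \<Omega> where "\<Omega> = nbhd P - C"
  have PG: "P \<subseteq> G" using T HG unfolding P_def H0_def by auto
  have QY: "Q \<inter> Y = P" using PG GY UC CX disjoint_XY unfolding Q_def by auto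
  have card_T: "real (card T) \<le> sum c T" and c_nn: "c v \<ge> 0" for v
    using sum_mono[of T "\<lambda>_. 1" c] unfolding c_def by auto
  have "real (card Q) \<le> real (card T) + real (card H0) + real (card U)"
    using card_Un_le[of P U] card_Un_le[of T H0] unfolding Q_def P_def by linarith
  also have "\<dots> \<le> (sum c T + (real d + 1) * real (card H0)) + real (card U)"
    using card_T d2 mult_right_mono[of 1 "real d + 1" "real (card H0)"] by auto
  also have "\<dots> \<le> 115 * l * t / real d + 2 * l * t / real d" using TH cU by linarith
  also have "\<dots> \<le> m" unfolding m_def l_def[symmetric] add_divide_distrib[symmetric]
    using d2 t0 l1 by (intro divide_right_mono) auto
  finally have cQ: "real (card Q) \<le> m" .

  have TXY: "T \<subseteq> X \<union> Y" and H0XY: "H0 \<subseteq> X \<union> Y"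
    using T HG GY unfolding H0_def by auto
  have "card \<Omega> \<le> card ((\<Union>v\<in>T. N v - C) \<union> nbhd H0)"
  proof (rule card_mono)
    show "finite ((\<Union>v\<in>T. N v - C) \<union> nbhd H0)"
      using finT finite_N TXY finite_nbhd[OF H0XY] by (auto intro!: finite_UN_I)
  qed (auto simp: \<Omega>_def P_def nbhd_def)
  also have "\<dots> \<le> (\<Sum>v\<in>T. card (N v - C)) + d * card H0"
    by (intro order.trans[OF card_Un_le] add_mono card_UN_le[OF finT] card_nbhd_le[OF H0XY])
  finally have "real (card \<Omega>) \<le> real ((\<Sum>v\<in>T. card (N v - C)) + d * card H0)" by (rule of_nat_mono)
  also have "\<dots> \<le> sum c T + (real d + 1) * real (card H0)"
    unfolding c_def by (simp add: sum.distrib algebra_simps)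
  also have "\<dots> \<le> 115 * l * t / real d" by (rule TH)
  also have "\<dots> \<le> m" unfolding m_def l_def[symmetric]
    using d2 t0 l1 by (intro divide_right_mono) auto
  finally have cO: "real (card \<Omega>) \<le> m" .

  have QCG: "Q \<subseteq> C \<union> G" using PG UC unfolding Q_def by auto
  \<comment> \<open>The distance is 2 through the packing, 1 from an unreached heavy neighbour, and
    otherwise 3 along the path \<open>s\<close>, \<open>w\<close>, \<open>v\<close>,
    \<open>u\<close> that starts in \<open>T\<close>.\<close>
  have CQ: "C \<subseteq> ball 3 Q"
  proof
    fix u assume u: "u \<in> C"
    then have uX: "u \<in> X" using CX by auto
    show "u \<in> ball 3 Q"
    proof (cases "N u \<inter> H = {}")
      case True
      then have "u \<in> C'" using u unfolding C'_def by auto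
      then obtain u' y where u': "u' \<in> U" "y \<in> N u" "y \<in> N u'"
        using U(3) N_nonempty[of u] uX by blast
      then have "u \<in> N2 u'" using N_sym[of u y] uX by (auto simp: nbhd_def)
      then have "u \<in> ball 2 {u'}" by (rule N2_ball)
      then show ?thesis by (rule ball_in) (use u'(1) in \<open>auto simp: Q_def\<close>)
    next
      case False
      then obtain v where v: "v \<in> N u" "v \<in> H" by auto
      have vY: "v \<in> Y" using v(2) HG GY by auto
      have uv: "u \<in> N v" using v uX N_sym by auto
      show ?thesis
      proof (cases "v \<in> H0")
        case True
        from ball_1[OF uv] show ?thesis
          by (rule ball_in) (use True in \<open>auto simp: Q_def P_def\<close>)
      next
        case False
        then obtain s w where s: "s \<in> T" "s \<in> N w" "w \<in> N v" "w \<in> C"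
          using v(2) unfolding H0_def W_def nbhd_def by auto
        have "v \<in> N w" using s vY N_sym by auto
        moreover have "w \<in> N s" using s CX N_sym by auto
        ultimately have "w \<in> ball 1 {s}" "v \<in> ball 1 {w}" "u \<in> ball 1 {v}" using uv ball_1 by auto
        then have "u \<in> ball (1 + (1 + 1)) {s}" using ball_trans by blast
        then show ?thesis by (rule ball_in) (use s(1) in \<open>auto simp: Q_def P_def\<close>)
      qed
    qed
  qed
  have core: "core Q \<Omega> = nbhd (nbhd P \<inter> C) \<union> P"
    unfolding core_def QY \<Omega>_def by (simp add: Diff_Diff_Int)
  have coreG: "core Q \<Omega> \<subseteq> G"
    unfolding core using PG nC nbhd_mono[of "nbhd P \<inter> C" C] by auto
  \<comment> \<open>An unreached heavy vertex is in \<open>P\<close> itself; any other has a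
    neighbour \<open>w\<close> in the closure that is adjacent to \<open>T\<close>. The core
    therefore misses only vertices that are not heavy.\<close>
  have "H \<subseteq> core Q \<Omega>"
  proof
    fix v assume v: "v \<in> H"
    then have vY: "v \<in> Y" using HG GY by auto
    show "v \<in> core Q \<Omega>"
    proof (cases "v \<in> H0")
      case True
      then show ?thesis unfolding core P_def by auto
    next
      case False
      then obtain s w where s: "s \<in> T" "s \<in> N w" "w \<in> N v" "w \<in> C"
        using v unfolding H0_def W_def nbhd_def by auto
      have "v \<in> N w" "w \<in> N s" using s vY CX N_sym by auto
      then show ?thesis using s unfolding core P_def nbhd_def by auto
    qed
  qed
  then have "card (G - core Q \<Omega>) \<le> card (G - H)" using finG by (intro card_mono) auto
  then have "real (card (G - core Q \<Omega>)) \<le> 2 * t" using GH by linarith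
  then show ?thesis
    using QCG CQ cQ cO coreG QY unfolding G_def C_def \<Omega>_def
    by (intro exI[of _ Q] exI[of _ "nbhd P - cl A"]) auto
qed

text \<open>Every point of \<open>Q\<close> is within 3 of \<open>A\<close> and every point of
  \<open>A\<close> within 3 of \<open>Q\<close>, so a step of length 2 inside \<open>A\<close>
  becomes one of length at most 3 + 2 + 3 = 8 inside \<open>Q\<close>.\<close>

lemma linked_core:
  assumes A: "A \<subseteq> X" "linked N2 A"
    and Q: "Q \<subseteq> cl A \<union> nbhd A" and AQ: "A \<subseteq> ball 3 Q"
  shows "linked (\<lambda>u. ball 8 {u}) Q"
  unfolding linked_def
proof (intro allI impI)
  fix D assume D: "D \<subset> Q \<and> D \<noteq> {}"
  have near: "\<exists>a\<in>A. a \<in> ball 3 {q}" if q: "q \<in> Q" for q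
  proof (cases "q \<in> cl A")
    case True
    then show ?thesis using cl_near[OF A(1)] ball_le[of 2 3 "{q}"] by auto
  next
    case False
    then obtain a where "a \<in> A" "q \<in> N a" using q Q unfolding nbhd_def by auto
    then have "a \<in> A" "a \<in> ball 1 {q}" using N_sym[of a q] A(1) ball_1 by auto
    then show ?thesis using ball_le[of 1 3 "{q}"] by auto
  qed
  have QXY: "Q \<subseteq> X \<union> Y" using Q cl_X nbhd_X[OF A(1)] by auto
  have link: "\<exists>u\<in>D. \<exists>w\<in>Q - D. w \<in> ball 8 {u}"
    if "q \<in> D" "q' \<in> Q - D" "a \<in> ball 3 {q}" "a' \<in> ball 3 {q'}" "a' \<in> ball 2 {a}" for q q' a a'
  proof -
    have "q' \<in> ball 3 {a'}" using ball_sym[of q' a' 3] that QXY by auto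
    then have "q' \<in> ball (3 + 2) {a}" using that ball_trans by blast
    then have "q' \<in> ball (3 + 2 + 3) {q}" using that ball_trans by blast
    then show ?thesis using that by auto
  qed
  define AD where "AD = {a\<in>A. \<exists>q\<in>D. a \<in> ball 3 {q}}"
  have "AD \<noteq> {}" using D near unfolding AD_def by blast
  show "\<exists>u\<in>D. \<exists>w\<in>Q - D. w \<in> ball 8 {u}"
  proof (cases "AD = A")
    case True
    obtain q' where q': "q' \<in> Q - D" using D by auto
    then obtain a where a: "a \<in> A" "a \<in> ball 3 {q'}" using near by auto
    then obtain q where "q \<in> D" "a \<in> ball 3 {q}" using True unfolding AD_def by auto
    then show ?thesis using link[of q q' a a] q' a subset_ball[of "{a}" 2] by auto
  next
    case False
    then have "AD \<subset> A" unfolding AD_def by auto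
    then obtain a a' where a: "a \<in> AD" "a' \<in> A - AD" "a' \<in> N2 a"
      using A(2) \<open>AD \<noteq> {}\<close> unfolding linked_def by metis
    obtain q where q: "q \<in> D" "a \<in> ball 3 {q}" using a(1) unfolding AD_def by auto
    obtain q' where q': "q' \<in> Q" "a' \<in> ball 3 {q'}"
      using a(2) AQ ball_iff[of a' 3 Q] by auto
    have "q' \<notin> D" using a(2) q' unfolding AD_def by auto
    then show ?thesis using link[of q q' a a'] q q' N2_ball[OF a(3)] by auto
  qed
qed

text \<open>Like \<open>core\<close>, this and the next two sets are determined by the code
  \<open>Q\<close>, \<open>\<Omega>\<close>, \<open>U\<close>, \<open>W\<close>. The restriction to
  \<open>ball 3 Q\<close> keeps them local, so that \<open>U\<close> and \<open>W\<close> can be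
  sought near \<open>Q\<close>.\<close>

definition outer1 :: "real \<Rightarrow> 'a set \<Rightarrow> 'a set \<Rightarrow> 'a set \<Rightarrow> 'a set" where
  "outer1 \<psi> Q \<Omega> U = {u \<in> X \<inter> ball 3 Q. real (card (N u - (core Q \<Omega> \<union> nbhd U))) \<le> \<psi>}"

definition outer :: "real \<Rightarrow> 'a set \<Rightarrow> 'a set \<Rightarrow> 'a set \<Rightarrow> 'a set \<Rightarrow> 'a set" where
  "outer \<psi> Q \<Omega> U W = outer1 \<psi> Q \<Omega> U - nbhd W"

text \<open>For the \<open>W\<close> chosen below, a vertex outside \<open>nbhd A\<close> has at
  most \<open>\<psi>\<close> neighbours in \<open>outer\<close>; a vertex with more is therefore
  certain to lie in \<open>nbhd A\<close>.\<close>

definition inner :: "real \<Rightarrow> 'a set \<Rightarrow> 'a set \<Rightarrow> 'a set \<Rightarrow> 'a set \<Rightarrow> 'a set" where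
  "inner \<psi> Q \<Omega> U W = core Q \<Omega> \<union> nbhd U \<union> {w \<in> Y. real (card (N w \<inter> outer \<psi> Q \<Omega> U W)) > \<psi>}"

text \<open>Second approximation: two greedy covers (first of \<open>N(A)\<close> from the closure, then of the excess of
  \<open>outer1\<close> from outside \<open>N(A)\<close>) sharpen the core to \<open>inner \<subseteq> N(A)\<close> and \<open>[A] \<subseteq> outer\<close>, where at most
  \<open>\<psi>\<close> edges per vertex are undecided.\<close>

lemma approx_pair:
  fixes \<psi> t :: real
  assumes A: "A \<subseteq> X"
    and t: "t = real (card (nbhd A)) - real (card (cl A))"
    and Q: "Q \<subseteq> X \<union> Y" "cl A \<subseteq> ball 3 Q"
    and core: "core Q \<Omega> \<subseteq> nbhd A" "real (card (nbhd A - core Q \<Omega>)) \<le> 2 * t"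
    and psi: "0 < \<psi>" "\<psi> \<le> real d / 2"
  shows "\<exists>U W. U \<subseteq> ball 3 Q \<and> real (card U) \<le> 2 * t / \<psi> \<and> W \<subseteq> ball 4 Q \<and> real (card W) \<le> 2 * t / \<psi>
    \<and> cl A \<subseteq> outer \<psi> Q \<Omega> U W \<and> inner \<psi> Q \<Omega> U W \<subseteq> nbhd A
    \<and> (real d - \<psi>) * (real (card (outer \<psi> Q \<Omega> U W)) - real (card (inner \<psi> Q \<Omega> U W))) \<le> \<psi> * t"
proof -
  define G C where "G = nbhd A" and "C = cl A"
  have GY: "G \<subseteq> Y" unfolding G_def by (rule nbhd_X[OF A])
  have CX: "C \<subseteq> X" unfolding C_def by (rule cl_X)
  have nC: "nbhd C = G" unfolding C_def G_def by (rule nbhd_cl[OF A])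
  have finG: "finite G" using GY finite_Y finite_subset by auto
  have finC: "finite C" using CX finite_X finite_subset by auto
  have leave: "(\<Sum>v\<in>G. real (card (N v - C))) = real d * t"
    using edges_leaving(2)[OF A] t unfolding G_def C_def by simp
  have NG: "N w \<inter> C = {}" if "w \<in> Y - G" for w
  proof -
    have "u \<notin> C" if u: "u \<in> N w" for u
    proof
      assume "u \<in> C"
      moreover have "w \<in> N u" using N_sym[of w u] u \<open>w \<in> Y - G\<close> by auto
      ultimately have "w \<in> nbhd C" by (rule nbhdI)
      then show False using nC \<open>w \<in> Y - G\<close> by auto
    qed
    then show ?thesis by auto
  qed

  obtain U where U: "U \<subseteq> C" "\<psi> * card U \<le> card ((G - core Q \<Omega>) \<inter> nbhd U)"
     "\<forall>u\<in>C. card (N u \<inter> ((G - core Q \<Omega>) - nbhd U)) \<le> \<psi>"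
    using greedy_cover[OF finC, of "G - core Q \<Omega>" \<psi>] finG psi by auto
  have "\<psi> * card U \<le> 2 * t"
    using U(2) core(2) card_mono[of "G - core Q \<Omega>" "(G - core Q \<Omega>) \<inter> nbhd U"] finG
    unfolding G_def[symmetric] by fastforce
  then have cU: "real (card U) \<le> 2 * t / \<psi>" using psi by (simp add: field_simps)
  define F1 where "F1 = core Q \<Omega> \<union> nbhd U"
  have F1G: "F1 \<subseteq> G" using core(1) nbhd_mono[OF U(1)] nC unfolding F1_def G_def by auto
  define S1 where "S1 = outer1 \<psi> Q \<Omega> U"
  have S1: "S1 = {u \<in> X \<inter> ball 3 Q. real (card (N u - F1)) \<le> \<psi>}"
    unfolding S1_def outer1_def F1_def ..
  have S1X: "S1 \<subseteq> X" unfolding S1 by auto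
  have finS1: "finite S1" using S1X finite_X finite_subset by auto
  have CS1: "C \<subseteq> S1"
  proof
    fix u assume u: "u \<in> C"
    have "N u - F1 = N u \<inter> ((G - core Q \<Omega>) - nbhd U)"
      using nbhd_mono[of "{u}" C] u nC unfolding F1_def nbhd_def by auto
    then show "u \<in> S1" using U(3) u CX Q(2) unfolding S1 C_def by auto
  qed
  \<comment> \<open>Since \<open>\<psi> \<le> d / 2\<close>, every excess vertex has at least
    \<open>d / 2\<close> neighbours in \<open>G\<close>. These edges leave the closure, and there
    are only \<open>d t\<close> of them.\<close>
  have cS1: "real (card (S1 - C)) \<le> 2 * t"
  proof -
    have "real (card (S1 - C)) * (real d / 2) = (\<Sum>u\<in>S1 - C. real d / 2)" by simp
    also have "\<dots> \<le> (\<Sum>u\<in>S1 - C. real (card (N u \<inter> G)))"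
    proof (rule sum_mono)
      fix u assume u: "u \<in> S1 - C"
      have uX: "u \<in> X \<union> Y" using u S1X by auto
      have "d = card ((N u \<inter> F1) \<union> (N u - F1))" using card_N[OF uX] by (simp add: Un_Diff_Int Un_commute)
      also have "\<dots> \<le> card (N u \<inter> F1) + card (N u - F1)" by (rule card_Un_le)
      also have "card (N u \<inter> F1) \<le> card (N u \<inter> G)" using F1G finG by (intro card_mono) auto
      finally show "real d / 2 \<le> real (card (N u \<inter> G))" using u psi unfolding S1 by auto
    qed
    also have "\<dots> = real (\<Sum>u\<in>S1 - C. card (N u \<inter> G))" by simp
    also have "(\<Sum>u\<in>S1 - C. card (N u \<inter> G)) = (\<Sum>v\<in>G. card (N v \<inter> (S1 - C)))"
      using S1X GY by (intro double_count) auto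
    also have "real \<dots> \<le> real (\<Sum>v\<in>G. card (N v - C))"
      using GY finite_N by (intro of_nat_mono sum_mono card_mono) auto
    also have "\<dots> = real d * t" using leave by simp
    finally have "real d * (real (card (S1 - C)) / 2) \<le> real d * t" by (simp add: mult.commute)
    then show ?thesis using d_ge_2 by simp
  qed
  have nS1: "nbhd S1 \<subseteq> ball 4 Q"
    using nbhd_mono[of S1 "ball 3 Q"] unfolding S1 by (auto simp: eval_nat_numeral)

  obtain W where W: "W \<subseteq> {w\<in>Y - G. N w \<inter> (S1 - C) \<noteq> {}}" "\<psi> * card W \<le> card ((S1 - C) \<inter> nbhd W)"
     "\<forall>w\<in>{w\<in>Y - G. N w \<inter> (S1 - C) \<noteq> {}}. card (N w \<inter> ((S1 - C) - nbhd W)) \<le> \<psi>"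
    using greedy_cover[of "{w\<in>Y - G. N w \<inter> (S1 - C) \<noteq> {}}" "S1 - C" \<psi>] finite_Y finS1 psi by auto
  have "\<psi> * card W \<le> 2 * t"
    using W(2) cS1 card_mono[of "S1 - C" "(S1 - C) \<inter> nbhd W"] finS1 by fastforce
  then have cW: "real (card W) \<le> 2 * t / \<psi>" using psi by (simp add: field_simps)
  have W4: "W \<subseteq> ball 4 Q"
  proof
    fix w assume w: "w \<in> W"
    then obtain u where u: "u \<in> N w" "u \<in> S1" "w \<in> Y" using W(1) by auto
    then have "w \<in> nbhd S1" using N_sym[of w u] by (auto simp: nbhd_def)
    then show "w \<in> ball 4 Q" using nS1 by auto
  qed
  define S F where "S = outer \<psi> Q \<Omega> U W" and "F = inner \<psi> Q \<Omega> U W"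
  have S: "S = S1 - nbhd W" unfolding S_def outer_def S1_def ..
  have F: "F = F1 \<union> {w \<in> Y. real (card (N w \<inter> S)) > \<psi>}"
    unfolding F_def inner_def F1_def S_def ..
  have SX: "S \<subseteq> X" using S1X S by auto
  have finS: "finite S" using finS1 S by auto
  have CS: "C \<subseteq> S" using CS1 NG W(1) unfolding S nbhd_def by blast
  have wG: "real (card (N w \<inter> S)) \<le> \<psi>" if "w \<in> Y - G" for w
  proof -
    have eq: "N w \<inter> S = N w \<inter> ((S1 - C) - nbhd W)" using NG[OF that] unfolding S by auto
    show ?thesis
    proof (cases "N w \<inter> (S1 - C) = {}")
      case True
      then have "N w \<inter> S = {}" unfolding eq by auto
      then show ?thesis using psi by simp
    next
      case False
      then show ?thesis unfolding eq using W(3) that by auto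
    qed
  qed
  have FG: "F \<subseteq> G" using F1G wG unfolding F by force
  have finF: "finite F" using FG finG finite_subset by auto
  have wF: "real (card (N w \<inter> S)) \<le> \<psi>" if "w \<in> Y - F" for w using that unfolding F by auto
  have uS: "real (card (N u - F)) \<le> \<psi>" if "u \<in> S" for u
  proof -
    have "card (N u - F) \<le> card (N u - F1)"
      using finite_N[of u] that SX unfolding F by (intro card_mono) auto
    then show ?thesis using that unfolding S S1 by auto
  qed

  have fY: "finite (Y - F)" "finite (Y - G)" using finite_Y by auto
  \<comment> \<open>The edges at \<open>S\<close> are sorted by their other end: at most
    \<open>d\<close> at a vertex of \<open>F\<close>, at most \<open>\<psi>\<close> at a vertex of
    \<open>G - F\<close>, and those into \<open>Y - G\<close> start in \<open>S - C\<close>, at most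
    \<open>\<psi>\<close> at each. The sizes of \<open>G - F\<close> and \<open>S - C\<close> add up
    to \<open>t + |S| - |F|\<close>.\<close>
  have "d * card S = (\<Sum>u\<in>S. card (N u \<inter> F) + card (N u \<inter> (Y - F)))"
  proof -
    have "card (N u \<inter> F) + card (N u \<inter> (Y - F)) = d" if "u \<in> S" for u
    proof -
      have "u \<in> X" using that SX by auto
      then have "(N u \<inter> F) \<union> (N u \<inter> (Y - F)) = N u" using N_X[of u] by auto
      then show ?thesis using card_N[of u] \<open>u \<in> X\<close> finite_N[of u]
        by (subst card_Un_disjoint[symmetric]) auto
    qed
    then show ?thesis by simp
  qed
  also have "\<dots> = (\<Sum>u\<in>S. card (N u \<inter> F)) + (\<Sum>u\<in>S. card (N u \<inter> (Y - F)))"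
    by (rule sum.distrib)
  also have "(\<Sum>u\<in>S. card (N u \<inter> F)) = (\<Sum>v\<in>F. card (N v \<inter> S))"
    using SX FG GY by (intro double_count) auto
  also have "(\<Sum>u\<in>S. card (N u \<inter> (Y - F))) = (\<Sum>w\<in>Y - F. card (N w \<inter> S))"
    using SX by (intro double_count) auto
  also have "(\<Sum>w\<in>Y - F. card (N w \<inter> S)) = (\<Sum>w\<in>G - F. card (N w \<inter> S)) + (\<Sum>w\<in>Y - G. card (N w \<inter> S))"
  proof -
    have "Y - F = (G - F) \<union> (Y - G)" using FG GY by auto
    then show ?thesis using finG finite_Y by (subst sum.union_disjoint[symmetric]) auto
  qed
  also have "(\<Sum>w\<in>Y - G. card (N w \<inter> S)) = (\<Sum>w\<in>Y - G. card (N w \<inter> (S - C)))"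
    using NG by (intro sum.cong refl arg_cong[of _ _ card]) blast
  also have "\<dots> = (\<Sum>u\<in>S - C. card (N u \<inter> (Y - G)))"
    using SX by (intro double_count) auto
  finally have "real (d * card S) = (\<Sum>v\<in>F. real (card (N v \<inter> S))) +
     ((\<Sum>w\<in>G - F. real (card (N w \<inter> S))) + (\<Sum>u\<in>S - C. real (card (N u \<inter> (Y - G)))))"
    by simp
  also have "\<dots> \<le> real (card F) * real d + (real (card (G - F)) * \<psi> + real (card (S - C)) * \<psi>)"
  proof (intro add_mono sum_bounded_above)
    fix v assume "v \<in> F"
    then have "v \<in> X \<union> Y" using FG GY by auto
    then show "real (card (N v \<inter> S)) \<le> real d"
      using card_N[of v] card_mono[of "N v" "N v \<inter> S"] finite_N[of v] by auto
  next
    fix w assume "w \<in> G - F"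
    then show "real (card (N w \<inter> S)) \<le> \<psi>" using wF GY by auto
  next
    fix u assume u: "u \<in> S - C"
    then have "card (N u \<inter> (Y - G)) \<le> card (N u - F)"
      using finite_N[of u] SX FG by (intro card_mono) auto
    then show "real (card (N u \<inter> (Y - G))) \<le> \<psi>" using uS[of u] u by auto
  qed
  finally have le: "real d * real (card S) \<le> real (card F) * real d + (real (card (G - F)) * \<psi> + real (card (S - C)) * \<psi>)"
    by simp
  have "real (card (G - F)) = real (card G) - real (card F)"
    using FG finG finF by (simp add: card_Diff_subset card_mono of_nat_diff)
  moreover have "real (card (S - C)) = real (card S) - real (card C)"
    using CS finC finS by (simp add: card_Diff_subset card_mono of_nat_diff)
  moreover have "t = real (card G) - real (card C)" using t unfolding G_def C_def .
  ultimately have "(real d - \<psi>) * (real (card S) - real (card F)) \<le> \<psi> * t"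
    using le by (simp only:) (simp add: algebra_simps)
  then show ?thesis
    using U(1) Q(2) cU W4 cW CS FG unfolding S_def F_def C_def G_def
    by (intro exI[of _ U] exI[of _ W]) auto
qed

subsection \<open>Reconstruction and the container bound\<close>

lemma wt_nonneg: "l \<ge> 0 \<Longrightarrow> wt l A \<ge> 0"
  unfolding wt_def by simp

text \<open>With \<open>card (nbhd A)\<close> fixed, the weights are \<open>l ^ card A\<close> up to
  a constant factor, and summing over all subsets of \<open>S\<close> gives a power of
  \<open>1 + l\<close>.\<close>

lemma sum_wt_le:
  assumes l: "l > 0" and S: "finite S" and P: "\<P> \<subseteq> Pow S" "\<And>A. A \<in> \<P> \<Longrightarrow> card (nbhd A) = g"
  shows "(\<Sum>A\<in>\<P>. wt l A) \<le> exp (ln (1 + l) * (real (card S) - real g))"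
proof -
  have "(\<Sum>A\<in>\<P>. wt l A) = (\<Sum>A\<in>\<P>. l ^ card A / (1 + l) ^ g)"
    using P(2) by (intro sum.cong refl) (simp add: wt_def)
  also have "\<dots> \<le> (\<Sum>A\<in>Pow S. l ^ card A / (1 + l) ^ g)"
    using P(1) S l by (intro sum_mono2) auto
  also have "\<dots> = (1 + l) ^ card S / (1 + l) ^ g"
    using S by (simp add: sum_divide_distrib[symmetric] sum_Pow_power)
  finally show ?thesis using power_div_power_exp[OF l] by simp
qed

text \<open>If \<open>S\<close> is much smaller than \<open>g\<close>, summing over all subsets of \<open>S\<close> already wins; otherwise \<open>F\<close> misses
  few vertices of \<open>N(A)\<close>, which can be guessed, and \<open>N(A)\<close> determines the closure.\<close>

lemma reconstruct:
  fixes l \<gamma> \<psi> t m n D :: real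
  defines "L \<equiv> ln (1 + l)"
  assumes l: "l > 0" and S: "S \<subseteq> X" and F: "F \<subseteq> Y"
    and Z: "nbhd S \<subseteq> Z" "finite Z" "real (card Z) \<le> n" and D: "D \<ge> 1" "n / D \<le> m" "m \<ge> 0"
    and gam: "\<gamma> \<ge> 0" "\<gamma> \<le> 2" "\<psi> = \<gamma> * real d / 4" "\<gamma> * ln D + L * \<gamma> / 2 \<le> L"
    and t: "t = real g - real a" "t \<ge> 0"
    and SF: "(real d - \<psi>) * (real (card S) - real (card F)) \<le> \<psi> * t"
    and P: "\<And>A. A \<in> \<P> \<Longrightarrow> A \<subseteq> X \<and> card (cl A) = a \<and> card (nbhd A) = g \<and> cl A \<subseteq> S \<and> F \<subseteq> nbhd A"
  shows "(\<Sum>A\<in>\<P>. wt l A) \<le> exp (m - L * \<gamma> * t / 2)"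
proof -
  have L: "L > 0" unfolding L_def using l by simp
  have finS: "finite S" using S finite_X finite_subset by auto
  have "\<P> \<subseteq> Pow X" using P by blast
  then have finP: "finite \<P>" using finite_X by (simp add: finite_subset)
  have AS: "A \<subseteq> S" if "A \<in> \<P>" for A using P[OF that] subset_cl[of A] by auto
  show ?thesis
  proof (cases "real (card S) \<le> real g - \<gamma> * t / 2")
    case True
    have "(\<Sum>A\<in>\<P>. wt l A) \<le> exp (L * (real (card S) - real g))"
      unfolding L_def using AS P by (intro sum_wt_le[OF l finS]) auto
    also have "L * (real (card S) - real g) \<le> L * (- (\<gamma> * t / 2))"
      using True L by (intro mult_left_mono) auto
    finally show ?thesis using D(3) by (simp add: algebra_simps order.trans)
  next
    case False
    have d2: "real d \<ge> 2" using d_ge_2 by simp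
    \<comment> \<open>\<open>\<gamma> \<le> 2\<close> gives \<open>d - \<psi> \<ge> d / 2\<close>,
      whereas \<open>\<psi> * t\<close> is \<open>d / 2\<close> times
      \<open>\<gamma> * t / 2\<close>.\<close>
    have sf: "real (card S) - real (card F) \<le> \<gamma> * t / 2"
    proof (rule ccontr)
      assume neg: "\<not> ?thesis"
      have "\<gamma> * t / 2 \<ge> 0" using gam t(2) by simp
      with neg have pos: "real (card S) - real (card F) > 0" by linarith
      have "\<psi> * t = real d / 2 * (\<gamma> * t / 2)" unfolding gam(3) by simp
      also have "\<dots> < real d / 2 * (real (card S) - real (card F))" using neg d2 by (intro mult_strict_left_mono) auto
      also have "\<dots> \<le> (real d - \<psi>) * (real (card S) - real (card F))"
      proof (rule mult_right_mono)
        have "\<gamma> * real d \<le> 2 * real d" using gam(2) by (rule mult_right_mono) simp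
        then show "real d / 2 \<le> real d - \<psi>" unfolding gam(3) by simp
      qed (use pos in auto)
      finally show False using SF by simp
    qed
    define \<B> where "\<B> = {B. B \<subseteq> Z \<and> real (card B) \<le> \<gamma> * t}"
    have finB: "finite \<B>" unfolding \<B>_def using Z(2) by auto
    have "\<P> \<subseteq> (\<Union>B\<in>\<B>. {A\<in>\<P>. nbhd A = F \<union> B})"
    proof
      fix A assume A: "A \<in> \<P>"
      have fin: "finite (nbhd A)" using P[OF A] finite_nbhd[of A] by auto
      have "nbhd A \<subseteq> Z"
        using nbhd_cl[of A] P[OF A] nbhd_mono[of "cl A" S] Z(1) by auto
      \<comment> \<open>Split \<open>g - |F|\<close> as \<open>(g - |S|) + (|S| - |F|)\<close>: the
        first part is below \<open>\<gamma> * t / 2\<close> because the first case fails, the second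
        is bounded by \<open>sf\<close>.\<close>
      moreover have "real (card (nbhd A - F)) \<le> \<gamma> * t"
      proof -
        have "card (nbhd A - F) = g - card F" "card F \<le> g"
          using P[OF A] fin card_mono[OF fin, of F] by (auto simp: card_Diff_subset finite_subset)
        then have "real (card (nbhd A - F)) = real g - real (card F)" by simp
        then show ?thesis using sf False by linarith
      qed
      ultimately have "nbhd A - F \<in> \<B>" unfolding \<B>_def by auto
      then show "A \<in> (\<Union>B\<in>\<B>. {A\<in>\<P>. nbhd A = F \<union> B})" using P[OF A] A by auto
    qed
    then have "(\<Sum>A\<in>\<P>. wt l A) \<le> (\<Sum>B\<in>\<B>. \<Sum>A\<in>{A\<in>\<P>. nbhd A = F \<union> B}. wt l A)"
      using finB finP wt_nonneg l by (intro sum_le_sum_cover) auto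
    also have "\<dots> \<le> (\<Sum>B\<in>\<B>. exp (- L * t))"
    proof (rule sum_mono)
      fix B assume "B \<in> \<B>"
      show "(\<Sum>A\<in>{A\<in>\<P>. nbhd A = F \<union> B}. wt l A) \<le> exp (- L * t)"
      proof (cases "{A\<in>\<P>. nbhd A = F \<union> B} = {}")
        case True
        then show ?thesis by (simp only:) simp
      next
        case False
        \<comment> \<open>The closure depends on the neighbourhood only, so all members with this
          neighbourhood are subsets of \<open>cl A0\<close>, which has \<open>a\<close> elements.
          Together they contribute at most \<open>(1 + l)^(a - g)\<close>.\<close>
        then obtain A0 where A0: "A0 \<in> \<P>" "nbhd A0 = F \<union> B" by auto
        have fin: "finite (cl A0)" using cl_X finite_X finite_subset by blast
        have "A \<subseteq> cl A0" if "A \<in> \<P>" "nbhd A = F \<union> B" for A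
          using subset_cl[of A] P[OF that(1)] that(2) A0(2) unfolding cl_def by auto
        then have "(\<Sum>A\<in>{A\<in>\<P>. nbhd A = F \<union> B}. wt l A) \<le> exp (L * (real (card (cl A0)) - real g))"
          unfolding L_def using P by (intro sum_wt_le[OF l fin]) blast+
        then show ?thesis using P[OF A0(1)] unfolding t(1) by (simp add: algebra_simps)
      qed
    qed
    also have "\<dots> = real (card \<B>) * exp (- L * t)" by simp
    also have "\<dots> \<le> exp (\<gamma> * t * ln D + n / D) * exp (- L * t)"
      unfolding \<B>_def by (intro mult_right_mono card_small_subsets Z D) auto
    also have "\<dots> = exp (\<gamma> * t * ln D + n / D - L * t)" by (simp add: exp_add exp_diff exp_minus divide_inverse)
    also have "\<dots> \<le> exp (m - L * \<gamma> * t / 2)"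
      using mult_right_mono[OF gam(4) t(2)] D(2) by (simp add: algebra_simps)
    finally show ?thesis .
  qed
qed

text \<open>In the exponent, 3 stands for the choice of a point of \<open>Q\<close> in
  \<open>ball 3 {v}\<close>, and 16 = 2 times 8 for each element: walks of length
  \<open>2 * k\<close> whose steps have length at most 8.\<close>

lemma card_core_sets:
  assumes v: "v \<in> X" and m: "m \<ge> 0"
  defines "\<Q> \<equiv> {Q. Q \<subseteq> X \<union> Y \<and> linked (\<lambda>u. ball 8 {u}) Q \<and> real (card Q) \<le> m \<and> Q \<inter> ball 3 {v} \<noteq> {}}"
  shows "finite \<Q>" "real (card \<Q>) \<le> exp (ln (real d + 1) * (3 + 16 * m))"
proof -
  show fin: "finite \<Q>"
    unfolding \<Q>_def using finite_X finite_Y by - (rule finite_subset[of _ "Pow (X \<union> Y)"], auto)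
  define k where "k = nat \<lfloor>m\<rfloor>"
  have k: "real k \<le> m" unfolding k_def using m by linarith
  define \<R> where "\<R> q = {Q. Q \<subseteq> X \<union> Y \<and> q \<in> Q \<and> linked (\<lambda>u. ball 8 {u}) Q \<and> card Q \<le> k}" for q
  have R: "card (\<R> q) \<le> ((d + 1) ^ 8) ^ (2 * k)" if "q \<in> X \<union> Y" for q
    unfolding \<R>_def
  proof (rule card_linked_sets)
    fix u assume u: "u \<in> X \<union> Y"
    have "card (ball 8 {u}) \<le> (d + 1) ^ 8 * card {u}" using u by (intro card_ball) auto
    then show "ball 8 {u} \<subseteq> X \<union> Y \<and> finite (ball 8 {u}) \<and> card (ball 8 {u}) \<le> (d + 1) ^ 8 \<and> u \<in> ball 8 {u}"
      using u ball_XY[of "{u}" 8] finite_ball[of "{u}" 8] subset_ball[of "{u}" 8] by auto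
  qed (use that finite_X finite_Y ball_sym in auto)
  have b3: "ball 3 {v} \<subseteq> X \<union> Y" "finite (ball 3 {v})" "card (ball 3 {v}) \<le> (d + 1) ^ 3"
    using v ball_XY[of "{v}" 3] finite_ball[of "{v}" 3] card_ball[of "{v}" 3] by auto
  have "\<Q> \<subseteq> (\<Union>q\<in>ball 3 {v}. \<R> q)"
    unfolding \<Q>_def \<R>_def k_def by (auto simp: le_nat_floor)
  moreover have "finite (\<R> q)" for q
    unfolding \<R>_def using finite_X finite_Y by - (rule finite_subset[of _ "Pow (X \<union> Y)"], auto)
  ultimately have "card \<Q> \<le> card (\<Union>q\<in>ball 3 {v}. \<R> q)" using b3(2) by (intro card_mono) auto
  also have "\<dots> \<le> (\<Sum>q\<in>ball 3 {v}. card (\<R> q))" by (rule card_UN_le[OF b3(2)])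
  also have "\<dots> \<le> (\<Sum>q\<in>ball 3 {v}. ((d + 1) ^ 8) ^ (2 * k))" using R b3(1) by (intro sum_mono) auto
  also have "\<dots> \<le> (d + 1) ^ 3 * ((d + 1) ^ 8) ^ (2 * k)" using b3(3) by simp
  also have "\<dots> = (d + 1) ^ (3 + 16 * k)" by (simp add: power_add power_mult[symmetric])
  finally have "real (card \<Q>) \<le> real ((d + 1) ^ (3 + 16 * k))" by (rule of_nat_mono)
  also have "\<dots> = exp (real (3 + 16 * k) * ln (real d + 1))"
    unfolding exp_of_nat_mult by (simp add: add.commute)
  also have "\<dots> \<le> exp (ln (real d + 1) * (3 + 16 * m))"
    using k by (simp add: mult.commute mult_left_mono)
  finally show "real (card \<Q>) \<le> exp (ln (real d + 1) * (3 + 16 * m))" .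
qed

text \<open>The second approximation costs \<open>O(e\<^sup>2 t / (L1 d))\<close> while the gain is of order \<open>L L1 t / e\<close>; this
  is where \<open>\<lambda> \<ge> c\<^sub>0 log d / d\<^sup>1\<^sup>/\<^sup>3\<close> comes from.\<close>

theorem container_bound:
  fixes l t :: real
  defines "e \<equiv> ln (real d + 1)" and "L \<equiv> ln (1 + l)" and "L1 \<equiv> min (ln (1 + l)) 1"
  assumes l: "l > 0" and v: "v \<in> X"
    and t: "t = real g - real a" and iso: "2 * real g \<le> 5 * real d * t"
    and large: "250000 * e ^ 3 \<le> L1 ^ 3 * real d"
  shows "(\<Sum>A\<in>{A. A \<subseteq> X \<and> v \<in> A \<and> linked N2 A \<and> card (cl A) = a \<and> card (nbhd A) = g}. wt l A)
     \<le> exp (3 * e - L * L1 / (64 * e) * t)"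
proof -
  define \<A> where "\<A> = {A. A \<subseteq> X \<and> v \<in> A \<and> linked N2 A \<and> card (cl A) = a \<and> card (nbhd A) = g}"
  have d2: "real d \<ge> 2" using d_ge_2 by simp
  have e1: "e \<ge> 1" unfolding e_def using d_ge_2 by (rule one_le_ln)
  have L: "L > 0" unfolding L_def using l by simp
  have L1: "0 < L1" "L1 \<le> 1" "L1 \<le> L" using L unfolding L1_def L_def by auto
  have t0: "t \<ge> 0"
  proof (rule ccontr)
    assume "\<not> t \<ge> 0"
    then have "5 * real d * t < 0" using d2 by (intro mult_pos_neg) auto
    moreover have "0 \<le> 2 * real g" by simp
    ultimately show False using iso by linarith
  qed
  define m where "m = 120 * e * t / real d"
  \<comment> \<open>Chosen so that guessing \<open>\<gamma> * t\<close> vertices at a price of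
    \<open>ln ((d + 1)^4)\<close> each costs only \<open>L1 / 4\<close> per unit of
    \<open>t\<close>.\<close>
  define \<gamma> where "\<gamma> = L1 / (16 * e)"
  define \<psi> where "\<psi> = \<gamma> * real d / 4"
  define k where "k = 2 * t / \<psi>"
  have m0: "m \<ge> 0" unfolding m_def using e1 t0 by simp
  have gam: "0 < \<gamma>" "\<gamma> \<le> 1 / 16"
    unfolding \<gamma>_def using L1 e1 by (simp_all add: divide_le_eq)
  have psi: "0 < \<psi>" "\<psi> \<le> real d / 2" unfolding \<psi>_def using gam d2 mult_right_mono[of \<gamma> 2 "real d"] by simp_all
  have k0: "k \<ge> 0" unfolding k_def using t0 psi by simp
  have L13: "L1 ^ 3 \<le> 1" using L1 by (simp add: power_le_one)
  have "L1 ^ 3 * real d \<le> 1 * real d" using L13 by (rule mult_right_mono) simp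
  then have "250000 * e ^ 3 \<le> real d" using large by simp
  moreover have "e \<le> e ^ 3" using e1 self_le_power[of e 3] by simp
  ultimately have "32 * e \<le> real d" using e1 by linarith
  also have "\<dots> \<le> (real d)\<^sup>2" using d2 by (simp add: self_le_power)
  finally have large': "32 * ln (real d + 1) \<le> (real d)\<^sup>2" unfolding e_def .

  define \<Q> where "\<Q> = {Q. Q \<subseteq> X \<union> Y \<and> linked (\<lambda>u. ball 8 {u}) Q \<and> real (card Q) \<le> m \<and> Q \<inter> ball 3 {v} \<noteq> {}}"
  define O' where "O' Q = {\<Omega>. \<Omega> \<subseteq> nbhd (Q \<inter> Y) \<and> real (card \<Omega>) \<le> m}" for Q
  define BB where "BB j Q = {U. U \<subseteq> ball j Q \<and> real (card U) \<le> k}" for j Q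
  \<comment> \<open>The codes: \<open>Q\<close> is linked and comes near \<open>v\<close>, and the
    other three components are small sets within bounded distance of \<open>Q\<close>. Each code
    determines a container pair.\<close>
  define I where "I = (SIGMA Q:\<Q>. O' Q \<times> (BB 3 Q \<times> BB 4 Q))"
  define ok where "ok Q \<Omega> U W A \<longleftrightarrow> cl A \<subseteq> outer \<psi> Q \<Omega> U W \<and> inner \<psi> Q \<Omega> U W \<subseteq> nbhd A \<and>
     (real d - \<psi>) * (real (card (outer \<psi> Q \<Omega> U W)) - real (card (inner \<psi> Q \<Omega> U W))) \<le> \<psi> * t" for Q \<Omega> U W A
  define \<A>' where "\<A>' = (\<lambda>(Q, \<Omega>, U, W). {A\<in>\<A>. ok Q \<Omega> U W A})"
  have QXY: "Q \<subseteq> X \<union> Y" "finite Q" "real (card Q) \<le> m" if "Q \<in> \<Q>" for Q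
    using that finite_X finite_Y unfolding \<Q>_def by (auto intro: finite_subset[of Q "X \<union> Y"])
  have finQ: "finite \<Q>" and cQ: "real (card \<Q>) \<le> exp (e * (3 + 16 * m))"
    using card_core_sets[OF v m0] unfolding \<Q>_def e_def by auto
  have e_D: "ln ((real d + 1) ^ j) = real j * e" for j unfolding e_def using d2 by (simp add: ln_realpow)
  have O': "finite (O' Q)" "real (card (O' Q)) \<le> exp (m * e + m)" if Q: "Q \<in> \<Q>" for Q
  proof -
    have QY: "Q \<inter> Y \<subseteq> X \<union> Y" by auto
    have fin: "finite (nbhd (Q \<inter> Y))" using finite_nbhd[OF QY] .
    then show "finite (O' Q)" unfolding O'_def by auto
    have "card (nbhd (Q \<inter> Y)) \<le> d * card (Q \<inter> Y)" by (rule card_nbhd_le[OF QY])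
    also have "\<dots> \<le> d * card Q" using QXY[OF Q] by (intro mult_left_mono card_mono) auto
    finally have "real (card (nbhd (Q \<inter> Y))) \<le> real d * real (card Q)" by (metis of_nat_le_iff of_nat_mult)
    also have "\<dots> \<le> real d * m" using QXY[OF Q] by (intro mult_left_mono) auto
    finally have "real (card (O' Q)) \<le> exp (m * ln (real d + 1) + real d * m / (real d + 1))"
      unfolding O'_def by (intro card_small_subsets[OF fin]) auto
    also have "\<dots> \<le> exp (m * e + m)" unfolding e_def using m0 by (simp add: field_simps)
    finally show "real (card (O' Q)) \<le> exp (m * e + m)" .
  qed
  have bQ: "real (card (ball j Q)) \<le> (real d + 1) ^ j * m" if Q: "Q \<in> \<Q>" for Q j
  proof -
    have "card (ball j Q) \<le> (d + 1) ^ j * card Q" by (rule card_ball[OF QXY(1)[OF Q]])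
    then have "real (card (ball j Q)) \<le> real ((d + 1) ^ j * card Q)" by (rule of_nat_mono)
    also have "\<dots> = (real d + 1) ^ j * real (card Q)" by (simp add: add.commute)
    also have "\<dots> \<le> (real d + 1) ^ j * m" using QXY(3)[OF Q] by (intro mult_left_mono) auto
    finally show ?thesis .
  qed
  have BB: "finite (BB j Q)" "real (card (BB j Q)) \<le> exp (k * (real j * e) + m)" if Q: "Q \<in> \<Q>" for Q j
  proof -
    have fin: "finite (ball j Q)" using finite_ball[OF QXY(1)[OF Q]] .
    then show "finite (BB j Q)" unfolding BB_def by auto
    have "real (card (BB j Q)) \<le> exp (k * ln ((real d + 1) ^ j) + (real d + 1) ^ j * m / (real d + 1) ^ j)"
      unfolding BB_def by (intro card_small_subsets[OF fin bQ[OF Q]]) auto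
    also have "(real d + 1) ^ j * m / (real d + 1) ^ j = m" using d2 by simp
    finally show "real (card (BB j Q)) \<le> exp (k * (real j * e) + m)" unfolding e_D .
  qed
  have finI: "finite I" unfolding I_def using finQ O' BB by auto
  have cI: "real (card I) \<le> exp (e * (3 + 16 * m)) * (exp (m * e + m) * (exp (k * (3 * e) + m) * exp (k * (4 * e) + m)))"
  proof -
    have "real (card I) = (\<Sum>Q\<in>\<Q>. real (card (O' Q)) * (real (card (BB 3 Q)) * real (card (BB 4 Q))))"
      unfolding I_def using finQ O' BB by (subst card_SigmaI) (auto simp: card_cartesian_product)
    also have "\<dots> \<le> (\<Sum>Q\<in>\<Q>. exp (m * e + m) * (exp (k * (3 * e) + m) * exp (k * (4 * e) + m)))"
    proof (intro sum_mono mult_mono)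
      fix Q assume "Q \<in> \<Q>"
      then show "real (card (O' Q)) \<le> exp (m * e + m)"
        "real (card (BB 3 Q)) \<le> exp (k * (3 * e) + m)" "real (card (BB 4 Q)) \<le> exp (k * (4 * e) + m)"
        using O' BB[of Q 3] BB[of Q 4] by auto
    qed auto
    also have "\<dots> = real (card \<Q>) * (exp (m * e + m) * (exp (k * (3 * e) + m) * exp (k * (4 * e) + m)))" by simp
    also have "\<dots> \<le> exp (e * (3 + 16 * m)) * (exp (m * e + m) * (exp (k * (3 * e) + m) * exp (k * (4 * e) + m)))"
      using cQ by (intro mult_right_mono) auto
    finally show ?thesis .
  qed
  have finA: "finite \<A>" unfolding \<A>_def using finite_X by - (rule finite_subset[of _ "Pow X"], auto)
  have "\<A> \<subseteq> (\<Union>i\<in>I. \<A>' i)"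
  proof
    fix A assume A: "A \<in> \<A>"
    then have AX: "A \<subseteq> X" "v \<in> A" "linked N2 A" "card (cl A) = a" "card (nbhd A) = g" unfolding \<A>_def by auto
    have tA: "t = real (card (nbhd A)) - real (card (cl A))" using AX t by simp
    obtain Q \<Omega> where Q: "Q \<subseteq> cl A \<union> nbhd A" "cl A \<subseteq> ball 3 Q" "real (card Q) \<le> m"
      "\<Omega> \<subseteq> nbhd (Q \<inter> Y)" "real (card \<Omega>) \<le> m"
      "core Q \<Omega> \<subseteq> nbhd A" "real (card (nbhd A - core Q \<Omega>)) \<le> 2 * t"
      using core_set[OF AX(1) tA _ large'] iso AX(5) unfolding m_def e_def by blast
    have QX: "Q \<subseteq> X \<union> Y" using Q(1) cl_X nbhd_X[OF AX(1)] by auto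
    obtain U W where UW: "U \<subseteq> ball 3 Q" "real (card U) \<le> k" "W \<subseteq> ball 4 Q" "real (card W) \<le> k" "ok Q \<Omega> U W A"
      using approx_pair[OF AX(1) tA QX Q(2,6,7) psi] unfolding k_def ok_def by blast
    have AQ: "A \<subseteq> ball 3 Q" using Q(2) subset_cl[OF AX(1)] by auto
    have "linked (\<lambda>u. ball 8 {u}) Q" by (rule linked_core[OF AX(1,3) Q(1) AQ])
    moreover have "Q \<inter> ball 3 {v} \<noteq> {}"
    proof -
      obtain q where "q \<in> Q" "v \<in> ball 3 {q}" using AQ AX(2) ball_iff[of v 3 Q] by auto
      then show ?thesis using ball_sym[of q v 3] QX by auto
    qed
    ultimately have "Q \<in> \<Q>" unfolding \<Q>_def using QX Q(3) by auto
    then have "(Q, \<Omega>, U, W) \<in> I" unfolding I_def O'_def BB_def using Q UW by auto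
    then show "A \<in> (\<Union>i\<in>I. \<A>' i)" using A UW(5) unfolding \<A>'_def by force
  qed
  then have "(\<Sum>A\<in>\<A>. wt l A) \<le> (\<Sum>i\<in>I. \<Sum>A\<in>\<A>' i. wt l A)"
    using finI finA wt_nonneg l by (intro sum_le_sum_cover) (auto simp: \<A>'_def)
  also have "\<dots> \<le> (\<Sum>i\<in>I. exp (m - L * \<gamma> * t / 2))"
  proof (rule sum_mono)
    fix i assume i: "i \<in> I"
    obtain Q \<Omega> U W where i': "i = (Q, \<Omega>, U, W)" by (cases i) auto
    have Q: "Q \<in> \<Q>" using i unfolding i' I_def by auto
    show "(\<Sum>A\<in>\<A>' i. wt l A) \<le> exp (m - L * \<gamma> * t / 2)"
    proof (cases "\<A>' i = {}")
      case False
      then obtain A0 where "A0 \<in> \<A>" "ok Q \<Omega> U W A0" unfolding i' \<A>'_def by auto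
      then have A0: "A0 \<subseteq> X" "inner \<psi> Q \<Omega> U W \<subseteq> nbhd A0"
        "(real d - \<psi>) * (real (card (outer \<psi> Q \<Omega> U W)) - real (card (inner \<psi> Q \<Omega> U W))) \<le> \<psi> * t"
        unfolding ok_def \<A>_def by auto
      have "nbhd (outer \<psi> Q \<Omega> U W) \<subseteq> nbhd (ball 3 Q)"
        unfolding outer_def outer1_def by (intro nbhd_mono) auto
      also have "\<dots> \<subseteq> ball 4 Q" by (auto simp: eval_nat_numeral)
      finally have nS: "nbhd (outer \<psi> Q \<Omega> U W) \<subseteq> ball 4 Q" .
      have gD: "\<gamma> * ln ((real d + 1) ^ 4) + ln (1 + l) * \<gamma> / 2 \<le> ln (1 + l)"
      proof -
        have "\<gamma> * ln ((real d + 1) ^ 4) = L1 / 4" unfolding e_D \<gamma>_def using e1 by simp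
        moreover have "L * \<gamma> \<le> L * (1 / 16)" using gam L by (intro mult_left_mono) auto
        ultimately show ?thesis using L1 L unfolding L_def by linarith
      qed
      show ?thesis unfolding i' L_def
      proof (rule reconstruct[where S = "outer \<psi> Q \<Omega> U W" and F = "inner \<psi> Q \<Omega> U W" and Z = "ball 4 Q"
            and n = "(real d + 1) ^ 4 * m" and D = "(real d + 1) ^ 4" and \<psi> = \<psi> and g = g and a = a])
        show "outer \<psi> Q \<Omega> U W \<subseteq> X" unfolding outer_def outer1_def by auto
        show "inner \<psi> Q \<Omega> U W \<subseteq> Y" using A0 nbhd_X by auto
        show "finite (ball 4 Q)" using finite_ball QXY(1)[OF Q] by auto
        show "real (card (ball 4 Q)) \<le> (real d + 1) ^ 4 * m" by (rule bQ[OF Q])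
        show "1 \<le> (real d + 1) ^ 4" by simp
        show "(real d + 1) ^ 4 * m / (real d + 1) ^ 4 \<le> m" using d2 by simp
        show "A \<subseteq> X \<and> card (cl A) = a \<and> card (nbhd A) = g \<and> cl A \<subseteq> outer \<psi> Q \<Omega> U W \<and> inner \<psi> Q \<Omega> U W \<subseteq> nbhd A"
          if "A \<in> \<A>' (Q, \<Omega>, U, W)" for A
          using that unfolding \<A>'_def \<A>_def ok_def by auto
        show "nbhd (outer \<psi> Q \<Omega> U W) \<subseteq> ball 4 Q" by (rule nS)
        show "\<psi> = \<gamma> * real d / 4" by (rule \<psi>_def)
      qed (use l m0 gam gD t t0 A0(3) in auto)
    qed simp
  qed
  also have "\<dots> = real (card I) * exp (m - L * \<gamma> * t / 2)" by simp
  also have "\<dots> \<le> exp (e * (3 + 16 * m)) * (exp (m * e + m) * (exp (k * (3 * e) + m) * exp (k * (4 * e) + m))) * exp (m - L * \<gamma> * t / 2)"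
    using cI by (intro mult_right_mono) auto
  also have "\<dots> = exp (3 * e + 17 * (m * e) + 4 * m + 7 * (k * e) - L * \<gamma> * t / 2)"
    by (simp add: exp_add[symmetric] algebra_simps)
  \<comment> \<open>\<open>L * \<gamma> * t / 2\<close> is twice the claimed gain
    \<open>L * L1 * t / (64 * e)\<close>. One half is kept, the other pays for the codes: these cost
    2520 + 896 = 3416 units of \<open>e^2 t / (d L1)\<close>, and
    \<open>250000 / 64 > 3416\<close>.\<close>
  also have "\<dots> \<le> exp (3 * e - L * L1 / (64 * e) * t)"
  proof -
    have "m \<le> m * e" using mult_left_mono[OF e1 m0] by (simp only: mult_1_right)
    then have "17 * (m * e) + 4 * m \<le> 21 * (m * e)" by linarith
    also have "\<dots> = 2520 * (e\<^sup>2 * t / real d)" unfolding m_def by (simp add: power2_eq_square)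
    also have "\<dots> \<le> 2520 * (e\<^sup>2 * t / real d / L1)"
    proof -
      have "e\<^sup>2 * t / real d * L1 \<le> e\<^sup>2 * t / real d * 1" using t0 L1 by (intro mult_left_mono) auto
      then have "e\<^sup>2 * t / real d \<le> e\<^sup>2 * t / real d / L1"
        by (simp only: pos_le_divide_eq[OF L1(1)] mult_1_right)
      then show ?thesis by (rule mult_left_mono) simp
    qed
    finally have 1: "17 * (m * e) + 4 * m \<le> 2520 * (e\<^sup>2 * t / real d / L1)" .
    have 2: "7 * (k * e) = 896 * (e\<^sup>2 * t / real d / L1)"
      unfolding k_def \<psi>_def \<gamma>_def using L1 e1 d2 by (simp add: field_simps power2_eq_square)
    have "3416 * (e\<^sup>2 * t / real d / L1) = 3416 * e ^ 3 * (t / (e * real d * L1))"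
      using e1 by (simp add: field_simps power2_eq_square power3_eq_cube)
    also have "\<dots> \<le> (L1 ^ 3 * real d / 64) * (t / (e * real d * L1))"
    proof (rule mult_right_mono)
      have "0 \<le> e ^ 3" using e1 by simp
      then show "3416 * e ^ 3 \<le> L1 ^ 3 * real d / 64" using large by linarith
    qed (use e1 L1 t0 in auto)
    also have "\<dots> = L1 * L1 * t / (64 * e)"
      using e1 d2 L1 by (simp add: field_simps power3_eq_cube)
    also have "\<dots> \<le> L * L1 * t / (64 * e)"
      using L1 t0 e1 by (intro divide_right_mono mult_right_mono) auto
    finally have 3: "3416 * (e\<^sup>2 * t / real d / L1) \<le> L * L1 * t / (64 * e)" .
    have 4: "L * \<gamma> * t / 2 = 2 * (L * L1 * t / (64 * e))" unfolding \<gamma>_def by (simp add: field_simps)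
    have 5: "L * L1 / (64 * e) * t = L * L1 * t / (64 * e)" by simp
    define z R ke me LL where "z = e\<^sup>2 * t / real d / L1" and "R = L * L1 * t / (64 * e)"
      and "ke = k * e" and "me = m * e" and "LL = L * \<gamma> * t / 2"
    show ?thesis using 1 2 3 4
      unfolding exp_le_cancel_iff 5 z_def[symmetric] R_def[symmetric] ke_def[symmetric]
        me_def[symmetric] LL_def[symmetric] by linarith
  qed
  finally show ?thesis unfolding \<A>_def .
qed

subsection \<open>Polymer decomposition\<close>

definition far :: "'a set set \<Rightarrow> bool" where
  "far S \<longleftrightarrow> (\<forall>B\<in>S. \<forall>B'\<in>S. B \<noteq> B' \<longrightarrow> nbhd B \<inter> nbhd B' = {})"

definition polymers :: "'a set set" where
  "polymers = {B. B \<subseteq> X \<and> B \<noteq> {} \<and> linked N2 B \<and> 2 * card (cl B) \<le> card X}"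

definition good :: "'a set \<Rightarrow> bool" where
  "good A \<longleftrightarrow> (\<exists>S\<subseteq>polymers. \<Union>S = A \<and> far S)"

lemma finite_polymers: "finite polymers"
  unfolding polymers_def using finite_X by - (rule finite_subset[of _ "Pow X"], auto)

text \<open>A cut that shows \<open>A\<close> not to be linked splits it into parts with disjoint
  neighbourhoods, since a common neighbour would be a step of \<open>N2\<close>. Recursion on both
  parts stands in for connected components.\<close>

lemma decompose:
  assumes "A \<subseteq> X"
  shows "\<exists>S. \<Union>S = A \<and> (\<forall>B\<in>S. B \<noteq> {} \<and> linked N2 B) \<and> far S"
  using assms
proof (induction "card A" arbitrary: A rule: less_induct)
  case less
  have fin: "finite A" using less.prems finite_X finite_subset by auto
  consider "A = {}" | "A \<noteq> {}" "linked N2 A" | "\<not> linked N2 A" by auto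
  then show ?case
  proof cases
    case 1
    then show ?thesis by (intro exI[of _ "{}"]) (auto simp: far_def)
  next
    case 2
    then show ?thesis by (intro exI[of _ "{A}"]) (auto simp: far_def)
  next
    case 3
    then obtain D where D: "D \<subset> A" "D \<noteq> {}" "\<forall>u\<in>D. \<forall>w\<in>A - D. w \<notin> N2 u"
      unfolding linked_def by blast
    have sep: "nbhd D \<inter> nbhd (A - D) = {}"
    proof (rule ccontr)
      assume "\<not> ?thesis"
      then obtain y u w where y: "u \<in> D" "y \<in> N u" "w \<in> A - D" "y \<in> N w" unfolding nbhd_def by auto
      have "w \<in> N y" using N_sym[of w y] y less.prems by auto
      then have "w \<in> N2 u" using y(2) unfolding nbhd_def by auto
      then show False using D(3) y by auto
    qed
    have "card D < card A" using D(1) fin psubset_card_mono by auto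
    moreover have "card (A - D) < card A" using D(1,2) fin by (intro psubset_card_mono) auto
    ultimately obtain S S' where S: "\<Union>S = D" "\<forall>B\<in>S. B \<noteq> {} \<and> linked N2 B" "far S"
      "\<Union>S' = A - D" "\<forall>B\<in>S'. B \<noteq> {} \<and> linked N2 B" "far S'"
    proof -
      have DX: "D \<subseteq> X" "A - D \<subseteq> X" using D(1) less.prems by auto
      from less.hyps[OF _ DX(1)] less.hyps[OF _ DX(2)] show ?thesis
        using that \<open>card D < card A\<close> \<open>card (A - D) < card A\<close> by blast
    qed
    have "nbhd B \<inter> nbhd B' = {}" if "B \<in> S" "B' \<in> S'" for B B'
      using sep nbhd_mono[of B D] nbhd_mono[of B' "A - D"] that S(1,4) by blast
    then have "far (S \<union> S')" using S(3,6) unfolding far_def by blast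
    moreover have "\<Union>(S \<union> S') = A" using S(1,4) D(1) by auto
    ultimately show ?thesis using S(2,5) by (intro exI[of _ "S \<union> S'"]) auto
  qed
qed

lemma wt_Union:
  assumes fin: "finite S" and S: "\<And>B. B \<in> S \<Longrightarrow> B \<subseteq> X" and far: "far S"
  shows "wt l (\<Union>S) = (\<Prod>B\<in>S. wt l B)"
proof -
  have finB: "finite B" if "B \<in> S" for B using S[OF that] finite_X finite_subset by auto
  have finn: "finite (nbhd B)" if "B \<in> S" for B using finite_nbhd[of B] S[OF that] by auto
  have disj: "B \<inter> B' = {}" if "B \<in> S" "B' \<in> S" "B \<noteq> B'" for B B'
  proof (rule ccontr)
    assume "\<not> ?thesis"
    then obtain u where u: "u \<in> B" "u \<in> B'" by auto
    moreover have "u \<in> X \<union> Y" using u(1) S[OF that(1)] by auto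
    ultimately obtain y where "y \<in> N u" using N_nonempty[of u] by blast
    then have "y \<in> nbhd B \<inter> nbhd B'" using u by (auto intro: nbhdI)
    then show False using far that unfolding far_def by auto
  qed
  have "card (\<Union>S) = sum card S"
    using finB disj by (intro card_Union_disjoint) (auto simp: pairwise_def disjnt_def)
  moreover have "nbhd (\<Union>S) = (\<Union>B\<in>S. nbhd B)" unfolding nbhd_def by auto
  moreover have "card (\<Union>B\<in>S. nbhd B) = (\<Sum>B\<in>S. card (nbhd B))"
    using fin far finn unfolding far_def by (intro card_UN_disjoint) auto
  ultimately show ?thesis unfolding wt_def by (simp add: power_sum prod_dividef)
qed

text \<open>The chosen decomposition is an injective code because its union recovers the set.
  Forgetting that its polymers are far apart enlarges the sum to all families of polymers, which is
  the product of \<open>1 + wt l B\<close>.\<close>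

lemma sum_good:
  assumes l: "l \<ge> 0"
  shows "(\<Sum>A\<in>{A\<in>Pow X. good A}. wt l A) \<le> exp (\<Sum>B\<in>polymers. wt l B)"
proof -
  define f where "f A = (SOME S. S \<subseteq> polymers \<and> \<Union>S = A \<and> far S)" for A
  have "f A \<subseteq> polymers \<and> \<Union>(f A) = A \<and> far (f A)" if "good A" for A
    using that unfolding f_def good_def by (rule someI_ex)
  then have f: "f A \<subseteq> polymers" "\<Union>(f A) = A" "far (f A)" if "good A" for A
    using that by auto
  have inj: "inj_on f {A\<in>Pow X. good A}"
    by (rule inj_on_inverseI[of _ "\<Union>"]) (use f(2) in auto)
  have fin: "finite S" if "S \<subseteq> polymers" for S using that finite_polymers finite_subset by auto
  have "(\<Sum>A\<in>{A\<in>Pow X. good A}. wt l A) = (\<Sum>A\<in>{A\<in>Pow X. good A}. \<Prod>B\<in>f A. wt l B)"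
  proof (rule sum.cong[OF refl])
    fix A assume "A \<in> {A\<in>Pow X. good A}"
    then have "good A" by auto
    from f[OF this] show "wt l A = (\<Prod>B\<in>f A. wt l B)"
      using wt_Union[of "f A" l] fin[of "f A"] unfolding polymers_def by auto
  qed
  also have "\<dots> = (\<Sum>S\<in>f ` {A\<in>Pow X. good A}. \<Prod>B\<in>S. wt l B)"
    by (rule sum.reindex[OF inj, unfolded o_def, symmetric])
  also have "\<dots> \<le> (\<Sum>S\<in>Pow polymers. \<Prod>B\<in>S. wt l B)"
    using f(1) finite_polymers l by (intro sum_mono2 prod_nonneg) (auto intro: wt_nonneg)
  also have "\<dots> = (\<Prod>B\<in>polymers. 1 + wt l B)" by (rule sum_Pow_prod[OF finite_polymers])
  also have "\<dots> \<le> (\<Prod>B\<in>polymers. exp (wt l B))"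
    using l by (intro prod_mono) (auto intro: wt_nonneg add_nonneg_nonneg)
  also have "\<dots> = exp (\<Sum>B\<in>polymers. wt l B)" using finite_polymers by (simp add: exp_sum)
  finally show ?thesis .
qed

definition indep :: "'a set set" where
  "indep = {I. I \<subseteq> X \<union> Y \<and> (\<forall>x\<in>I. \<forall>y\<in>I. y \<notin> N x)}"

lemma finite_indep: "finite indep"
  unfolding indep_def using finite_X finite_Y by - (rule finite_subset[of _ "Pow (X \<union> Y)"], auto)

lemma indep_iff:
  assumes "A \<subseteq> X" "B \<subseteq> Y"
  shows "A \<union> B \<in> indep \<longleftrightarrow> B \<inter> nbhd A = {}"
proof
  assume "A \<union> B \<in> indep"
  then show "B \<inter> nbhd A = {}" unfolding indep_def nbhd_def by auto
next
  assume *: "B \<inter> nbhd A = {}"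
  have "y \<notin> N x" if xy: "x \<in> A \<union> B" "y \<in> A \<union> B" for x y
  proof
    assume y: "y \<in> N x"
    show False
    proof (cases "x \<in> A")
      case True
      then have "y \<in> Y" "y \<in> nbhd A" using y N_X assms by (auto simp: nbhd_def)
      then show False using * xy assms disjoint_XY by auto
    next
      case False
      then have x: "x \<in> B" "x \<in> Y" using xy assms by auto
      then have "y \<in> X" "x \<in> N y" using y N_Y N_sym[of x y] by auto
      moreover have "y \<in> A" using \<open>y \<in> X\<close> xy assms disjoint_XY by auto
      ultimately show False using * x by (auto simp: nbhd_def)
    qed
  qed
  then show "A \<union> B \<in> indep" unfolding indep_def using assms by auto
qed

lemma sum_indep:
  assumes l: "l \<ge> 0" and G: "\<G> \<subseteq> Pow X"
  shows "(\<Sum>I\<in>{I\<in>indep. I \<inter> X \<in> \<G>}. l ^ card I) = (1 + l) ^ card X * (\<Sum>A\<in>\<G>. wt l A)"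
proof -
  have finG: "finite \<G>" using G finite_X finite_subset by auto
  let ?S = "SIGMA A:\<G>. Pow (Y - nbhd A)"
  have img: "{I\<in>indep. I \<inter> X \<in> \<G>} = (\<lambda>(A, B). A \<union> B) ` ?S"
  proof (intro equalityI subsetI)
    fix I assume I: "I \<in> {I\<in>indep. I \<inter> X \<in> \<G>}"
    have IXY: "I = (I \<inter> X) \<union> (I \<inter> Y)" using I unfolding indep_def by auto
    have "(I \<inter> Y) \<inter> nbhd (I \<inter> X) = {}"
      using I indep_iff[of "I \<inter> X" "I \<inter> Y"] IXY by auto
    then have "(I \<inter> X, I \<inter> Y) \<in> ?S" using I by auto
    then show "I \<in> (\<lambda>(A, B). A \<union> B) ` ?S" using IXY by (metis (no_types, lifting) case_prod_conv imageI)
  next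
    fix I assume "I \<in> (\<lambda>(A, B). A \<union> B) ` ?S"
    then obtain A B where AB: "I = A \<union> B" "A \<in> \<G>" "B \<subseteq> Y - nbhd A" by auto
    have "A \<subseteq> X" "B \<subseteq> Y" using AB G by auto
    moreover from this have "I \<inter> X = A" using AB disjoint_XY by auto
    ultimately show "I \<in> {I\<in>indep. I \<inter> X \<in> \<G>}" using AB indep_iff[of A B] by auto
  qed
  have inj: "inj_on (\<lambda>(A, B). A \<union> B) ?S"
  proof (rule inj_onI, clarify)
    fix A B A' B'
    assume h: "A \<in> \<G>" "B \<subseteq> Y - nbhd A" "A' \<in> \<G>" "B' \<subseteq> Y - nbhd A'" "A \<union> B = A' \<union> B'"
    have "A \<subseteq> X" "A' \<subseteq> X" using h G by auto
    then show "A = A' \<and> B = B'" using h disjoint_XY by blast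
  qed
  have "(\<Sum>I\<in>{I\<in>indep. I \<inter> X \<in> \<G>}. l ^ card I) = (\<Sum>(A, B)\<in>?S. l ^ card (A \<union> B))"
    unfolding img by (subst sum.reindex[OF inj]) (auto intro!: sum.cong)
  also have "\<dots> = (\<Sum>A\<in>\<G>. \<Sum>B\<in>Pow (Y - nbhd A). l ^ card (A \<union> B))"
    using finG finite_Y by (subst sum.Sigma) auto
  also have "\<dots> = (\<Sum>A\<in>\<G>. (1 + l) ^ card X * wt l A)"
  proof (rule sum.cong[OF refl])
    fix A assume "A \<in> \<G>"
    then have AX: "A \<subseteq> X" using G by auto
    have fA: "finite A" using AX finite_X finite_subset by auto
    have "(\<Sum>B\<in>Pow (Y - nbhd A). l ^ card (A \<union> B)) = (\<Sum>B\<in>Pow (Y - nbhd A). l ^ card A * l ^ card B)"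
    proof (rule sum.cong[OF refl])
      fix B assume B: "B \<in> Pow (Y - nbhd A)"
      then have "finite B" using finite_Y by (auto intro: finite_subset[of B Y])
      moreover have "A \<inter> B = {}" using B AX disjoint_XY by auto
      ultimately show "l ^ card (A \<union> B) = l ^ card A * l ^ card B"
        using fA by (simp add: card_Un_disjoint power_add)
    qed
    also have "\<dots> = l ^ card A * (1 + l) ^ card (Y - nbhd A)"
      using finite_Y by (simp add: sum_distrib_left[symmetric] sum_Pow_power)
    also have "card (Y - nbhd A) = card X - card (nbhd A)"
      using nbhd_X[OF AX] finite_Y card_Y_eq by (simp add: card_Diff_subset finite_subset)
    also have "(1 + l) ^ (card X - card (nbhd A)) = (1 + l) ^ card X / (1 + l) ^ card (nbhd A)"
      using card_mono[OF finite_Y nbhd_X[OF AX]] card_Y_eq l by (intro power_diff) auto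
    finally show "(\<Sum>B\<in>Pow (Y - nbhd A). l ^ card (A \<union> B)) = (1 + l) ^ card X * wt l A"
      by (simp add: wt_def)
  qed
  finally show ?thesis by (simp add: sum_distrib_left)
qed

text \<open>Suppose that \<open>B\<close> on one side and \<open>B'\<close> on the other both fail
  to be polymers. Then \<open>N(B)\<close>, being at least as large as \<open>[B]\<close>, and
  \<open>[B']\<close> each have more than half of the vertices of \<open>Y\<close>. They are
  disjoint because \<open>I\<close> is independent, a contradiction.\<close>

lemma good_cases:
  assumes I: "I \<in> indep"
  shows "good (I \<inter> X) \<or> biregular.good Y N (I \<inter> Y)"
proof (rule ccontr)
  interpret sw: biregular Y X N d by (rule swap)
  assume neg: "\<not> ?thesis"
  obtain S where S: "\<Union>S = I \<inter> X" "\<forall>B\<in>S. B \<noteq> {} \<and> linked N2 B" "far S"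
    using decompose[of "I \<inter> X"] by auto
  obtain S' where S': "\<Union>S' = I \<inter> Y" "\<forall>B\<in>S'. B \<noteq> {} \<and> linked N2 B" "far S'"
    using sw.decompose[of "I \<inter> Y"] by auto
  have "\<not> S \<subseteq> polymers" using neg S unfolding good_def by auto
  then obtain B where B: "B \<in> S" "B \<notin> polymers" by auto
  have "\<not> S' \<subseteq> sw.polymers" using neg S' unfolding sw.good_def by auto
  then obtain B' where B': "B' \<in> S'" "B' \<notin> sw.polymers" by auto
  have BX: "B \<subseteq> I \<inter> X" "B' \<subseteq> I \<inter> Y" using B(1) B'(1) S(1) S'(1) by auto
  have "card X < 2 * card (cl B)" using B S(2) BX unfolding polymers_def by auto
  also have "card (cl B) \<le> card (nbhd B)" using edges_leaving(1) BX by auto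
  finally have 1: "card X < 2 * card (nbhd B)" by simp
  have 2: "card Y < 2 * card (sw.cl B')" using B' S'(2) BX unfolding sw.polymers_def by auto
  have "sw.cl B' \<inter> nbhd B = {}"
  proof (rule ccontr)
    assume "\<not> ?thesis"
    then obtain u x where u: "u \<in> Y" "N u \<subseteq> nbhd B'" "x \<in> B" "u \<in> N x"
      unfolding sw.cl_def nbhd_def by auto
    have "x \<in> N u" using N_sym[of x u] u BX by auto
    then obtain y where "y \<in> B'" "x \<in> N y" using u(2) unfolding nbhd_def by auto
    then show False using I u(3) BX unfolding indep_def by blast
  qed
  moreover have "nbhd B \<subseteq> Y" "sw.cl B' \<subseteq> Y" using nbhd_X BX sw.cl_X by auto
  ultimately have "card (nbhd B \<union> sw.cl B') \<le> card Y" "nbhd B \<inter> sw.cl B' = {}"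
    "finite (nbhd B)" "finite (sw.cl B')"
    using finite_Y by (auto intro: card_mono finite_subset)
  then have "card (nbhd B) + card (sw.cl B') \<le> card Y" by (simp add: card_Un_disjoint)
  then show False using 1 2 card_Y_eq by linarith
qed

lemma swap_indep: "biregular.indep Y X N = indep"
proof -
  interpret sw: biregular Y X N d by (rule swap)
  show ?thesis unfolding indep_def sw.indep_def by (simp add: Un_commute)
qed

theorem partition_upper:
  assumes l: "l \<ge> 0"
  shows "(\<Sum>I\<in>indep. l ^ card I) \<le> (1 + l) ^ card X *
     (exp (\<Sum>B\<in>polymers. wt l B) + exp (\<Sum>B\<in>biregular.polymers Y N. wt l B))"
proof -
  interpret sw: biregular Y X N d by (rule swap)
  let ?G = "{A\<in>Pow X. good A}" and ?G' = "{A\<in>Pow Y. sw.good A}"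
  have s1: "?G \<subseteq> Pow X" and s2: "?G' \<subseteq> Pow Y" by blast+
  have sub: "indep \<subseteq> {I\<in>indep. I \<inter> X \<in> ?G} \<union> {I\<in>indep. I \<inter> Y \<in> ?G'}"
  proof
    fix I assume I: "I \<in> indep"
    from good_cases[OF I] show "I \<in> {I\<in>indep. I \<inter> X \<in> ?G} \<union> {I\<in>indep. I \<inter> Y \<in> ?G'}"
      using I by blast
  qed
  have "(\<Sum>I\<in>indep. l ^ card I) \<le> (\<Sum>I\<in>{I\<in>indep. I \<inter> X \<in> ?G} \<union> {I\<in>indep. I \<inter> Y \<in> ?G'}. l ^ card I)"
  proof (rule sum_mono2[OF _ sub])
    show "finite ({I\<in>indep. I \<inter> X \<in> ?G} \<union> {I\<in>indep. I \<inter> Y \<in> ?G'})"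
      using finite_indep by (rule rev_finite_subset) blast
  qed (use l in simp)
  also have "\<dots> \<le> (\<Sum>I\<in>{I\<in>indep. I \<inter> X \<in> ?G}. l ^ card I) + (\<Sum>I\<in>{I\<in>indep. I \<inter> Y \<in> ?G'}. l ^ card I)"
    by (rule sum_Un_le) (use finite_indep l in simp_all)
  also have "\<dots> = (1 + l) ^ card X * (\<Sum>A\<in>?G. wt l A) + (1 + l) ^ card X * (\<Sum>A\<in>?G'. wt l A)"
    using sum_indep[OF l s1] sw.sum_indep[OF l s2] card_Y_eq by (simp only: swap_indep)
  also have "\<dots> \<le> (1 + l) ^ card X * exp (\<Sum>B\<in>polymers. wt l B) + (1 + l) ^ card X * exp (\<Sum>B\<in>sw.polymers. wt l B)"
    using sum_good[OF l] sw.sum_good[OF l] l by (intro add_mono mult_left_mono) auto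
  finally show ?thesis by (simp add: distrib_left)
qed

subsection \<open>Lower bounds from separated sets\<close>

definition separated :: "'a set \<Rightarrow> bool" where
  "separated A \<longleftrightarrow> (\<forall>u\<in>A. \<forall>u'\<in>A. u \<noteq> u' \<longrightarrow> N u \<inter> N u' = {})"

lemma card_nbhd_separated: "A \<subseteq> X \<Longrightarrow> separated A \<Longrightarrow> card (nbhd A) = d * card A"
  unfolding separated_def by (intro card_nbhd_packing) blast+

lemma wt_separated:
  assumes "A \<subseteq> X" "separated A"
  shows "wt l A = (l / (1 + l) ^ d) ^ card A"
  using card_nbhd_separated[OF assms] by (simp add: wt_def power_mult power_divide)

text \<open>Separated sets are the independent sets of the graph that joins distinct vertices with a
  common neighbour. This is the deletion recursion of its independence polynomial.\<close>

lemma sum_separated_insert: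
  fixes x :: real
  assumes v: "v \<in> X" "v \<notin> W" and W: "W \<subseteq> X"
  shows "(\<Sum>A\<in>{A\<in>Pow (insert v W). separated A}. x ^ card A) =
    (\<Sum>A\<in>{A\<in>Pow W. separated A}. x ^ card A) + x * (\<Sum>A\<in>{A\<in>Pow (W - N2 v). separated A}. x ^ card A)"
proof -
  have finW: "finite W" using W finite_X finite_subset by auto
  have far_iff: "N u \<inter> N v = {} \<longleftrightarrow> u \<notin> N2 v" if u: "u \<in> X" for u
  proof -
    have "u \<in> N y \<longleftrightarrow> y \<in> N u" if "y \<in> N v" for y
    proof -
      have "y \<in> X \<union> Y" using that N_X[OF v(1)] by auto
      then show ?thesis using N_sym[of u y] N_sym[of y u] u by auto
    qed
    then show ?thesis unfolding nbhd_def by auto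
  qed
  have "separated (insert v A) \<longleftrightarrow> separated A \<and> A \<inter> N2 v = {}" if "A \<subseteq> W" for A
  proof -
    have "separated (insert v A) \<longleftrightarrow> separated A \<and> (\<forall>u\<in>A. N u \<inter> N v = {})"
    proof
      assume "separated (insert v A)"
      then show "separated A \<and> (\<forall>u\<in>A. N u \<inter> N v = {})"
        using that v(2) unfolding separated_def by (metis insertCI subsetD)
    next
      assume "separated A \<and> (\<forall>u\<in>A. N u \<inter> N v = {})"
      then show "separated (insert v A)" unfolding separated_def by (auto simp: Int_commute[of "N v"])
    qed
    then show ?thesis using far_iff that W by blast
  qed
  then have eq: "{A\<in>Pow (insert v W). separated A} = {A\<in>Pow W. separated A} \<union> insert v ` {A\<in>Pow (W - N2 v). separated A}"
    unfolding Pow_insert by blast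
  have inj: "inj_on (insert v) {A\<in>Pow (W - N2 v). separated A}"
    by (rule inj_on_inverseI[of _ "\<lambda>A. A - {v}"]) (use v(2) in auto)
  have "(\<Sum>A\<in>insert v ` {A\<in>Pow (W - N2 v). separated A}. x ^ card A) = (\<Sum>A\<in>{A\<in>Pow (W - N2 v). separated A}. x ^ card (insert v A))"
    by (rule sum.reindex[OF inj, unfolded o_def])
  also have "\<dots> = (\<Sum>A\<in>{A\<in>Pow (W - N2 v). separated A}. x * x ^ card A)"
  proof (rule sum.cong[OF refl])
    fix A assume "A \<in> {A\<in>Pow (W - N2 v). separated A}"
    then have "finite A" "v \<notin> A" using finW v(2) by (auto intro: finite_subset[of A W])
    then show "x ^ card (insert v A) = x * x ^ card A" by simp
  qed
  finally have "(\<Sum>A\<in>insert v ` {A\<in>Pow (W - N2 v). separated A}. x ^ card A) = x * (\<Sum>A\<in>{A\<in>Pow (W - N2 v). separated A}. x ^ card A)"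
    by (simp add: sum_distrib_left)
  moreover have "{A\<in>Pow W. separated A} \<inter> insert v ` {A\<in>Pow (W - N2 v). separated A} = {}"
    using v(2) by blast
  ultimately show ?thesis unfolding eq using finW by (subst sum.union_disjoint) auto
qed

lemma sum_separated_mono:
  fixes x :: real
  assumes "W \<subseteq> W'" "W' \<subseteq> X" "x \<ge> 0"
  shows "(\<Sum>A\<in>{A\<in>Pow W. separated A}. x ^ card A) \<le> (\<Sum>A\<in>{A\<in>Pow W'. separated A}. x ^ card A)"
proof (rule sum_mono2)
  show "finite {A\<in>Pow W'. separated A}" using finite_subset[OF assms(2) finite_X] by simp
  show "{A\<in>Pow W. separated A} \<subseteq> {A\<in>Pow W'. separated A}" using assms(1) by blast
qed (use assms in simp)

text \<open>Deleting one vertex costs at most a factor \<open>1 + x\<close>: the sets that contain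
  it become, after its removal, distinct separated sets that avoid it.\<close>

lemma sum_separated_remove:
  fixes x :: real
  assumes "finite B" "W \<subseteq> X" "x \<ge> 0"
  shows "(\<Sum>A\<in>{A\<in>Pow W. separated A}. x ^ card A) \<le> (1 + x) ^ card B * (\<Sum>A\<in>{A\<in>Pow (W - B). separated A}. x ^ card A)"
  using assms(1)
proof (induction B rule: finite_induct)
  case (insert b B)
  let ?P = "\<lambda>W. \<Sum>A\<in>{A\<in>Pow W. separated A}. x ^ card A"
  have "?P (W - B) \<le> (1 + x) * ?P (W - insert b B)"
  proof (cases "b \<in> W - B")
    case False
    then have e: "W - insert b B = W - B" by blast
    have "?P (W - B) \<ge> 0" using assms(3) by (intro sum_nonneg) simp
    then show ?thesis unfolding e using assms(3) mult_right_mono[of 1 "1 + x" "?P (W - B)"] by simp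
  next
    case True
    have e: "W - B = insert b (W - insert b B)" using True by blast
    have "?P (W - B) = ?P (W - insert b B) + x * ?P (W - insert b B - N2 b)"
      unfolding e by (rule sum_separated_insert) (use True assms(2) in blast)+
    also have "\<dots> \<le> ?P (W - insert b B) + x * ?P (W - insert b B)"
      using assms by (intro add_left_mono mult_left_mono sum_separated_mono) blast+
    finally show ?thesis by (simp add: algebra_simps)
  qed
  then have "(1 + x) ^ card B * ?P (W - B) \<le> (1 + x) ^ card B * ((1 + x) * ?P (W - insert b B))"
    using assms(3) by (intro mult_left_mono) auto
  also have "\<dots> = (1 + x) ^ card (insert b B) * ?P (W - insert b B)"
    using insert.hyps by simp
  finally show ?case using insert.IH by linarith
qed simp

text \<open>Adding \<open>v\<close> contributes \<open>x\<close> times the sum over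
  \<open>W - N2 v\<close>, and removing the at most \<open>d^2\<close> vertices of
  \<open>N2 v\<close> costs at most \<open>(1 + x)^(d^2)\<close>. Hence every vertex brings at least
  the same factor.\<close>

lemma sum_separated_lower:
  fixes x :: real
  assumes W: "W \<subseteq> X" and x: "x \<ge> 0"
  shows "(1 + x / (1 + x) ^ (d * d)) ^ card W \<le> (\<Sum>A\<in>{A\<in>Pow W. separated A}. x ^ card A)"
  using finite_subset[OF W finite_X] W
proof (induction W rule: finite_induct)
  case empty
  have "{A\<in>Pow {}. separated A} = {{}}" unfolding separated_def by auto
  then show ?case by simp
next
  case (insert v W)
  let ?P = "\<lambda>W. \<Sum>A\<in>{A\<in>Pow W. separated A}. x ^ card A"
  let ?c = "1 + x / (1 + x) ^ (d * d)"
  have vX: "v \<in> X" "W \<subseteq> X" using insert.prems by auto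
  have P0: "?P W' \<ge> 0" for W' using x by (intro sum_nonneg) simp
  have fin: "finite (N2 v)" using finite_subset[OF N2_X[OF vX(1)] finite_X] .
  have "?P W \<le> (1 + x) ^ card (N2 v) * ?P (W - N2 v)"
    by (rule sum_separated_remove[OF fin vX(2) x])
  also have "\<dots> \<le> (1 + x) ^ (d * d) * ?P (W - N2 v)"
    using card_N2[OF vX(1)] x P0 by (intro mult_right_mono power_increasing) auto
  finally have "?P W / (1 + x) ^ (d * d) \<le> ?P (W - N2 v)"
    using x by (simp add: pos_divide_le_eq mult.commute)
  then have "x * (?P W / (1 + x) ^ (d * d)) \<le> x * ?P (W - N2 v)" using x by (rule mult_left_mono)
  then have "?c * ?P W \<le> ?P W + x * ?P (W - N2 v)" by (simp add: algebra_simps)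
  also have "\<dots> = ?P (insert v W)" by (rule sum_separated_insert[symmetric]) (use vX insert.hyps in auto)
  finally have "?c * ?P W \<le> ?P (insert v W)" .
  moreover have "?c ^ card (insert v W) \<le> ?c * ?P W"
    using insert x vX by (simp add: mult_left_mono)
  ultimately show ?case by linarith
qed

lemma partition_lower_separated:
  fixes l :: real
  assumes l: "l \<ge> 0"
  defines "x \<equiv> l / (1 + l) ^ d"
  shows "(1 + l) ^ card X * (1 + x / (1 + x) ^ (d * d)) ^ card X \<le> (\<Sum>I\<in>{I\<in>indep. separated (I \<inter> X)}. l ^ card I)"
proof -
  have x: "x \<ge> 0" unfolding x_def using l by simp
  let ?G = "{A\<in>Pow X. separated A}"
  have eq: "{I\<in>indep. separated (I \<inter> X)} = {I\<in>indep. I \<inter> X \<in> ?G}" by blast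
  have "(1 + x / (1 + x) ^ (d * d)) ^ card X \<le> (\<Sum>A\<in>?G. x ^ card A)"
    by (rule sum_separated_lower) (use x in auto)
  also have "\<dots> = (\<Sum>A\<in>?G. wt l A)"
    unfolding x_def by (rule sum.cong) (auto simp: wt_separated)
  finally have "(1 + l) ^ card X * (1 + x / (1 + x) ^ (d * d)) ^ card X \<le> (1 + l) ^ card X * (\<Sum>A\<in>?G. wt l A)"
    using l by (intro mult_left_mono) auto
  also have "\<dots> = (\<Sum>I\<in>{I\<in>indep. I \<inter> X \<in> ?G}. l ^ card I)"
    by (rule sum_indep[symmetric]) (use l in auto)
  finally show ?thesis unfolding eq .
qed

text \<open>Disjoint neighbourhoods of size \<open>d\<close> leave room for at most
  \<open>card X / d\<close> members. The bound controls the independent sets that are separated on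
  both sides and would be counted twice in \<open>partition_lower\<close>.\<close>

lemma sum_separated_small:
  fixes l :: real
  assumes l: "0 \<le> l" "l \<le> 2"
  shows "(\<Sum>A\<in>{A\<in>Pow X. separated A}. l ^ card A) \<le> exp (real (card X) / real d * (ln (real d) + 2))"
proof -
  have d: "real d \<ge> 1" using d_ge_2 by simp
  let ?k = "real (card X) / real d"
  have sub: "{A\<in>Pow X. separated A} \<subseteq> {A. A \<subseteq> X \<and> real (card A) \<le> ?k}"
  proof
    fix A assume A: "A \<in> {A\<in>Pow X. separated A}"
    have "d * card A = card (nbhd A)"
      using card_nbhd_separated[of A] A by auto
    also have "\<dots> \<le> card X" using card_mono[OF finite_Y nbhd_X[of A]] A card_Y_eq by auto
    finally have "real (d * card A) \<le> real (card X)" by (rule of_nat_mono)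
    then show "A \<in> {A. A \<subseteq> X \<and> real (card A) \<le> ?k}" using A d by (simp add: field_simps)
  qed
  have fin: "finite {A. A \<subseteq> X \<and> real (card A) \<le> ?k}" using finite_X by simp
  have ln2: "ln (2::real) \<le> 1" using ln_le_minus_one[of "2::real"] by simp
  have "(\<Sum>A\<in>{A\<in>Pow X. separated A}. l ^ card A) \<le> (\<Sum>A\<in>{A. A \<subseteq> X \<and> real (card A) \<le> ?k}. l ^ card A)"
    using l by (intro sum_mono2[OF fin sub]) simp
  also have "\<dots> \<le> (\<Sum>A\<in>{A. A \<subseteq> X \<and> real (card A) \<le> ?k}. exp ?k)"
  proof (rule sum_mono)
    fix A assume A: "A \<in> {A. A \<subseteq> X \<and> real (card A) \<le> ?k}"
    have "l ^ card A \<le> 2 ^ card A" using l by (intro power_mono) auto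
    also have "\<dots> \<le> exp 1 ^ card A" using exp_ge_add_one_self[of "1::real"] by (intro power_mono) auto
    also have "\<dots> = exp (real (card A))" by (simp add: exp_of_nat_mult[symmetric])
    also have "\<dots> \<le> exp ?k" using A by simp
    finally show "l ^ card A \<le> exp ?k" .
  qed
  also have "\<dots> = real (card {A. A \<subseteq> X \<and> real (card A) \<le> ?k}) * exp ?k" by simp
  also have "\<dots> \<le> exp (?k * ln (real d) + real (card X) / real d) * exp ?k"
    using card_small_subsets[OF finite_X order.refl d, of ?k] by (intro mult_right_mono) auto
  also have "\<dots> = exp (?k * (ln (real d) + 2))" by (simp add: exp_add[symmetric] algebra_simps)
  finally show ?thesis .
qed

text \<open>Inclusion-exclusion over the two sides produces the factor 2. The overlap is bounded by
  ignoring independence, which leaves a product of two sums over separated sets.\<close>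

theorem partition_lower:
  fixes l :: real
  assumes l: "0 \<le> l" "l \<le> 2"
  defines "x \<equiv> l / (1 + l) ^ d"
  shows "2 * (1 + l) ^ card X * (1 + x / (1 + x) ^ (d * d)) ^ card X
     - exp (2 * (real (card X) / real d * (ln (real d) + 2))) \<le> (\<Sum>I\<in>indep. l ^ card I)"
proof -
  interpret sw: biregular Y X N d by (rule swap)
  let ?A = "{I\<in>indep. separated (I \<inter> X)}" and ?B = "{I\<in>indep. separated (I \<inter> Y)}"
  let ?SX = "{A\<in>Pow X. separated A}" and ?SY = "{A\<in>Pow Y. separated A}"
  have fin: "finite ?A" "finite ?B" using finite_indep by auto
  let ?b = "(1 + l) ^ card X * (1 + x / (1 + x) ^ (d * d)) ^ card X"
  have a: "?b \<le> (\<Sum>I\<in>?A. l ^ card I)" unfolding x_def by (rule partition_lower_separated[OF l(1)])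
  have b: "?b \<le> (\<Sum>I\<in>?B. l ^ card I)"
    using sw.partition_lower_separated[OF l(1)] unfolding x_def swap_indep card_Y_eq .
  have finS: "finite ?SX" "finite ?SY" using finite_X finite_Y by auto
  have "(\<Sum>I\<in>?A \<inter> ?B. l ^ card I) = (\<Sum>p\<in>(\<lambda>I. (I \<inter> X, I \<inter> Y)) ` (?A \<inter> ?B). l ^ card (fst p) * l ^ card (snd p))"
  proof (subst sum.reindex)
    show "inj_on (\<lambda>I. (I \<inter> X, I \<inter> Y)) (?A \<inter> ?B)"
      by (rule inj_onI) (auto simp: indep_def)
    show "(\<Sum>I\<in>?A \<inter> ?B. l ^ card I) = sum ((\<lambda>p. l ^ card (fst p) * l ^ card (snd p)) \<circ> (\<lambda>I. (I \<inter> X, I \<inter> Y))) (?A \<inter> ?B)"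
    proof (rule sum.cong[OF refl])
      fix I assume "I \<in> ?A \<inter> ?B"
      then have I: "I \<subseteq> X \<union> Y" unfolding indep_def by blast
      have "card I = card ((I \<inter> X) \<union> (I \<inter> Y))" using I by (intro arg_cong[of _ _ card]) blast
      also have "\<dots> = card (I \<inter> X) + card (I \<inter> Y)"
        using finite_X finite_Y disjoint_XY by (intro card_Un_disjoint) auto
      finally show "l ^ card I = ((\<lambda>p. l ^ card (fst p) * l ^ card (snd p)) \<circ> (\<lambda>I. (I \<inter> X, I \<inter> Y))) I"
        by (simp add: power_add)
    qed
  qed
  also have "\<dots> \<le> (\<Sum>p\<in>?SX \<times> ?SY. l ^ card (fst p) * l ^ card (snd p))"
    using l finS by (intro sum_mono2) auto
  also have "\<dots> = (\<Sum>A\<in>?SX. l ^ card A) * (\<Sum>B\<in>?SY. l ^ card B)"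
    by (simp add: sum_product sum.cartesian_product case_prod_beta)
  also have "\<dots> \<le> exp (real (card X) / real d * (ln (real d) + 2)) * exp (real (card X) / real d * (ln (real d) + 2))"
    using sum_separated_small[OF l] sw.sum_separated_small[OF l] l unfolding card_Y_eq
    by (intro mult_mono) (auto intro: sum_nonneg)
  also have "\<dots> = exp (2 * (real (card X) / real d * (ln (real d) + 2)))"
    by (simp add: exp_add[symmetric])
  finally have ab: "(\<Sum>I\<in>?A \<inter> ?B. l ^ card I) \<le> exp (2 * (real (card X) / real d * (ln (real d) + 2)))" .
  have "(\<Sum>I\<in>?A. l ^ card I) + (\<Sum>I\<in>?B. l ^ card I) = (\<Sum>I\<in>?A \<union> ?B. l ^ card I) + (\<Sum>I\<in>?A \<inter> ?B. l ^ card I)"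
    by (rule sum.union_inter[OF fin, symmetric])
  moreover have "(\<Sum>I\<in>?A \<union> ?B. l ^ card I) \<le> (\<Sum>I\<in>indep. l ^ card I)"
    using l by (intro sum_mono2[OF finite_indep]) auto
  ultimately show ?thesis using a b ab by (simp add: mult.assoc)
qed

text \<open>Only the subsets of a single side are used; the empty set, common to both, accounts for
  the 1. This is enough where the first-order exponent tends to 0.\<close>

lemma partition_lower_trivial:
  fixes l :: real
  assumes l: "0 \<le> l"
  shows "2 * (1 + l) ^ card X - 1 \<le> (\<Sum>I\<in>indep. l ^ card I)"
proof -
  have "Pow X \<union> Pow Y \<subseteq> indep"
    unfolding indep_def using N_X N_Y disjoint_XY by blast
  then have "(\<Sum>I\<in>Pow X \<union> Pow Y. l ^ card I) \<le> (\<Sum>I\<in>indep. l ^ card I)"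
    using l by (intro sum_mono2[OF finite_indep]) auto
  moreover have "Pow X \<inter> Pow Y = {{}}" using disjoint_XY by blast
  then have "(\<Sum>I\<in>Pow X \<union> Pow Y. l ^ card I) + 1 = (\<Sum>I\<in>Pow X. l ^ card I) + (\<Sum>I\<in>Pow Y. l ^ card I)"
    using sum.union_inter[of "Pow X" "Pow Y" "\<lambda>I. l ^ card I"] finite_X finite_Y by simp
  ultimately show ?thesis using sum_Pow_power[OF finite_X, of l] sum_Pow_power[OF finite_Y, of l] card_Y_eq by simp
qed

subsection \<open>Sums over small and large polymers\<close>

text \<open>A vertex added to \<open>n\<close> others shares at most two neighbours with each of
  them, so the losses add up to 0 + 2 + 4 + ... = \<open>card A * (card A - 1)\<close>.\<close>

lemma card_nbhd_ge:
  assumes "A \<subseteq> X"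
  shows "d * card A \<le> card (nbhd A) + card A * (card A - 1)"
  using finite_subset[OF assms finite_X] assms
proof (induction A rule: finite_induct)
  case (insert u A)
  have u: "u \<in> X" "A \<subseteq> X" using insert.prems by auto
  have eq: "N u \<inter> nbhd A = (\<Union>a\<in>A. N u \<inter> N a)" unfolding nbhd_def by auto
  have "card (N u \<inter> nbhd A) \<le> (\<Sum>a\<in>A. card (N u \<inter> N a))"
    unfolding eq by (rule card_UN_le[OF insert.hyps(1)])
  also have "\<dots> \<le> (\<Sum>a\<in>A. 2)"
    using u insert.hyps by (intro sum_mono codegree) auto
  finally have 1: "card (N u \<inter> nbhd A) \<le> 2 * card A" by simp
  have fin: "finite (nbhd A)" "finite (N u)" using finite_nbhd[of A] finite_N[of u] u by auto
  have "nbhd (insert u A) = nbhd A \<union> N u" unfolding nbhd_def by auto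
  then have "card (nbhd (insert u A)) + card (N u \<inter> nbhd A) = card (nbhd A) + d"
    using card_Un_Int[OF fin] card_N[of u] u by (simp add: Int_commute)
  then have "d * Suc (card A) \<le> card (nbhd (insert u A)) + (card A * (card A - 1) + 2 * card A)"
    unfolding mult_Suc_right using 1 insert.IH[OF u(2)] by linarith
  also have "card A * (card A - 1) + 2 * card A = Suc (card A) * card A"
    by (cases "card A") (auto simp: algebra_simps)
  finally show ?case using insert.hyps by simp
qed simp

lemma wt_le_exp:
  assumes l: "l > 0" "B \<subseteq> X"
  shows "wt l B \<le> exp (- (ln (1 + l) * (real (card (nbhd B)) - real (card B))))"
proof -
  have "wt l B \<le> (1 + l) ^ card B / (1 + l) ^ card (nbhd B)"
    unfolding wt_def using l by (intro divide_right_mono power_mono) auto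
  then show ?thesis using power_div_power_exp[OF l(1)] by (simp add: algebra_simps)
qed

lemma sum_wt_pairs:
  assumes l: "l \<ge> 0" and v: "v \<in> X"
  shows "(\<Sum>B\<in>{B. B \<subseteq> X \<and> v \<in> B \<and> linked N2 B \<and> card B = 2}. wt l B)
     \<le> (real d)\<^sup>2 * (l\<^sup>2 / (1 + l) ^ (2 * d - 2))"
proof -
  let ?P = "{B. B \<subseteq> X \<and> v \<in> B \<and> linked N2 B \<and> card B = 2}"
  have fin: "finite (N2 v)" using finite_subset[OF N2_X[OF v] finite_X] .
  have "?P \<subseteq> (\<lambda>u. {v, u}) ` N2 v"
  proof
    fix B assume "B \<in> ?P"
    then have B: "B \<subseteq> X" "v \<in> B" "linked N2 B" "card B = 2" by auto
    obtain u where u: "B = {v, u}" "u \<noteq> v"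
      using B(2,4) by (metis card_2_iff doubleton_eq_iff insert_iff singletonD)
    have "{v} \<subset> B \<and> {v} \<noteq> {}" using u by auto
    then have "\<exists>u'\<in>{v}. \<exists>w\<in>B - {v}. w \<in> N2 u'" using B(3) unfolding linked_def by metis
    then have "u \<in> N2 v" using u by auto
    then show "B \<in> (\<lambda>u. {v, u}) ` N2 v" using u by auto
  qed
  then have "card ?P \<le> d * d"
    using card_mono[OF finite_imageI[OF fin]] card_image_le[OF fin] card_N2[OF v] le_trans by meson
  then have "real (card ?P) \<le> real (d * d)" by (rule of_nat_mono)
  then have cP: "real (card ?P) \<le> (real d)\<^sup>2" by (simp add: power2_eq_square)
  have "(\<Sum>B\<in>?P. wt l B) \<le> (\<Sum>B\<in>?P. l\<^sup>2 / (1 + l) ^ (2 * d - 2))"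
  proof (rule sum_mono)
    fix B assume B: "B \<in> ?P"
    then have "2 * d - 2 \<le> card (nbhd B)" using card_nbhd_ge[of B] by auto
    then have "(1 + l) ^ (2 * d - 2) \<le> (1 + l) ^ card (nbhd B)" using l by (intro power_increasing) auto
    then have "l\<^sup>2 / (1 + l) ^ card (nbhd B) \<le> l\<^sup>2 / (1 + l) ^ (2 * d - 2)"
      using l by (intro divide_left_mono) auto
    then show "wt l B \<le> l\<^sup>2 / (1 + l) ^ (2 * d - 2)" using B unfolding wt_def by simp
  qed
  also have "\<dots> = real (card ?P) * (l\<^sup>2 / (1 + l) ^ (2 * d - 2))" by simp
  also have "\<dots> \<le> (real d)\<^sup>2 * (l\<^sup>2 / (1 + l) ^ (2 * d - 2))"
    using cP l by (intro mult_right_mono) auto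
  finally show ?thesis .
qed

end

text \<open>\<open>iso\<close> is the edge-isoperimetric inequality for the union of
  \<open>[A]\<close> and \<open>N(A)\<close>: every edge at \<open>[A]\<close> stays inside, so the
  degrees sum to at least \<open>2 d |[A]|\<close>, while in the cube \<open>s\<close> vertices have
  degree sum at most \<open>s log2 s\<close>.\<close>

locale expanding_biregular = biregular +
  assumes iso: "A \<subseteq> X \<Longrightarrow> 2 * real d * real (card (cl A)) \<le>
      (real (card (cl A)) + real (card (nbhd A))) * log 2 (real (card (cl A)) + real (card (nbhd A)))"
    and card_X: "card X = 2 ^ (d - 1)"
begin

lemma expansion:
  assumes A: "A \<subseteq> X" and half: "2 * card (cl A) \<le> card X"
  shows "2 * real (card (nbhd A)) \<le> 5 * real d * (real (card (nbhd A)) - real (card (cl A)))"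
proof -
  define a g s where "a = real (card (cl A))" and "g = real (card (nbhd A))" and "s = a + g"
  have gM: "card (nbhd A) \<le> card X" using card_mono[OF finite_Y nbhd_X[OF A]] card_Y_eq by simp
  obtain k where k: "d = Suc (Suc k)" using d_ge_2 by (metis add_2_eq_Suc le_Suc_ex)
  have "real (card (cl A)) \<le> real (2 ^ k)"
    by (rule of_nat_mono) (use half in \<open>simp add: card_X k\<close>)
  then have "real (card (cl A)) \<le> 2 ^ k" by simp
  moreover have "real (card (nbhd A)) \<le> real (2 * 2 ^ k)"
    by (rule of_nat_mono) (use gM in \<open>simp add: card_X k\<close>)
  then have "real (card (nbhd A)) \<le> 2 * 2 ^ k" by simp
  ultimately have s: "s \<le> 3 * 2 ^ k" unfolding s_def a_def g_def by linarith
  show ?thesis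
  proof (cases "s > 0")
    case False
    moreover have "a \<ge> 0" "g \<ge> 0" unfolding a_def g_def by simp_all
    ultimately have "a = 0" "g = 0" unfolding s_def by linarith+
    then show ?thesis unfolding a_def g_def by simp
  next
    case True
    \<comment> \<open>\<open>s\<close> is at most three quarters of \<open>2^d\<close>, and
      \<open>(3/4)^5 < 1/4\<close> turns this into a saving of 2/5 in the logarithm; hence the
      factor 5 in the conclusion.\<close>
    have "(3/4::real) ^ 5 \<le> 2 powr (-2)" by (simp add: powr_minus eval_nat_numeral)
    then have "log 2 ((3/4::real) ^ 5) \<le> - 2" by (subst log_le_iff) auto
    then have l34: "log 2 (3/4::real) \<le> - 2 / 5" by (simp add: log_nat_power)
    have "log 2 s \<le> log 2 (3 * 2 ^ k)" using True s by simp
    also have "3 * 2 ^ k = (3/4 :: real) * 2 ^ d" unfolding k by simp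
    also have "log 2 \<dots> = log 2 (3/4) + real d" by (subst log_mult) (auto simp: log_nat_power)
    finally have "log 2 s \<le> real d - 2 / 5" using l34 by simp
    then have "s * log 2 s \<le> s * (real d - 2 / 5)" using True by (intro mult_left_mono) auto
    then have "2 * real d * a \<le> s * (real d - 2 / 5)"
      using iso[OF A] unfolding a_def[symmetric] g_def[symmetric] s_def[symmetric] by linarith
    then have "2 * s \<le> 5 * real d * (s - 2 * a)" by (simp add: algebra_simps)
    then show ?thesis unfolding s_def a_def[symmetric] g_def[symmetric] by (simp add: algebra_simps a_def)
  qed
qed

text \<open>Up to \<open>d / 8\<close> vertices the codegree bound gives
  \<open>g - n \<ge> 7/8 * n * d\<close>. Of this, 5/6 yields the factor with 5/2 because
  \<open>n \<ge> 3\<close>, and the remaining 1/24 yields \<open>6 * e * n\<close> by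
  \<open>h1\<close>. For larger sets isoperimetry below size \<open>d^4\<close> gives
  \<open>g - n \<ge> n * q\<close>. Then \<open>L * n * q\<close> is at least
  \<open>5 * d * L\<close> and at least \<open>12 * e * n\<close>, hence at least their
  average.\<close>

lemma wt_mid:
  fixes l :: real
  defines "e \<equiv> ln (real d + 1)" and "L \<equiv> ln (1 + l)" and "q \<equiv> real d / (2 * log 2 (real d)) - 2"
  assumes l: "l > 0" and h1: "144 * e \<le> real d * L" and h2: "40 \<le> q" "12 * e \<le> L * q"
    and B: "B \<subseteq> X" "card B \<ge> 3" "card (cl B) + card (nbhd B) \<le> d ^ 4"
  shows "wt l B \<le> exp (- (5 / 2 * real d * L)) * exp (- (6 * e * real (card B)))"
proof -
  define n where "n = real (card B)"
  define a g where "a = real (card (cl B))" and "g = real (card (nbhd B))"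
  have L: "L > 0" unfolding L_def using l by simp
  have e0: "e \<ge> 0" unfolding e_def by simp
  have d2: "real d \<ge> 2" using d_ge_2 by simp
  have n3: "n \<ge> 3" using B(2) unfolding n_def by simp
  have "L * (g - n) \<ge> 5 / 2 * real d * L + 6 * e * n"
  proof (cases "n \<le> real d / 8")
    case True
    have "real (d * card B) \<le> real (card (nbhd B) + card B * (card B - 1))"
      using card_nbhd_ge[OF B(1)] by (rule of_nat_mono)
    moreover have "real (card B - 1) = n - 1"
      unfolding n_def using B(2) by (simp add: of_nat_diff)
    ultimately have "real d * n \<le> g + n * (n - 1)"
      unfolding g_def by (simp only: of_nat_add of_nat_mult n_def[symmetric])
    then have "n * (real d - n) \<le> g - n" by (simp add: algebra_simps)
    moreover have "n * (7 / 8 * real d) \<le> n * (real d - n)" using True n3 by (intro mult_left_mono) auto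
    ultimately have "L * (n * (7 / 8 * real d)) \<le> L * (g - n)" using L by (intro mult_left_mono) auto
    moreover have "5 / 2 * real d * L \<le> n * (5 / 6) * (real d * L)"
      using n3 d2 L mult_right_mono[of "5 / 2" "n * (5 / 6)" "real d * L"] by simp
    moreover have "n * (144 * e) \<le> n * (real d * L)" using h1 n3 by (intro mult_left_mono) auto
    ultimately show ?thesis by (simp add: algebra_simps)
  next
    case False
    have "card B \<le> card (cl B)" using subset_cl[OF B(1)] finite_subset[OF cl_X finite_X] by (intro card_mono)
    then have an: "n \<le> a" unfolding n_def a_def by simp
    have lg: "log 2 (real d) > 0" using d2 by simp
    have "real (card (cl B) + card (nbhd B)) \<le> real (d ^ 4)" using B(3) by (rule of_nat_mono)
    then have "a + g \<le> real d ^ 4" unfolding a_def g_def by simp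
    then have "log 2 (a + g) \<le> log 2 (real d ^ 4)" using an n3 d2 g_def by simp
    also have "\<dots> = 4 * log 2 (real d)" using d2 by (simp add: log_nat_power)
    finally have "(a + g) * log 2 (a + g) \<le> (a + g) * (4 * log 2 (real d))"
      using an n3 g_def by (intro mult_left_mono) auto
    then have "2 * real d * a \<le> (a + g) * (4 * log 2 (real d))"
      using iso[OF B(1)] unfolding a_def g_def by linarith
    then have "a * (real d / (2 * log 2 (real d))) \<le> a + g"
      using lg by (simp add: field_simps)
    then have "a * q \<le> g - a" unfolding q_def by (simp add: algebra_simps)
    moreover have "n * q \<le> a * q" using an h2 by (intro mult_right_mono) auto
    ultimately have "n * q \<le> g - n" using an by linarith
    then have 1: "L * (n * q) \<le> L * (g - n)" using L by (intro mult_left_mono) auto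
    have "real d / 8 * 40 \<le> n * q" using False h2 n3 by (intro mult_mono) auto
    then have 2: "L * (5 * real d) \<le> L * (n * q)" using L by (intro mult_left_mono) auto
    have "n * (12 * e) \<le> n * (L * q)" using h2 n3 by (intro mult_left_mono) auto
    then show ?thesis using 1 2 by (simp add: algebra_simps)
  qed
  then have "exp (- (L * (g - n))) \<le> exp (- (5 / 2 * real d * L) + - (6 * e * n))" by simp
  then show ?thesis using wt_le_exp[OF l B(1)] unfolding L_def g_def n_def exp_add by linarith
qed

text \<open>At most \<open>d^(4n)\<close> linked sets of size \<open>n\<close> contain
  \<open>v\<close>. The spare factor \<open>exp (- 6 e n)\<close> in \<open>wt_mid\<close> outweighs
  this number and leaves a geometric series.\<close>

lemma sum_wt_mid:
  fixes l :: real
  defines "e \<equiv> ln (real d + 1)" and "L \<equiv> ln (1 + l)" and "q \<equiv> real d / (2 * log 2 (real d)) - 2"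
  assumes l: "l > 0" and v: "v \<in> X" and h1: "144 * e \<le> real d * L" and h2: "40 \<le> q" "12 * e \<le> L * q"
  shows "(\<Sum>B\<in>{B. B \<subseteq> X \<and> v \<in> B \<and> linked N2 B \<and> card B \<ge> 3 \<and> card (cl B) + card (nbhd B) \<le> d ^ 4}. wt l B)
     \<le> exp (- (5 / 2 * real d * L)) / 2"
proof -
  let ?M = "{B. B \<subseteq> X \<and> v \<in> B \<and> linked N2 B \<and> card B \<ge> 3 \<and> card (cl B) + card (nbhd B) \<le> d ^ 4}"
  define \<M> where "\<M> n = {B \<in> ?M. card B = n}" for n
  let ?E = "exp (- (5 / 2 * real d * L))"
  have d2: "real d \<ge> 2" using d_ge_2 by simp
  have e1: "e \<ge> 1" unfolding e_def using d_ge_2 by (rule one_le_ln)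
  have finM: "finite ?M" by (rule finite_subset[of _ "Pow X"]) (use finite_X in auto)
  have finMn: "finite (\<M> n)" for n unfolding \<M>_def by (rule finite_subset[OF _ finM]) blast
  have cM: "real (card (\<M> n)) \<le> exp (4 * e * real n)" for n
  proof -
    have "card (\<M> n) \<le> card {C. C \<subseteq> X \<and> v \<in> C \<and> linked N2 C \<and> card C \<le> n}"
      by (rule card_mono[OF finite_subset[of _ "Pow X"]]) (use finite_X in \<open>auto simp: \<M>_def\<close>)
    also have "\<dots> \<le> (d * d) ^ (2 * n)"
    proof (rule card_linked_sets)
      fix u assume u: "u \<in> X"
      show "N2 u \<subseteq> X \<and> finite (N2 u) \<and> card (N2 u) \<le> d * d \<and> u \<in> N2 u"
        using N2_X[OF u] card_N2[OF u] self_N2[of u] u finite_subset[OF N2_X[OF u] finite_X] by auto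
    qed (use N2_sym v finite_X in auto)
    also have "\<dots> = d ^ (4 * n)" by (simp add: power2_eq_square[symmetric] power_mult[symmetric])
    finally have "real (card (\<M> n)) \<le> real (d ^ (4 * n))" by (rule of_nat_mono)
    also have "\<dots> = real d ^ (4 * n)" by simp
    also have "\<dots> \<le> (real d + 1) ^ (4 * n)" by (intro power_mono) auto
    also have "\<dots> = exp (real (4 * n) * e)" unfolding exp_of_nat_mult e_def using d2 by simp
    also have "\<dots> = exp (4 * e * real n)" by (simp add: algebra_simps)
    finally show ?thesis .
  qed
  have "?M \<subseteq> (\<Union>n\<in>{1..card X}. \<M> n)"
    unfolding \<M>_def using card_mono[OF finite_X] by auto
  then have "(\<Sum>B\<in>?M. wt l B) \<le> (\<Sum>n\<in>{1..card X}. \<Sum>B\<in>\<M> n. wt l B)"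
    using finMn wt_nonneg l by (intro sum_le_sum_cover) auto
  also have "\<dots> \<le> (\<Sum>n\<in>{1..card X}. ?E * (1 / 4) ^ n)"
  proof (rule sum_mono)
    fix n assume "n \<in> {1..card X}"
    have "(\<Sum>B\<in>\<M> n. wt l B) \<le> (\<Sum>B\<in>\<M> n. ?E * exp (- (6 * e * real n)))"
    proof (rule sum_mono)
      fix B assume "B \<in> \<M> n"
      then have B: "B \<subseteq> X" "card B \<ge> 3" "card (cl B) + card (nbhd B) \<le> d ^ 4" "card B = n"
        unfolding \<M>_def by auto
      show "wt l B \<le> ?E * exp (- (6 * e * real n))"
        using wt_mid[OF l _ _ _ B(1-3)] h1 h2 B(4) unfolding e_def L_def q_def by blast
    qed
    also have "\<dots> = real (card (\<M> n)) * (?E * exp (- (6 * e * real n)))" by simp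
    also have "\<dots> \<le> exp (4 * e * real n) * (?E * exp (- (6 * e * real n)))"
      using cM by (intro mult_right_mono) auto
    also have "\<dots> = ?E * exp (- (2 * e * real n))" by (simp add: exp_add[symmetric])
    also have "exp (- (2 * e * real n)) \<le> exp (- 2 * real n)"
      using e1 mult_right_mono[of 1 e "real n"] by simp
    also have "exp (- 2 * real n) = exp (- 2) ^ n" by (simp add: exp_of_nat_mult[symmetric] mult.commute)
    also have "\<dots> \<le> (1 / 4) ^ n"
    proof (rule power_mono)
      have "2 * 2 \<le> exp 1 * exp (1::real)" using exp_ge_add_one_self[of "1::real"] by (intro mult_mono) auto
      then have "4 \<le> exp (2::real)" by (simp add: exp_add[symmetric])
      then show "exp (- 2) \<le> (1 / 4 :: real)" by (simp add: exp_minus field_simps)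
    qed simp
    finally show "(\<Sum>B\<in>\<M> n. wt l B) \<le> ?E * (1 / 4) ^ n" by simp
  qed
  also have "\<dots> = ?E * (\<Sum>n\<in>{1..card X}. (1 / 4) ^ n)" by (simp add: sum_distrib_left)
  also have "(\<Sum>n\<in>{1..m}. (1 / 4 :: real) ^ n) \<le> 1 / 2" for m
  proof -
    have "(\<Sum>n\<in>{1..m}. (1 / 4 :: real) ^ n) = (1 - (1 / 4) ^ m) / 3"
    proof (induction m)
      case (Suc m)
      define z :: real where "z = (1 / 4) ^ m"
      have *: "(\<Sum>n\<in>{1..Suc m}. (1 / 4 :: real) ^ n) = (1 - z) / 3 + 1 / 4 * z"
        using Suc by (simp add: z_def)
      show ?case unfolding * power_Suc z_def[symmetric] by (simp add: field_simps)
    qed simp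
    also have "\<dots> \<le> 1 / 2"
    proof -
      have "0 \<le> (1 / 4 :: real) ^ m" by (rule zero_le_power) simp
      then have "(1 - (1 / 4 :: real) ^ m) / 3 \<le> 1 / 3" by (intro divide_right_mono) auto
      also have "(1 / 3 :: real) \<le> 1 / 2" by simp
      finally show ?thesis .
    qed
    finally show ?thesis .
  qed
  finally show ?thesis by simp
qed

text \<open>There are at most \<open>exp (2 d)\<close> pairs of sizes \<open>(a, g)\<close>. Size
  above \<open>d^4\<close> and \<open>a \<le> g\<close> make \<open>g\<close> exceed
  \<open>d^4 / 2\<close>, whence \<open>t \<ge> d^3 / 5\<close> by the expansion. Since
  \<open>large\<close> gives \<open>L1 / (64 * e) \<ge> 1 / d\<close>, the container gain is at
  least \<open>L * d^2 / 5\<close>, and \<open>h4\<close> states that this suffices.\<close>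

lemma sum_wt_big:
  fixes l :: real
  defines "e \<equiv> ln (real d + 1)" and "L \<equiv> ln (1 + l)" and "L1 \<equiv> min (ln (1 + l)) 1"
  assumes l: "l > 0" and v: "v \<in> X" and large: "250000 * e ^ 3 \<le> L1 ^ 3 * real d"
    and h4: "3 * e + 2 * real d + 1 \<le> L * ((real d)\<^sup>2 / 5 - 5 / 2 * real d)"
  shows "(\<Sum>B\<in>{B \<in> polymers. v \<in> B \<and> d ^ 4 < card (cl B) + card (nbhd B)}. wt l B)
     \<le> exp (- (5 / 2 * real d * L)) / 2"
proof -
  let ?B = "{B \<in> polymers. v \<in> B \<and> d ^ 4 < card (cl B) + card (nbhd B)}"
  define I where "I = {(a, g). a \<le> card X \<and> g \<le> card X \<and> d ^ 4 < a + g \<and> a \<le> g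
     \<and> 2 * real g \<le> 5 * real d * (real g - real a)}"
  define \<A> where "\<A> = (\<lambda>(a, g). {A. A \<subseteq> X \<and> v \<in> A \<and> linked N2 A \<and> card (cl A) = a \<and> card (nbhd A) = g})"
  have d2: "real d \<ge> 2" using d_ge_2 by simp
  have e1: "e \<ge> 1" unfolding e_def using d_ge_2 by (rule one_le_ln)
  have L: "L > 0" unfolding L_def using l by simp
  have L1: "0 < L1" "L1 \<le> 1" "L1 \<le> L" using L unfolding L1_def L_def by auto
  have subI: "I \<subseteq> {..card X} \<times> {..card X}" unfolding I_def by auto
  have finI: "finite I" by (rule finite_subset[OF subI]) simp
  have cI: "real (card I) \<le> exp (2 * real d)"
  proof -
    have "card I \<le> card ({..card X} \<times> {..card X})" by (rule card_mono[OF _ subI]) simp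
    also have "\<dots> = (2 ^ (d - 1) + 1) * (2 ^ (d - 1) + 1)" by (simp add: card_cartesian_product card_X)
    also have "\<dots> \<le> 2 ^ d * 2 ^ d"
    proof -
      have "2 ^ (d - 1) + 1 \<le> (2::nat) ^ d"
        using d_ge_2 by (cases d) auto
      then show ?thesis by (intro mult_mono) auto
    qed
    finally have "real (card I) \<le> real (2 ^ d * 2 ^ d)" by (rule of_nat_mono)
    also have "\<dots> = 2 ^ d * 2 ^ d" by simp
    also have "\<dots> \<le> exp 1 ^ d * exp (1::real) ^ d"
      using exp_ge_add_one_self[of "1::real"] by (intro mult_mono power_mono) auto
    also have "\<dots> = exp (2 * real d)" by (simp add: exp_of_nat_mult[symmetric] exp_add[symmetric])
    finally show ?thesis .
  qed
  have ratio: "1 / real d \<le> L1 / (64 * e)"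
  proof -
    have "e \<le> e ^ 3" using e1 self_le_power[of e 3] by simp
    then have "64 * e \<le> 250000 * e ^ 3" using e1 by linarith
    also have "\<dots> \<le> L1 ^ 3 * real d" by (rule large)
    also have "\<dots> \<le> L1 * real d"
      using L1 power_decreasing[of 1 3 L1] by (intro mult_right_mono) auto
    finally show ?thesis using e1 d2 by (simp add: field_simps)
  qed
  have "?B \<subseteq> (\<Union>i\<in>I. \<A> i)"
  proof
    fix B assume B: "B \<in> ?B"
    then have BX: "B \<subseteq> X" "2 * card (cl B) \<le> card X" unfolding polymers_def by auto
    have "card (nbhd B) \<le> card X" using card_mono[OF finite_Y nbhd_X[OF BX(1)]] card_Y_eq by simp
    then have "(card (cl B), card (nbhd B)) \<in> I"
      using expansion[OF BX] BX(2) edges_leaving(1)[OF BX(1)] B unfolding I_def by auto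
    then show "B \<in> (\<Union>i\<in>I. \<A> i)" using B unfolding \<A>_def polymers_def by auto
  qed
  moreover have "finite (\<A> i)" for i
    unfolding \<A>_def by (rule finite_subset[of _ "Pow X"]) (use finite_X in \<open>auto split: prod.splits\<close>)
  ultimately have "(\<Sum>B\<in>?B. wt l B) \<le> (\<Sum>i\<in>I. \<Sum>B\<in>\<A> i. wt l B)"
    using finI wt_nonneg l by (intro sum_le_sum_cover) auto
  also have "\<dots> \<le> (\<Sum>i\<in>I. exp (3 * e - L * (real d)\<^sup>2 / 5))"
  proof (rule sum_mono)
    fix i assume i: "i \<in> I"
    obtain a g where ag: "i = (a, g)" by (cases i)
    define t where "t = real g - real a"
    have h: "d ^ 4 < a + g" "a \<le> g" "2 * real g \<le> 5 * real d * t" using i unfolding ag I_def t_def by auto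
    have "real (d ^ 4) \<le> real (2 * g)" using h(1,2) by (intro of_nat_mono) linarith
    then have "real d ^ 4 \<le> 5 * real d * t" using h(3) by simp
    then have "real d * real d ^ 3 \<le> real d * (5 * t)" by (simp add: power_eq_if algebra_simps)
    then have t: "real d ^ 3 / 5 \<le> t" using d2 by simp
    have "(\<Sum>B\<in>\<A> i. wt l B) \<le> exp (3 * e - L * L1 / (64 * e) * t)"
      unfolding ag \<A>_def prod.case e_def L_def L1_def
      by (rule container_bound[OF l v t_def h(3)]) (use large in \<open>simp add: e_def L1_def\<close>)
    also have "\<dots> \<le> exp (3 * e - L * (real d)\<^sup>2 / 5)"
    proof -
      have "L * (real d)\<^sup>2 / 5 = L * (1 / real d * (real d ^ 3 / 5))"
        using d2 by (simp add: field_simps power_eq_if)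
      also have "\<dots> \<le> L * (L1 / (64 * e) * t)"
        using ratio t L L1 e1 d2 by (intro mult_left_mono mult_mono) auto
      finally show ?thesis by simp
    qed
    finally show "(\<Sum>B\<in>\<A> i. wt l B) \<le> exp (3 * e - L * (real d)\<^sup>2 / 5)" .
  qed
  also have "\<dots> = real (card I) * exp (3 * e - L * (real d)\<^sup>2 / 5)" by simp
  also have "\<dots> \<le> exp (2 * real d) * exp (3 * e - L * (real d)\<^sup>2 / 5)" using cI by (intro mult_right_mono) auto
  also have "\<dots> = exp (2 * real d + (3 * e - L * (real d)\<^sup>2 / 5))" by (rule exp_add[symmetric])
  also have "\<dots> \<le> exp (- (5 / 2 * real d * L) - 1)" using h4 by (simp add: algebra_simps)
  also have "\<dots> = exp (- (5 / 2 * real d * L)) / exp 1" by (rule exp_diff)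
  also have "\<dots> \<le> exp (- (5 / 2 * real d * L)) / 2"
    using exp_ge_add_one_self[of "1::real"] by (intro divide_left_mono) auto
  finally show ?thesis .
qed

theorem polymer_sum:
  fixes l :: real
  defines "e \<equiv> ln (real d + 1)" and "L \<equiv> ln (1 + l)" and "q \<equiv> real d / (2 * log 2 (real d)) - 2"
    and "L1 \<equiv> min (ln (1 + l)) 1"
  assumes l: "l > 0" and large: "250000 * e ^ 3 \<le> L1 ^ 3 * real d"
    and h1: "144 * e \<le> real d * L" and h2: "40 \<le> q" "12 * e \<le> L * q"
    and h4: "3 * e + 2 * real d + 1 \<le> L * ((real d)\<^sup>2 / 5 - 5 / 2 * real d)"
  shows "(\<Sum>B\<in>polymers. wt l B) \<le> real (card X) * (l / (1 + l) ^ d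
     + ((real d)\<^sup>2 * (l\<^sup>2 / (1 + l) ^ (2 * d - 2)) + exp (- (5 / 2 * real d * L))))"
proof -
  \<comment> \<open>Each polymer is charged to one of its vertices. Singletons give the main term
    and pairs the quadratic error. Sets of at least three vertices are split at size
    \<open>d^4\<close>, and each class gives half of the last term.\<close>
  define \<S> where "\<S> v = {{v}} \<union> ({B. B \<subseteq> X \<and> v \<in> B \<and> linked N2 B \<and> card B = 2} \<union>
     ({B. B \<subseteq> X \<and> v \<in> B \<and> linked N2 B \<and> card B \<ge> 3 \<and> card (cl B) + card (nbhd B) \<le> d ^ 4} \<union>
     {B \<in> polymers. v \<in> B \<and> d ^ 4 < card (cl B) + card (nbhd B)}))" for v
  have finP: "finite {B. B \<subseteq> X \<and> P B}" for P
    by (rule finite_subset[of _ "Pow X"]) (use finite_X in auto)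
  have fin: "finite (\<S> v)" for v unfolding \<S>_def using finP finite_polymers by simp
  have "polymers \<subseteq> (\<Union>v\<in>X. \<S> v)"
  proof
    fix B assume B: "B \<in> polymers"
    then have BX: "B \<subseteq> X" "B \<noteq> {}" "linked N2 B" unfolding polymers_def by auto
    then obtain v where v: "v \<in> B" by auto
    have finB: "finite B" using BX(1) finite_X finite_subset by auto
    then have "card B \<noteq> 0" using v by auto
    then consider "card B = 1" | "card B = 2" | "card B \<ge> 3" by linarith
    then have "B \<in> \<S> v"
    proof cases
      case 1
      then have "B = {v}" using v by (metis card_1_singletonE singletonD)
      then show ?thesis unfolding \<S>_def by simp
    next
      case 2
      then show ?thesis using BX v unfolding \<S>_def by simp
    next
      case 3
      then show ?thesis using BX v B unfolding \<S>_def
        by (cases "card (cl B) + card (nbhd B) \<le> d ^ 4") simp_all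
    qed
    then show "B \<in> (\<Union>v\<in>X. \<S> v)" using v BX by auto
  qed
  then have "(\<Sum>B\<in>polymers. wt l B) \<le> (\<Sum>v\<in>X. \<Sum>B\<in>\<S> v. wt l B)"
    using fin finite_X wt_nonneg l by (intro sum_le_sum_cover) auto
  also have "\<dots> \<le> (\<Sum>v\<in>X. l / (1 + l) ^ d
     + ((real d)\<^sup>2 * (l\<^sup>2 / (1 + l) ^ (2 * d - 2)) + exp (- (5 / 2 * real d * L))))"
  proof (rule sum_mono)
    fix v assume v: "v \<in> X"
    let ?P2 = "{B. B \<subseteq> X \<and> v \<in> B \<and> linked N2 B \<and> card B = 2}"
    let ?P3 = "{B. B \<subseteq> X \<and> v \<in> B \<and> linked N2 B \<and> card B \<ge> 3 \<and> card (cl B) + card (nbhd B) \<le> d ^ 4}"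
    let ?P4 = "{B \<in> polymers. v \<in> B \<and> d ^ 4 < card (cl B) + card (nbhd B)}"
    have f: "finite ?P2" "finite ?P3" "finite ?P4" using finP finite_polymers by simp_all
    have nn: "wt l B \<ge> 0" for B using wt_nonneg l by simp
    have "(\<Sum>B\<in>\<S> v. wt l B) \<le> wt l {v} + (sum (wt l) ?P2 + (sum (wt l) ?P3 + sum (wt l) ?P4))"
    proof -
      have "sum (wt l) (?P3 \<union> ?P4) \<le> sum (wt l) ?P3 + sum (wt l) ?P4"
        by (rule sum_Un_le) (use f nn in simp_all)
      moreover have "sum (wt l) (?P2 \<union> (?P3 \<union> ?P4)) \<le> sum (wt l) ?P2 + sum (wt l) (?P3 \<union> ?P4)"
        by (rule sum_Un_le) (use f nn in simp_all)
      moreover have "sum (wt l) (\<S> v) \<le> sum (wt l) {{v}} + sum (wt l) (?P2 \<union> (?P3 \<union> ?P4))"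
        unfolding \<S>_def by (rule sum_Un_le) (use f nn in simp_all)
      ultimately show ?thesis by simp
    qed
    moreover have "wt l {v} = l / (1 + l) ^ d" using v card_N[of v] unfolding wt_def nbhd_def by simp
    moreover have "sum (wt l) ?P2 \<le> (real d)\<^sup>2 * (l\<^sup>2 / (1 + l) ^ (2 * d - 2))"
      by (rule sum_wt_pairs) (use l v in auto)
    moreover have "sum (wt l) ?P3 \<le> exp (- (5 / 2 * real d * L)) / 2"
      using sum_wt_mid[OF l v] h1 h2 unfolding e_def L_def q_def by blast
    moreover have "sum (wt l) ?P4 \<le> exp (- (5 / 2 * real d * L)) / 2"
      using sum_wt_big[OF l v] large h4 unfolding e_def L_def L1_def by blast
    ultimately show "(\<Sum>B\<in>\<S> v. wt l B) \<le> l / (1 + l) ^ d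
     + ((real d)\<^sup>2 * (l\<^sup>2 / (1 + l) ^ (2 * d - 2)) + exp (- (5 / 2 * real d * L)))"
      by linarith
  qed
  also have "\<dots> = real (card X) * (l / (1 + l) ^ d
     + ((real d)\<^sup>2 * (l\<^sup>2 / (1 + l) ^ (2 * d - 2)) + exp (- (5 / 2 * real d * L))))" by simp
  finally show ?thesis .
qed

end

section \<open>The hypercube\<close>

lemma le_log_one_plus:
  fixes t :: real
  assumes "0 \<le> t" "t \<le> 1"
  shows "t \<le> log 2 (1 + t)"
proof -
  have "exp ((1 - t) *\<^sub>R 0 + t *\<^sub>R ln 2) \<le> (1 - t) * exp 0 + t * exp (ln (2::real))"
    using assms by (intro convex_onD[OF exp_convex]) auto
  then have "exp (t * ln 2) \<le> 1 + t" by simp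
  then have "t * ln 2 \<le> ln (1 + t)" using assms by (subst ln_ge_iff) auto
  then show ?thesis by (simp add: log_def pos_le_divide_eq)
qed

text \<open>The \<open>x\<close>-term and the \<open>y\<close>-term each supply one
  \<open>y\<close>: the former by \<open>le_log_one_plus\<close> at \<open>y / x\<close>, the latter
  because \<open>2 y \<le> x + y\<close>.\<close>

lemma entropy_two_point:
  fixes x y :: real
  assumes "0 \<le> y" "y \<le> x"
  shows "x * log 2 x + y * log 2 y + 2 * y \<le> (x + y) * log 2 (x + y)"
proof (cases "y = 0")
  case False
  then have pos: "x > 0" "y > 0" using assms by auto
  have "y / x \<le> log 2 (1 + y / x)" using pos assms by (intro le_log_one_plus) auto
  also have "1 + y / x = (x + y) / x" using pos by (simp add: field_simps)
  also have "log 2 ((x + y) / x) = log 2 (x + y) - log 2 x" using pos by (simp add: log_divide)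
  finally have 1: "y \<le> x * (log 2 (x + y) - log 2 x)" using pos by (simp add: pos_divide_le_eq mult.commute)
  have "log 2 (2 * y) \<le> log 2 (x + y)" using pos assms by simp
  then have "1 + log 2 y \<le> log 2 (x + y)" using pos by (simp add: log_mult)
  then have 2: "y * (1 + log 2 y) \<le> y * log 2 (x + y)" using pos by (intro mult_left_mono) auto
  show ?thesis using 1 2 by (simp add: algebra_simps)
qed simp

text \<open>Subtraction on \<open>nat\<close> is truncated, so flipping is an involution only at
  coordinates with value 0 or 1; hence the side conditions below.\<close>

definition flip :: "nat \<Rightarrow> (nat \<Rightarrow> nat) \<Rightarrow> nat \<Rightarrow> nat" where
  "flip i x = x(i := 1 - x i)"

lemma flip_flip: "x i \<in> {0, 1} \<Longrightarrow> flip i (flip i x) = x"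
  by (auto simp: flip_def fun_eq_iff)

lemma inj_on_flip: "(\<And>x. x \<in> S \<Longrightarrow> x i \<in> {0, 1}) \<Longrightarrow> inj_on (flip i) S"
  by (rule inj_on_inverseI[of _ "flip i"]) (simp add: flip_flip)

text \<open>Splitting \<open>S\<close> along one coordinate reduces this to the two-point inequality.\<close>

lemma edge_isoperimetry:
  assumes "finite I" "finite S" "\<And>x i. x \<in> S \<Longrightarrow> i \<in> I \<Longrightarrow> x i \<in> {0, 1}"
  shows "real (\<Sum>x\<in>S. card {i \<in> I. flip i x \<in> S}) \<le> real (card S) * log 2 (real (card S))"
  using assms
proof (induction I arbitrary: S rule: finite_induct)
  case empty
  show ?case by (cases "card S = 0") auto
next
  case (insert i I)
  define T where "T b = {x \<in> S. x i = b}" for b :: nat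
  have finT: "finite (T b)" for b unfolding T_def using insert.prems by simp
  have S: "S = T 0 \<union> T 1" "T 0 \<inter> T 1 = {}" unfolding T_def using insert.prems(2)[of _ i] by auto
  have IH: "real (\<Sum>x\<in>T b. card {j \<in> I. flip j x \<in> T b}) \<le> real (card (T b)) * log 2 (real (card (T b)))" for b
    by (rule insert.IH[OF finT]) (use insert.prems(2) in \<open>auto simp: T_def\<close>)
  \<comment> \<open>Edges in direction \<open>i\<close> match a part of \<open>T 0\<close> with a
    part of \<open>T 1\<close>, so each half gains at most the size of the smaller one. Both halves
    together give the term \<open>2 * y\<close> of \<open>entropy_two_point\<close>.\<close>
  have step: "(\<Sum>x\<in>T b. card {j \<in> insert i I. flip j x \<in> S})
      \<le> (\<Sum>x\<in>T b. card {j \<in> I. flip j x \<in> T b}) + min (card (T 0)) (card (T 1))"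
    if b: "b \<in> {0, 1}" for b
  proof -
    define K where "K = {x \<in> T b. flip i x \<in> S}"
    have "card {j \<in> insert i I. flip j x \<in> S} = card {j \<in> I. flip j x \<in> T b} + (if x \<in> K then 1 else 0)"
      if x: "x \<in> T b" for x
    proof -
      have "{j \<in> insert i I. flip j x \<in> S} = {j \<in> I. flip j x \<in> T b} \<union> (if x \<in> K then {i} else {})"
        using x insert.hyps(2) unfolding K_def T_def by (auto simp: flip_def)
      then show ?thesis using insert.hyps by auto
    qed
    then have eq: "(\<Sum>x\<in>T b. card {j \<in> insert i I. flip j x \<in> S})
       = (\<Sum>x\<in>T b. card {j \<in> I. flip j x \<in> T b}) + (\<Sum>x\<in>T b. if x \<in> K then 1 else 0)"
      by (simp add: sum.distrib)
    have "K \<subseteq> T b" unfolding K_def by auto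
    then have "(\<Sum>x\<in>T b. if x \<in> K then 1 else 0) = card K"
      using finT by (simp add: sum.If_cases Int_absorb1)
    moreover have "card K \<le> card (T b)" using \<open>K \<subseteq> T b\<close> finT by (intro card_mono)
    moreover have "card K \<le> card (T (1 - b))"
    proof (rule card_inj_on_le[OF _ _ finT])
      show "inj_on (flip i) K" using insert.prems(2) unfolding K_def T_def by (intro inj_on_flip) auto
      show "flip i ` K \<subseteq> T (1 - b)" unfolding K_def T_def flip_def by auto
    qed
    ultimately show ?thesis unfolding eq using b by auto
  qed
  define s0 s1 where "s0 = real (card (T 0))" and "s1 = real (card (T 1))"
  have cS: "real (card S) = s0 + s1" unfolding s0_def s1_def S(1) using S(2) finT by (simp add: card_Un_disjoint)
  have "(\<Sum>x\<in>S. card {j \<in> insert i I. flip j x \<in> S}) =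
     (\<Sum>x\<in>T 0. card {j \<in> insert i I. flip j x \<in> S}) + (\<Sum>x\<in>T 1. card {j \<in> insert i I. flip j x \<in> S})"
    using S finT by (metis (no_types, lifting) sum.union_disjoint)
  also have "\<dots> \<le> (\<Sum>x\<in>T 0. card {j \<in> I. flip j x \<in> T 0}) + (\<Sum>x\<in>T 1. card {j \<in> I. flip j x \<in> T 1})
     + 2 * min (card (T 0)) (card (T 1))"
    using step[of 0] step[of 1] by simp
  finally have "real (\<Sum>x\<in>S. card {j \<in> insert i I. flip j x \<in> S}) \<le>
     real ((\<Sum>x\<in>T 0. card {j \<in> I. flip j x \<in> T 0}) + (\<Sum>x\<in>T 1. card {j \<in> I. flip j x \<in> T 1})
     + 2 * min (card (T 0)) (card (T 1)))" by (rule of_nat_mono)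
  also have "\<dots> = real (\<Sum>x\<in>T 0. card {j \<in> I. flip j x \<in> T 0}) + real (\<Sum>x\<in>T 1. card {j \<in> I. flip j x \<in> T 1})
     + 2 * min s0 s1" unfolding s0_def s1_def by (simp add: of_nat_min)
  also have "\<dots> \<le> s0 * log 2 s0 + s1 * log 2 s1 + 2 * min s0 s1"
    using IH[of 0] IH[of 1] unfolding s0_def s1_def by linarith
  also have "\<dots> \<le> (s0 + s1) * log 2 (s0 + s1)"
  proof (cases "s1 \<le> s0")
    case True
    then show ?thesis using entropy_two_point[of s1 s0] by (simp add: s1_def)
  next
    case False
    then show ?thesis using entropy_two_point[of s0 s1] by (simp add: s0_def add.commute)
  qed
  finally show ?case unfolding cS .
qed

section \<open>The cube as an expanding biregular graph\<close>

definition cube_nbrs :: "nat \<Rightarrow> (nat \<Rightarrow> nat) \<Rightarrow> (nat \<Rightarrow> nat) set" where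
  "cube_nbrs d x = (\<lambda>i. flip i x) ` {..<d}"

definition cube_part :: "nat \<Rightarrow> bool \<Rightarrow> (nat \<Rightarrow> nat) set" where
  "cube_part d b = {x \<in> cube_verts d. even (\<Sum>i<d. x i) = b}"

lemma cube_vertsD: "x \<in> cube_verts d \<Longrightarrow> i < d \<Longrightarrow> x i \<in> {0, 1}"
  unfolding cube_verts_def by auto

lemma flip_cube: "x \<in> cube_verts d \<Longrightarrow> i < d \<Longrightarrow> flip i x \<in> cube_verts d"
  unfolding cube_verts_def flip_def by (auto simp: PiE_iff extensional_def)

lemma finite_cube: "finite (cube_verts d)"
  unfolding cube_verts_def by (intro finite_PiE) auto

lemma card_cube: "card (cube_verts d) = 2 ^ d"
  unfolding cube_verts_def by (simp add: card_funcsetE numeral_2_eq_2)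

lemma cube_adj_iff:
  assumes x: "x \<in> cube_verts d" and y: "y \<in> cube_verts d"
  shows "cube_adj d x y \<longleftrightarrow> y \<in> cube_nbrs d x"
proof
  assume "cube_adj d x y"
  then obtain i where i: "{i \<in> {..<d}. x i \<noteq> y i} = {i}"
    unfolding cube_adj_def using card_1_singletonE by blast
  then have id: "i < d" "x i \<noteq> y i" by auto
  have "y = flip i x"
  proof
    fix j
    show "y j = flip i x j"
    proof (cases "j = i")
      case True
      then show ?thesis using cube_vertsD[OF x id(1)] cube_vertsD[OF y id(1)] id unfolding flip_def by auto
    next
      case False
      have "x j = y j"
      proof (cases "j < d")
        case True
        then show ?thesis using i False by auto
      next
        case False
        then show ?thesis using x y unfolding cube_verts_def by (auto simp: PiE_iff extensional_def)
      qed
      then show ?thesis using False unfolding flip_def by simp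
    qed
  qed
  then show "y \<in> cube_nbrs d x" using id unfolding cube_nbrs_def by auto
next
  assume "y \<in> cube_nbrs d x"
  then obtain i where i: "i < d" "y = flip i x" unfolding cube_nbrs_def by auto
  have "{j \<in> {..<d}. x j \<noteq> y j} = {i}"
    using i cube_vertsD[OF x i(1)] unfolding flip_def by auto
  then show "cube_adj d x y" unfolding cube_adj_def by simp
qed

lemma flip_eq_iff: "x i \<in> {0, 1} \<Longrightarrow> flip i x = flip j x \<longleftrightarrow> i = j"
  by (auto simp: flip_def fun_eq_iff split: if_splits)

lemma card_cube_nbrs: "x \<in> cube_verts d \<Longrightarrow> card (cube_nbrs d x) = d"
  unfolding cube_nbrs_def using flip_eq_iff cube_vertsD by (subst card_image) (auto simp: inj_on_def)

lemma cube_nbrs_sym: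
  assumes "x \<in> cube_verts d" "y \<in> cube_nbrs d x"
  shows "x \<in> cube_nbrs d y"
proof -
  obtain i where i: "i < d" "y = flip i x" using assms unfolding cube_nbrs_def by auto
  then have "x = flip i y" using flip_flip cube_vertsD assms(1) by metis
  then show ?thesis using i unfolding cube_nbrs_def by auto
qed

text \<open>If flipping \<open>i\<close> in \<open>u\<close> and \<open>j\<close> in
  \<open>w\<close> gives the same vertex, then \<open>i \<noteq> j\<close>, and \<open>u\<close> and
  \<open>w\<close> differ at \<open>i\<close> and nowhere except \<open>i\<close> and
  \<open>j\<close>. Every common neighbour thus arises from \<open>u\<close> by flipping one of at
  most two fixed coordinates.\<close>

lemma cube_codegree:
  assumes u: "u \<in> cube_verts d" and w: "w \<in> cube_verts d" and "u \<noteq> w"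
  shows "card (cube_nbrs d u \<inter> cube_nbrs d w) \<le> 2"
proof (cases "cube_nbrs d u \<inter> cube_nbrs d w = {}")
  case False
  let ?D = "{k. k < d \<and> u k \<noteq> w k}"
  have key: "u i \<noteq> w i \<and> ?D \<subseteq> {i, j}" if ij: "i < d" "j < d" "flip i u = flip j w" for i j
  proof -
    have "i \<noteq> j"
    proof
      assume "i = j"
      then have "flip i (flip i u) = flip i (flip i w)" using ij by simp
      then show False using flip_flip cube_vertsD u w ij(1) \<open>u \<noteq> w\<close> by metis
    qed
    have eq: "(if k = i then 1 - u k else u k) = (if k = j then 1 - w k else w k)" for k
      using fun_cong[OF ij(3), of k] unfolding flip_def by auto
    have "u i \<noteq> w i" using eq[of i] \<open>i \<noteq> j\<close> cube_vertsD[OF u ij(1)] by auto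
    moreover have "?D \<subseteq> {i, j}"
    proof
      fix k assume "k \<in> ?D"
      then show "k \<in> {i, j}" using eq[of k] by (cases "k = i"; cases "k = j") auto
    qed
    ultimately show ?thesis by simp
  qed
  obtain i j where ij: "i < d" "j < d" "flip i u = flip j w"
    using False unfolding cube_nbrs_def by auto
  have "cube_nbrs d u \<inter> cube_nbrs d w \<subseteq> (\<lambda>k. flip k u) ` ?D"
    unfolding cube_nbrs_def using key by auto
  also have "\<dots> \<subseteq> (\<lambda>k. flip k u) ` {i, j}" using key[OF ij] by auto
  finally have "card (cube_nbrs d u \<inter> cube_nbrs d w) \<le> card ((\<lambda>k. flip k u) ` {i, j})"
    by (intro card_mono) auto
  also have "\<dots> \<le> card {i, j}" by (rule card_image_le) simp
  also have "\<dots> \<le> 2" by (simp add: card_insert_le_m1)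
  finally show ?thesis .
qed simp

lemma flip_part:
  assumes "x \<in> cube_part d b" "i < d"
  shows "flip i x \<in> cube_part d (\<not> b)"
proof -
  have x: "x \<in> cube_verts d" and xb: "even (\<Sum>i<d. x i) = b" using assms unfolding cube_part_def by auto
  have xi: "x i \<in> {0, 1}" using cube_vertsD[OF x assms(2)] .
  have "(\<Sum>j<d. flip i x j) = flip i x i + (\<Sum>j\<in>{..<d} - {i}. flip i x j)"
    using assms(2) by (intro sum.remove) auto
  also have "(\<Sum>j\<in>{..<d} - {i}. flip i x j) = (\<Sum>j\<in>{..<d} - {i}. x j)"
    unfolding flip_def by (intro sum.cong) auto
  finally have 1: "(\<Sum>j<d. flip i x j) = (1 - x i) + (\<Sum>j\<in>{..<d} - {i}. x j)" unfolding flip_def by simp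
  have 2: "(\<Sum>j<d. x j) = x i + (\<Sum>j\<in>{..<d} - {i}. x j)"
    using assms(2) by (intro sum.remove) auto
  have "even (\<Sum>j<d. flip i x j) \<longleftrightarrow> \<not> even (\<Sum>j<d. x j)"
    unfolding 1 2 using xi by auto
  then show ?thesis using flip_cube[OF x assms(2)] xb unfolding cube_part_def by auto
qed

lemma cube_part_Un: "cube_part d b \<union> cube_part d (\<not> b) = cube_verts d"
  unfolding cube_part_def by auto

lemma cube_biregular:
  assumes "d \<ge> 2"
  shows "biregular (cube_part d b) (cube_part d (\<not> b)) (cube_nbrs d) d"
proof
  show "finite (cube_part d b)" "finite (cube_part d (\<not> b))"
    unfolding cube_part_def using finite_cube by auto
  show "cube_part d b \<inter> cube_part d (\<not> b) = {}" unfolding cube_part_def by auto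
  show "cube_nbrs d x \<subseteq> cube_part d (\<not> b)" if "x \<in> cube_part d b" for x
    using flip_part[OF that] unfolding cube_nbrs_def by auto
  show "cube_nbrs d x \<subseteq> cube_part d b" if "x \<in> cube_part d (\<not> b)" for x
    using flip_part[OF that] unfolding cube_nbrs_def by auto
qed (use assms cube_part_Un[of d b] card_cube_nbrs cube_nbrs_sym cube_codegree in auto)

lemma cube_expanding:
  assumes d: "d \<ge> 2"
  shows "expanding_biregular (cube_part d b) (cube_part d (\<not> b)) (cube_nbrs d) d"
proof -
  interpret biregular "cube_part d b" "cube_part d (\<not> b)" "cube_nbrs d" d by (rule cube_biregular[OF d])
  let ?X = "cube_part d b" and ?Y = "cube_part d (\<not> b)"
  show ?thesis
  proof
    fix A assume A: "A \<subseteq> ?X"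
    define C G where "C = cl A" and "G = nbhd A"
    have CX: "C \<subseteq> ?X" unfolding C_def by (rule cl_X)
    have GY: "G \<subseteq> ?Y" unfolding G_def by (rule nbhd_X[OF A])
    have CV: "C \<subseteq> cube_verts d" and GV: "G \<subseteq> cube_verts d" using CX GY cube_part_Un[of d b] by auto
    have fin: "finite C" "finite G" using finite_subset[OF CV finite_cube] finite_subset[OF GV finite_cube] by auto
    have disj: "C \<inter> G = {}" using CX GY disjoint_XY by auto
    let ?f = "\<lambda>x. card {i \<in> {..<d}. flip i x \<in> C \<union> G}"
    have fC: "?f x = d" if x: "x \<in> C" for x
    proof -
      have "flip i x \<in> G" if "i < d" for i
        using x that unfolding C_def G_def cl_def cube_nbrs_def by auto
      then have "{i \<in> {..<d}. flip i x \<in> C \<union> G} = {..<d}" by auto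
      then show ?thesis by simp
    qed
    have fG: "card (cube_nbrs d y \<inter> C) \<le> ?f y" if y: "y \<in> G" for y
    proof -
      have "cube_nbrs d y \<inter> C \<subseteq> (\<lambda>i. flip i y) ` {i \<in> {..<d}. flip i y \<in> C \<union> G}"
        unfolding cube_nbrs_def by auto
      then show ?thesis by (rule surj_card_le[rotated]) simp
    qed
    have "(\<Sum>y\<in>G. card (cube_nbrs d y \<inter> C)) = (\<Sum>x\<in>C. card (cube_nbrs d x \<inter> G))"
      using CX GY by (intro double_count) auto
    also have "\<dots> = (\<Sum>x\<in>C. d)"
    proof (rule sum.cong[OF refl])
      fix x assume x: "x \<in> C"
      then have "cube_nbrs d x \<inter> G = cube_nbrs d x" unfolding C_def G_def by (rule nbhd_Int_cl[OF A])
      then show "card (cube_nbrs d x \<inter> G) = d" using card_cube_nbrs x CV by auto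
    qed
    finally have e: "(\<Sum>y\<in>G. card (cube_nbrs d y \<inter> C)) = card C * d" by simp
    \<comment> \<open>Each of the \<open>d * card C\<close> edges between \<open>C\<close> and
      \<open>G\<close> is seen from both of its ends.\<close>
    have "card C * d + card C * d \<le> (\<Sum>x\<in>C. ?f x) + (\<Sum>y\<in>G. ?f y)"
      using fC sum_mono[of G "\<lambda>y. card (cube_nbrs d y \<inter> C)" ?f] fG e by simp
    also have "\<dots> = (\<Sum>x\<in>C \<union> G. ?f x)" using fin disj by (simp add: sum.union_disjoint)
    finally have "real (card C * d + card C * d) \<le> real (\<Sum>x\<in>C \<union> G. ?f x)" by (rule of_nat_mono)
    also have "\<dots> \<le> real (card (C \<union> G)) * log 2 (real (card (C \<union> G)))"
    proof (rule edge_isoperimetry)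
      show "x i \<in> {0, 1}" if "x \<in> C \<union> G" "i \<in> {..<d}" for x i
        using cube_vertsD[of x d i] that CV GV by auto
    qed (use fin in auto)
    finally show "2 * real d * real (card (cl A)) \<le> (real (card (cl A)) + real (card (nbhd A))) *
        log 2 (real (card (cl A)) + real (card (nbhd A)))"
      unfolding C_def[symmetric] G_def[symmetric] using fin disj by (simp add: card_Un_disjoint algebra_simps)
  next
    have "card (cube_verts d) = card ?X + card ?Y"
      unfolding cube_part_Un[of d b, symmetric] using finite_X finite_Y disjoint_XY by (rule card_Un_disjoint)
    then have "2 * card ?X = 2 ^ d" using card_Y_eq card_cube by simp
    then show "card ?X = 2 ^ (d - 1)" using d by (cases d) auto
  qed
qed

lemma cube_Z_eq:
  assumes d: "d \<ge> 2"
  shows "cube_Z l d = (\<Sum>I\<in>biregular.indep (cube_part d True) (cube_part d False) (cube_nbrs d). l ^ card I)"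
proof -
  interpret biregular "cube_part d True" "cube_part d False" "cube_nbrs d" d
    using cube_biregular[OF d, of True] by simp
  have "indep_sets (cube_verts d) (cube_adj d) = indep"
    unfolding indep_sets_def indep_def using cube_part_Un[of d True] cube_adj_iff by auto blast+
  then show ?thesis unfolding cube_Z_def by simp
qed

theorem cube_Z_upper:
  fixes l :: real and d :: nat
  defines "e \<equiv> ln (real d + 1)" and "L \<equiv> ln (1 + l)" and "q \<equiv> real d / (2 * log 2 (real d)) - 2"
    and "L1 \<equiv> min (ln (1 + l)) 1"
  assumes d: "d \<ge> 2" and l: "l > 0" and large: "250000 * e ^ 3 \<le> L1 ^ 3 * real d"
    and h1: "144 * e \<le> real d * L" and h2: "40 \<le> q" "12 * e \<le> L * q"
    and h4: "3 * e + 2 * real d + 1 \<le> L * ((real d)\<^sup>2 / 5 - 5 / 2 * real d)"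
  shows "cube_Z l d \<le> 2 * (1 + l) ^ 2 ^ (d - 1) * exp (2 ^ (d - 1) * (l / (1 + l) ^ d
     + ((real d)\<^sup>2 * (l\<^sup>2 / (1 + l) ^ (2 * d - 2)) + exp (- (5 / 2 * real d * L)))))"
proof -
  interpret a: expanding_biregular "cube_part d True" "cube_part d False" "cube_nbrs d" d
    using cube_expanding[OF d, of True] by simp
  interpret b: expanding_biregular "cube_part d False" "cube_part d True" "cube_nbrs d" d
    using cube_expanding[OF d, of False] by simp
  let ?E = "exp (2 ^ (d - 1) * (l / (1 + l) ^ d
     + ((real d)\<^sup>2 * (l\<^sup>2 / (1 + l) ^ (2 * d - 2)) + exp (- (5 / 2 * real d * L)))))"
  have "exp (sum (a.wt l) a.polymers) \<le> ?E"
    using a.polymer_sum[OF l] large h1 h2 h4 unfolding a.card_X e_def L_def q_def L1_def by simp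
  moreover have "exp (sum (a.wt l) b.polymers) \<le> ?E"
    using b.polymer_sum[OF l] large h1 h2 h4 unfolding b.card_X e_def L_def q_def L1_def by simp
  moreover have "cube_Z l d \<le> (1 + l) ^ 2 ^ (d - 1) * (exp (sum (a.wt l) a.polymers) + exp (sum (a.wt l) b.polymers))"
    using a.partition_upper[of l] l unfolding cube_Z_eq[OF d] a.card_X by simp
  moreover have "(1 + l) ^ 2 ^ (d - 1) * (exp (sum (a.wt l) a.polymers) + exp (sum (a.wt l) b.polymers))
     \<le> (1 + l) ^ 2 ^ (d - 1) * (?E + ?E)"
    using calculation l by (intro mult_left_mono add_mono) auto
  ultimately show ?thesis by simp
qed

text \<open>One bound for each range of \<open>l\<close>. The first serves large \<open>l\<close>.
  The second, from one side only, serves small \<open>l\<close>, where a factor 2 is immaterial. The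
  third keeps the factor 2 at the price of the overlap.\<close>

theorem cube_Z_lower:
  fixes l :: real and d :: nat
  assumes d: "d \<ge> 2" and l: "0 \<le> l"
  defines "x \<equiv> l / (1 + l) ^ d"
  shows "2 * (1 + l) ^ 2 ^ (d - 1) - 1 \<le> cube_Z l d"
    and "(1 + l) ^ 2 ^ (d - 1) * (1 + x / (1 + x) ^ (d * d)) ^ 2 ^ (d - 1) \<le> cube_Z l d"
    and "l \<le> 2 \<Longrightarrow> 2 * (1 + l) ^ 2 ^ (d - 1) * (1 + x / (1 + x) ^ (d * d)) ^ 2 ^ (d - 1)
       - exp (2 * (2 ^ (d - 1) / real d * (ln (real d) + 2))) \<le> cube_Z l d"
proof -
  interpret a: expanding_biregular "cube_part d True" "cube_part d False" "cube_nbrs d" d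
    using cube_expanding[OF d, of True] by simp
  show "2 * (1 + l) ^ 2 ^ (d - 1) - 1 \<le> cube_Z l d"
    using a.partition_lower_trivial[OF l] unfolding cube_Z_eq[OF d] a.card_X .
  show "2 * (1 + l) ^ 2 ^ (d - 1) * (1 + x / (1 + x) ^ (d * d)) ^ 2 ^ (d - 1)
       - exp (2 * (2 ^ (d - 1) / real d * (ln (real d) + 2))) \<le> cube_Z l d" if "l \<le> 2"
    using a.partition_lower[OF l that] unfolding cube_Z_eq[OF d] a.card_X x_def by simp
  have "(1 + l) ^ 2 ^ (d - 1) * (1 + x / (1 + x) ^ (d * d)) ^ 2 ^ (d - 1)
     \<le> (\<Sum>I\<in>{I\<in>a.indep. a.separated (I \<inter> cube_part d True)}. l ^ card I)"
    using a.partition_lower_separated[OF l] unfolding a.card_X x_def .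
  also have "\<dots> \<le> (\<Sum>I\<in>a.indep. l ^ card I)"
    using a.finite_indep l by (intro sum_mono2) auto
  finally show "(1 + l) ^ 2 ^ (d - 1) * (1 + x / (1 + x) ^ (d * d)) ^ 2 ^ (d - 1) \<le> cube_Z l d"
    unfolding cube_Z_eq[OF d] .
qed

section \<open>Asymptotics\<close>

definition first_order :: "real \<Rightarrow> nat \<Rightarrow> real" where
  "first_order l d = l / 2 * (2 / (1 + l)) ^ d"

text \<open>A bound for the total weight of the polymers with at least two vertices.\<close>

definition correction :: "real \<Rightarrow> nat \<Rightarrow> real" where
  "correction l d = 2 ^ (d - 1) * ((real d)\<^sup>2 * (l\<^sup>2 / (1 + l) ^ (2 * d - 2)) + exp (- (5 / 2 * real d * ln (1 + l))))"

text \<open>The lower end of the range in part 3, for \<open>c\<^sub>0 = 300\<close>.\<close>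

definition lam_min :: "nat \<Rightarrow> real" where
  "lam_min d = 300 * ln (real d) / real d powr (1 / 3)"

lemma first_order_eq: "d \<ge> 1 \<Longrightarrow> 2 ^ (d - 1) * (l / (1 + l) ^ d) = first_order l d"
  unfolding first_order_def by (cases d) (auto simp: power_divide)

lemma power_eq_exp: "l > -1 \<Longrightarrow> (1 + l) ^ n = exp (real n * ln (1 + l :: real))"
  by (simp add: exp_of_nat_mult)

lemma half_le_ln: "0 \<le> x \<Longrightarrow> x \<le> 1 / 2 \<Longrightarrow> x / 2 \<le> ln (1 + x :: real)"
proof -
  assume x: "0 \<le> x" "x \<le> 1 / 2"
  have "x * x \<le> x * (1 / 2)" using x by (intro mult_left_mono) auto
  moreover have "x - x\<^sup>2 \<le> ln (1 + x)" using x by (intro ln_one_plus_pos_lower_bound) auto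
  ultimately show ?thesis by (simp add: power2_eq_square)
qed

lemma lam_min_small: "\<forall>\<^sub>F d in sequentially. lam_min d \<le> 2 / 5"
  unfolding lam_min_def by real_asymp

lemma ln_ge_lam_min: "\<forall>\<^sub>F d in sequentially. 0 < lam_min d \<and> (\<forall>l\<ge>lam_min d. lam_min d / 2 \<le> ln (1 + l))"
proof -
  have "\<forall>\<^sub>F d in sequentially. 0 < lam_min d" unfolding lam_min_def by real_asymp
  with lam_min_small show ?thesis
  proof eventually_elim
    case (elim d)
    have "lam_min d / 2 \<le> ln (1 + l)" if "l \<ge> lam_min d" for l
    proof -
      have "lam_min d / 2 \<le> ln (1 + lam_min d)" using elim by (intro half_le_ln) auto
      also have "\<dots> \<le> ln (1 + l)" using that elim by simp
      finally show ?thesis .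
    qed
    then show ?case using elim by auto
  qed
qed

text \<open>The threshold for \<open>d\<close> is uniform in \<open>l\<close>, so the bound can be
  applied along any sequence \<open>lam\<close>.\<close>

lemma upper_eventually:
  "\<forall>\<^sub>F d in sequentially. \<forall>l\<ge>lam_min d. cube_Z l d \<le> 2 * (1 + l) ^ 2 ^ (d - 1) * exp (first_order l d + correction l d)"
proof -
  have e1: "\<forall>\<^sub>F d in sequentially. ln (real d + 1) \<le> 2 * ln (real d)" by real_asymp
  have e2: "\<forall>\<^sub>F d in sequentially. 144 * ln (real d + 1) \<le> real d * (lam_min d / 2)" unfolding lam_min_def by real_asymp
  have e3: "\<forall>\<^sub>F d in sequentially. 40 \<le> real d / (2 * log 2 (real d)) - 2" unfolding log_def by real_asymp
  have e4: "\<forall>\<^sub>F d in sequentially. 12 * ln (real d + 1) \<le> lam_min d / 2 * (real d / (2 * log 2 (real d)) - 2)"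
    unfolding lam_min_def log_def by real_asymp
  have e5: "\<forall>\<^sub>F d in sequentially. 3 * ln (real d + 1) + 2 * real d + 1 \<le> lam_min d / 2 * ((real d)\<^sup>2 / 5 - 5 / 2 * real d)"
    unfolding lam_min_def by real_asymp
  have e6: "\<forall>\<^sub>F d in sequentially. 0 \<le> (real d)\<^sup>2 / 5 - 5 / 2 * real d" by real_asymp
  show ?thesis
    using e1 e2 e3 e4 e5 e6 ln_ge_lam_min lam_min_small eventually_ge_at_top[of 2]
  proof eventually_elim
    case (elim d)
    show ?case
    proof (intro allI impI)
      fix l assume l: "lam_min d \<le> l"
      have l0: "l > 0" using l elim by linarith
      define m where "m = lam_min d / 2"
      have L: "m \<le> ln (1 + l)" using elim l unfolding m_def by auto
      have m0: "m > 0" "m \<le> 1" using elim unfolding m_def by auto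
      \<comment> \<open>This is what the constant 300 must achieve: half of it, cubed, is 3375000,
        which exceeds the 250000 times 8 required by \<open>large\<close> when
        \<open>ln (d + 1)\<close> is replaced by \<open>2 * ln d\<close>.\<close>
      have "m ^ 3 * real d = 3375000 * ln (real d) ^ 3 * (real d / (real d powr (1 / 3)) ^ 3)"
        unfolding m_def lam_min_def by (simp add: power_divide power_mult_distrib)
      also have "(real d powr (1 / 3)) ^ 3 = real d" using elim by (simp add: powr_power)
      finally have m3: "m ^ 3 * real d = 3375000 * ln (real d) ^ 3" using elim by simp
      have "250000 * ln (real d + 1) ^ 3 \<le> 250000 * (2 * ln (real d)) ^ 3"
        using elim by (intro mult_left_mono power_mono) auto
      also have "\<dots> \<le> m ^ 3 * real d" unfolding m3 using elim by (simp add: power_mult_distrib)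
      also have "\<dots> \<le> min (ln (1 + l)) 1 ^ 3 * real d"
        using L m0 by (intro mult_right_mono power_mono) auto
      finally have large: "250000 * ln (real d + 1) ^ 3 \<le> min (ln (1 + l)) 1 ^ 3 * real d" .
      have h1: "144 * ln (real d + 1) \<le> real d * ln (1 + l)"
        using elim(2) mult_left_mono[OF L, of "real d"] unfolding m_def by simp
      have h2: "12 * ln (real d + 1) \<le> ln (1 + l) * (real d / (2 * log 2 (real d)) - 2)"
        using elim(3,4) mult_right_mono[OF L, of "real d / (2 * log 2 (real d)) - 2"] unfolding m_def by linarith
      have h4: "3 * ln (real d + 1) + 2 * real d + 1 \<le> ln (1 + l) * ((real d)\<^sup>2 / 5 - 5 / 2 * real d)"
        using elim(5,6) mult_right_mono[OF L, of "(real d)\<^sup>2 / 5 - 5 / 2 * real d"] unfolding m_def by linarith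
      have "cube_Z l d \<le> 2 * (1 + l) ^ 2 ^ (d - 1) * exp (2 ^ (d - 1) * (l / (1 + l) ^ d
         + ((real d)\<^sup>2 * (l\<^sup>2 / (1 + l) ^ (2 * d - 2)) + exp (- (5 / 2 * real d * ln (1 + l))))))"
        using elim large h1 h2 h4 l0 by (intro cube_Z_upper) auto
      also have "2 ^ (d - 1) * (l / (1 + l) ^ d
         + ((real d)\<^sup>2 * (l\<^sup>2 / (1 + l) ^ (2 * d - 2)) + exp (- (5 / 2 * real d * ln (1 + l)))))
         = first_order l d + correction l d"
        unfolding distrib_left[of _ "l / (1 + l) ^ d"] correction_def using first_order_eq[of d l] elim by simp
      finally show "cube_Z l d \<le> 2 * (1 + l) ^ 2 ^ (d - 1) * exp (first_order l d + correction l d)" .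
    qed
  qed
qed

text \<open>With \<open>y = x / (1 + x)^(d^2)\<close>, Bernoulli-type estimates give
  \<open>y \<ge> x - d^2 x^2\<close>, and \<open>ln (1 + y) \<ge> y - y^2\<close> loses another
  \<open>x^2\<close>. Multiplied by \<open>2^(d-1)\<close>, the \<open>x\<close>-term becomes
  \<open>first_order l d\<close>.\<close>

lemma separated_product_lower:
  fixes l :: real and d :: nat
  assumes d: "d \<ge> 1" and l: "l \<ge> 0"
  defines "x \<equiv> l / (1 + l) ^ d"
  shows "exp (first_order l d - first_order l d * x * ((real d)\<^sup>2 + 1)) \<le> (1 + x / (1 + x) ^ (d * d)) ^ 2 ^ (d - 1)"
proof -
  define y where "y = x / (1 + x) ^ (d * d)"
  have "(1 + l) ^ 1 \<le> (1 + l) ^ d" using l d by (intro power_increasing) auto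
  then have x: "0 \<le> x" "x \<le> 1" unfolding x_def using l by (auto simp: divide_le_eq)
  have "1 \<le> (1 + x) ^ (d * d)" using x by (intro one_le_power) auto
  then have y: "0 \<le> y" "y \<le> x" unfolding y_def using x mult_left_mono[of 1 "(1 + x) ^ (d * d)" x]
    by (auto simp: divide_le_eq)
  have "1 - real (d * d) * x \<le> exp (- (real (d * d) * x))"
    using exp_ge_add_one_self[of "- (real (d * d) * x)"] by simp
  also have "\<dots> = 1 / exp x ^ (d * d)" by (simp add: exp_minus exp_of_nat_mult divide_inverse del: of_nat_mult)
  also have "\<dots> \<le> 1 / (1 + x) ^ (d * d)"
    using x exp_ge_add_one_self[of x] by (intro divide_left_mono power_mono mult_pos_pos) auto
  finally have "x * (1 - real (d * d) * x) \<le> x * (1 / (1 + x) ^ (d * d))" using x by (intro mult_left_mono)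
  then have yx: "x - (real d)\<^sup>2 * x\<^sup>2 \<le> y" unfolding y_def by (simp add: algebra_simps power2_eq_square)
  have "y\<^sup>2 \<le> x\<^sup>2" using y by (intro power_mono) auto
  then have "x - ((real d)\<^sup>2 + 1) * x\<^sup>2 \<le> y - y\<^sup>2" using yx by (simp add: algebra_simps)
  also have "\<dots> \<le> ln (1 + y)" using x y by (intro ln_one_plus_pos_lower_bound) auto
  finally have "2 ^ (d - 1) * (x - ((real d)\<^sup>2 + 1) * x\<^sup>2) \<le> real (2 ^ (d - 1)) * ln (1 + y)"
    by simp
  then have "exp (2 ^ (d - 1) * (x - ((real d)\<^sup>2 + 1) * x\<^sup>2)) \<le> exp (real (2 ^ (d - 1)) * ln (1 + y))" by simp
  also have "\<dots> = (1 + y) ^ 2 ^ (d - 1)" using y by (intro power_eq_exp[symmetric]) auto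
  also have "2 ^ (d - 1) * (x - ((real d)\<^sup>2 + 1) * x\<^sup>2) = 2 ^ (d - 1) * x - 2 ^ (d - 1) * x * x * ((real d)\<^sup>2 + 1)"
    by (simp add: algebra_simps power2_eq_square)
  also have "2 ^ (d - 1) * x = first_order l d" unfolding x_def using d by (rule first_order_eq)
  finally show ?thesis unfolding y_def .
qed

lemma two_power_eq: "d \<ge> 1 \<Longrightarrow> (2::real) ^ (d - 1) = 2 powr real d / 2"
  by (cases d) (auto simp: powr_realpow powr_add)

text \<open>An exact rewriting in exponentials of \<open>ln (1 + l)\<close>, the form in which lower
  bounds on that logarithm can be inserted.\<close>

lemma correction_le:
  assumes l: "0 < l" and d: "d \<ge> 1"
  shows "correction l d = 2 powr real d / 2 * ((real d)\<^sup>2 * l\<^sup>2 * (1 + l)\<^sup>2 * exp (- (2 * real d * ln (1 + l)))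
     + exp (- (5 / 2 * real d * ln (1 + l))))"
proof -
  have "(1 + l) ^ (2 * d - 2) * (1 + l)\<^sup>2 = (1 + l) ^ (2 * d)"
    unfolding power_add[symmetric] using d by (intro arg_cong[of _ _ "(^) (1 + l)"]) simp
  also have "\<dots> = exp (2 * real d * ln (1 + l))" using l by (subst power_eq_exp) auto
  finally have "l\<^sup>2 / (1 + l) ^ (2 * d - 2) = l\<^sup>2 * (1 + l)\<^sup>2 * exp (- (2 * real d * ln (1 + l)))"
    using l by (simp add: exp_minus field_simps)
  then show ?thesis unfolding correction_def two_power_eq[OF d] by simp
qed

section \<open>The three ranges of lambda\<close>

lemma cube_Z_above_one:
  fixes lam w :: "nat \<Rightarrow> real"
  assumes w: "filterlim w at_top sequentially" and lam: "\<forall>\<^sub>F d in sequentially. lam d \<ge> 1 + w d / real d"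
  shows "\<exists>e. e \<longlonglongrightarrow> 0 \<and> (\<forall>\<^sub>F d in sequentially. cube_Z (lam d) d = (2 + e d) * (1 + lam d) ^ 2 ^ (d - 1))"
proof -
  define e where "e d = cube_Z (lam d) d / (1 + lam d) ^ 2 ^ (d - 1) - 2" for d
  define r where "r d = 2 powr real d / 2 * ((real d)\<^sup>2 * (16 * exp (- (2 * real d * ln 2))) + exp (- (5 / 2 * real d * ln 2)))" for d :: nat
  have wpos: "\<forall>\<^sub>F d in sequentially. w d > 0" using w by (simp add: filterlim_at_top_dense)
  have ev: "\<forall>\<^sub>F d in sequentially. lam d \<ge> 1 \<and> - (2 / 2 powr real d) \<le> e d \<and> e d \<le> 2 * exp (4 / w d + r d) - 2"
    using lam wpos upper_eventually lam_min_small eventually_ge_at_top[of 2]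
  proof eventually_elim
    case (elim d)
    define l where "l = lam d"
    have d: "d \<ge> 2" "real d > 0" using elim by auto
    have lw: "l \<ge> 1 + w d / real d" using elim unfolding l_def by simp
    have "w d / real d > 0" using elim d by simp
    then have l1: "l \<ge> 1" using lw by linarith
    have pos: "(1 + l) ^ 2 ^ (d - 1) > 0" using l1 by simp
    \<comment> \<open>\<open>l\<close> may be unbounded, so it is cancelled against one factor
      \<open>1 + l\<close>. The other \<open>d - 1\<close> factors, at least half of
      \<open>d\<close>, give \<open>w d / 4\<close> by Bernoulli, however slowly \<open>w\<close>
      grows.\<close>
    have "first_order l d \<le> 4 / w d"
    proof -
      obtain k where k: "d = Suc k" "k \<ge> 1" using d by (cases d) auto
      have "first_order l d = l / (1 + l) * (2 / (1 + l)) ^ k" unfolding first_order_def k by simp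
      also have "\<dots> \<le> 1 * (2 / (1 + l)) ^ k" using l1 by (intro mult_right_mono) auto
      also have "\<dots> = 1 / ((1 + l) / 2) ^ k" by (simp add: power_divide)
      also have "\<dots> \<le> 1 / (w d / 4)"
      proof (rule divide_left_mono)
        have "1 / 2 \<le> real k / real d" using k by (simp add: field_simps)
        then have "w d / 2 * (1 / 2) \<le> w d / 2 * (real k / real d)" using elim by (intro mult_left_mono) auto
        also have "\<dots> \<le> 1 + real k * (w d / (2 * real d))" by (simp add: field_simps)
        also have "\<dots> \<le> (1 + w d / (2 * real d)) ^ k" using elim d
          by (intro Bernoulli_inequality) (auto intro: order.trans[of _ 0])
        also have "\<dots> \<le> ((1 + l) / 2) ^ k" using lw elim by (intro power_mono) (auto simp: field_simps)
        finally show "w d / 4 \<le> ((1 + l) / 2) ^ k" by simp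
      qed (use elim l1 in auto)
      finally show ?thesis by simp
    qed
    \<comment> \<open>Again \<open>l^2\<close> is cancelled, against two of the factors
      \<open>1 + l\<close>. The remaining \<open>2 d - 4\<close> factors are at least 2, which
      explains the 16 in \<open>r\<close>.\<close>
    moreover have "correction l d \<le> r d"
    proof -
      obtain k where k: "d = k + 2" using d by (metis add.commute le_Suc_ex)
      have p: "(1 + l) ^ (2 * d - 2) = (1 + l) ^ (2 * k) * (1 + l)\<^sup>2"
        unfolding power_add[symmetric] k by (intro arg_cong[of _ _ "(^) (1 + l)"]) simp
      have "l\<^sup>2 / (1 + l) ^ (2 * d - 2) \<le> (1 + l)\<^sup>2 / (1 + l) ^ (2 * d - 2)"
        using l1 by (intro divide_right_mono power_mono) auto
      also have "\<dots> = 1 / (1 + l) ^ (2 * k)" unfolding p using l1 by simp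
      also have "\<dots> \<le> 1 / 2 ^ (2 * k)" using l1 by (intro divide_left_mono power_mono mult_pos_pos) auto
      also have "\<dots> = 16 / 2 ^ (2 * d)" unfolding k by (simp add: power_add)
      also have "(2::real) ^ (2 * d) = exp (2 * real d * ln 2)" using power_eq_exp[of 1 "2 * d"] by simp
      also have "16 / exp (2 * real d * ln 2) = 16 * exp (- (2 * real d * ln 2))" by (simp add: exp_minus divide_inverse)
      finally have a: "l\<^sup>2 / (1 + l) ^ (2 * d - 2) \<le> 16 * exp (- (2 * real d * ln 2))" .
      have "ln 2 \<le> ln (1 + l)" using l1 by simp
      then have b: "exp (- (5 / 2 * real d * ln (1 + l))) \<le> exp (- (5 / 2 * real d * ln 2))"
        using d by simp
      have "(2::real) ^ (d - 1) = 2 powr real d / 2" using d by (intro two_power_eq) auto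
      then show ?thesis unfolding correction_def r_def
        using a b by (simp only:) (intro mult_left_mono add_mono, auto)
    qed
    ultimately have "exp (first_order l d + correction l d) \<le> exp (4 / w d + r d)" by simp
    then have "2 * (1 + l) ^ 2 ^ (d - 1) * exp (first_order l d + correction l d) \<le> 2 * (1 + l) ^ 2 ^ (d - 1) * exp (4 / w d + r d)"
      using pos by (intro mult_left_mono) auto
    moreover have "lam_min d \<le> l" using elim l1 by linarith
    then have "cube_Z l d \<le> 2 * (1 + l) ^ 2 ^ (d - 1) * exp (first_order l d + correction l d)"
      using elim by blast
    ultimately have "cube_Z l d \<le> 2 * exp (4 / w d + r d) * (1 + l) ^ 2 ^ (d - 1)" by (simp add: algebra_simps)
    then have up: "e d \<le> 2 * exp (4 / w d + r d) - 2" using pos unfolding e_def l_def[symmetric]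
      by (simp add: divide_le_eq)
    have "2 * (1 + l) ^ 2 ^ (d - 1) - 1 \<le> cube_Z l d" using cube_Z_lower(1)[of d l] d l1 by simp
    then have "(2 * (1 + l) ^ 2 ^ (d - 1) - 1) / (1 + l) ^ 2 ^ (d - 1) \<le> cube_Z l d / (1 + l) ^ 2 ^ (d - 1)"
      using pos by (intro divide_right_mono) auto
    then have lo: "- (1 / (1 + l) ^ 2 ^ (d - 1)) \<le> e d"
      using pos l1 unfolding e_def l_def[symmetric] by (auto simp: diff_divide_distrib split: if_splits)
    have "(2::real) ^ (d - 1) * 1 \<le> 2 ^ (d - 1) * l" using l1 by (intro mult_left_mono) auto
    then have "(2::real) ^ (d - 1) \<le> 1 + real (2 ^ (d - 1)) * l"
      unfolding of_nat_power of_nat_numeral by linarith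
    also have "\<dots> \<le> (1 + l) ^ 2 ^ (d - 1)" using l1 by (intro Bernoulli_inequality) auto
    finally have "1 / (1 + l) ^ 2 ^ (d - 1) \<le> 1 / 2 ^ (d - 1)" using l1 by (intro divide_left_mono) auto
    also have "(1::real) / 2 ^ (d - 1) = 2 / 2 powr real d" using d by (subst two_power_eq) auto
    finally show ?case using up lo l1 unfolding l_def by linarith
  qed
  have r0: "r \<longlonglongrightarrow> 0" unfolding r_def[abs_def] by real_asymp
  have "(\<lambda>d. 4 / w d) \<longlonglongrightarrow> 0" using w by (rule tendsto_divide_0[OF tendsto_const filterlim_at_top_imp_at_infinity])
  then have "(\<lambda>d. 2 * exp (4 / w d + r d) - 2) \<longlonglongrightarrow> 2 * exp (0 + 0) - 2"
    using r0 by (intro tendsto_intros)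
  then have u: "(\<lambda>d. 2 * exp (4 / w d + r d) - 2) \<longlonglongrightarrow> 0" by simp
  have lo: "(\<lambda>d. - (2 / 2 powr real d)) \<longlonglongrightarrow> 0" by real_asymp
  have "e \<longlonglongrightarrow> 0"
    by (rule tendsto_sandwich[OF _ _ lo u]) (use ev in \<open>auto elim: eventually_mono\<close>)
  moreover have "\<forall>\<^sub>F d in sequentially. cube_Z (lam d) d = (2 + e d) * (1 + lam d) ^ 2 ^ (d - 1)"
    using ev by eventually_elim (auto simp: e_def)
  ultimately show ?thesis by blast
qed

text \<open>This makes \<open>2^d d^2 (1 + l)^(-2d)\<close> at most a constant times
  \<open>d\<close> to the power \<open>-\<epsilon>\<close>, the reason for the coefficient sqrt 2 of
  the logarithm. At the border \<open>1 + l = sqrt 2 * (1 + u)\<close> with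
  \<open>u = c * ln d / d\<close>, and the second-order loss \<open>2 * d * u^2\<close> tends to 0;
  the 1 absorbs it.\<close>

lemma ln_lower_window:
  fixes lam :: "nat \<Rightarrow> real" and \<epsilon> :: real
  assumes eps: "\<epsilon> > 0"
  shows "\<forall>\<^sub>F d in sequentially. \<forall>l\<ge>sqrt 2 - 1 + (sqrt 2 + \<epsilon>) * ln (real d) / real d.
     real d * ln 2 + 2 * (1 + \<epsilon> / 2) * ln (real d) - 1 \<le> 2 * real d * ln (1 + l)"
proof -
  define c where "c = 1 + \<epsilon> / sqrt 2"
  have c: "c > 1" "1 + \<epsilon> / 2 \<le> c"
  proof -
    show "c > 1" unfolding c_def using eps by simp
    have "sqrt 2 \<le> 2" using real_sqrt_le_mono[of 2 4] by simp
    then show "1 + \<epsilon> / 2 \<le> c" unfolding c_def using eps by (intro add_left_mono divide_left_mono) auto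
  qed
  have "(\<lambda>d. 2 * c\<^sup>2 * ((ln (real d))\<^sup>2 / real d)) \<longlonglongrightarrow> 2 * c\<^sup>2 * 0"
    by (intro tendsto_intros) real_asymp
  then have "\<forall>\<^sub>F d in sequentially. 2 * c\<^sup>2 * ((ln (real d))\<^sup>2 / real d) < 1"
    by (rule order_tendstoD) simp
  moreover have "(\<lambda>d. c * (ln (real d) / real d)) \<longlonglongrightarrow> c * 0"
    by (intro tendsto_intros) real_asymp
  then have "\<forall>\<^sub>F d in sequentially. c * (ln (real d) / real d) < 1"
    by (rule order_tendstoD) simp
  ultimately show ?thesis using eventually_ge_at_top[of 1]
  proof eventually_elim
    case (elim d)
    have d: "real d > 0" "ln (real d) \<ge> 0" using elim by auto
    define u where "u = c * (ln (real d) / real d)"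
    have u: "0 \<le> u" "u \<le> 1" using elim c d unfolding u_def by auto
    show ?case
    proof (intro allI impI)
      fix l assume l: "sqrt 2 - 1 + (sqrt 2 + \<epsilon>) * ln (real d) / real d \<le> l"
      have "sqrt 2 * (1 + u) = sqrt 2 + (sqrt 2 + \<epsilon>) * ln (real d) / real d"
        unfolding u_def c_def using d by (simp add: field_simps)
      then have le: "sqrt 2 * (1 + u) \<le> 1 + l" using l by linarith
      have "0 < sqrt 2 * (1 + u)" using u by simp
      then have "ln (sqrt 2 * (1 + u)) \<le> ln (1 + l)" using le by simp
      moreover have "ln (sqrt 2 * (1 + u)) = ln 2 / 2 + ln (1 + u)"
        using u by (simp add: ln_mult ln_sqrt)
      moreover have "u - u\<^sup>2 \<le> ln (1 + u)" using u by (intro ln_one_plus_pos_lower_bound)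
      ultimately have "ln 2 / 2 + (u - u\<^sup>2) \<le> ln (1 + l)" by linarith
      then have "2 * real d * (ln 2 / 2 + (u - u\<^sup>2)) \<le> 2 * real d * ln (1 + l)" using d by (intro mult_left_mono) auto
      moreover have "2 * real d * (ln 2 / 2 + (u - u\<^sup>2)) = real d * ln 2 + 2 * c * ln (real d) - 2 * c\<^sup>2 * ((ln (real d))\<^sup>2 / real d)"
        unfolding u_def using d by (simp add: field_simps power2_eq_square)
      moreover have "2 * (1 + \<epsilon> / 2) * ln (real d) \<le> 2 * c * ln (real d)"
        using c d by (intro mult_right_mono) auto
      ultimately show "real d * ln 2 + 2 * (1 + \<epsilon> / 2) * ln (real d) - 1 \<le> 2 * real d * ln (1 + l)"
        using elim by linarith
    qed
  qed
qed

text \<open>Covers both alternatives of part 2: what they share is a fixed margin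
  \<open>\<epsilon>\<close> above the threshold and an upper bound on \<open>lam\<close>.\<close>

lemma cube_Z_between:
  fixes lam :: "nat \<Rightarrow> real"
  assumes eps: "\<epsilon> > 0"
    and lam: "\<forall>\<^sub>F d in sequentially. sqrt 2 - 1 + (sqrt 2 + \<epsilon>) * ln (real d) / real d \<le> lam d \<and> lam d \<le> 2"
  shows "\<exists>e. e \<longlonglongrightarrow> 0 \<and> (\<forall>\<^sub>F d in sequentially. cube_Z (lam d) d =
     (2 + e d) * (1 + lam d) ^ 2 ^ (d - 1) * exp (first_order (lam d) d))"
proof -
  define e where "e d = cube_Z (lam d) d / ((1 + lam d) ^ 2 ^ (d - 1) * exp (first_order (lam d) d)) - 2" for d
  \<comment> \<open>Up to constants, \<open>s\<close> bounds the pairs and also the loss in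
    \<open>separated_product_lower\<close>; both are of order
    \<open>2^d d^2 (1 + l)^(-2d)\<close>.\<close>
  define s where "s d = exp 1 * exp (- (\<epsilon> * ln (real d)))" for d :: nat
  define r where "r d = 18 * s d + 2 powr real d / 2 * exp (- (5 / 4 * real d * ln 2))" for d :: nat
  \<comment> \<open>The overlap term of the lower bound relative to
    \<open>(1 + l) ^ 2 ^ (d - 1)\<close>, which is at least
    \<open>exp (2 ^ (d - 1) * ln 2 / 2)\<close>. It vanishes because the overlap exponent is smaller
    by a factor of order ln d / d.\<close>
  define q where "q d = exp (2 * (2 powr real d / 2 / real d * (ln (real d) + 2)) - 2 powr real d / 2 * (ln 2 / 2))" for d :: nat
  have ev: "\<forall>\<^sub>F d in sequentially. lam d \<ge> 2 / 5 \<and> 2 * exp (- (4 * s d)) - q d - 2 \<le> e d \<and> e d \<le> 2 * exp (r d) - 2"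
    using lam ln_lower_window[OF eps] upper_eventually lam_min_small eventually_ge_at_top[of 2]
  proof eventually_elim
    case (elim d)
    define l where "l = lam d"
    have d: "d \<ge> 2" "real d > 0" "real d \<ge> 1" "ln (real d) \<ge> 0" using elim by auto
    have "(7 / 5 :: real) \<le> sqrt 2" by (rule real_le_rsqrt) (simp add: power2_eq_square)
    moreover have "0 \<le> (sqrt 2 + \<epsilon>) * ln (real d) / real d" using d eps by simp
    ultimately have l: "2 / 5 \<le> l" "l \<le> 2" and lsq: "sqrt 2 \<le> 1 + l"
      using elim unfolding l_def by linarith+
    have L: "real d * ln 2 + 2 * (1 + \<epsilon> / 2) * ln (real d) - 1 \<le> 2 * real d * ln (1 + l)"
      using elim unfolding l_def by blast
    have "ln (sqrt 2) \<le> ln (1 + l)" using lsq l by simp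
    then have L2: "ln 2 / 2 \<le> ln (1 + l)" by (simp add: ln_sqrt)
    have M: "(2::real) ^ (d - 1) = 2 powr real d / 2" using d by (intro two_power_eq) auto
    have key: "2 powr real d * ((real d)\<^sup>2 * exp (- (2 * real d * ln (1 + l)))) \<le> s d"
    proof -
      have "2 powr real d * ((real d)\<^sup>2 * exp (- (2 * real d * ln (1 + l))))
        = exp (real d * ln 2 + 2 * ln (real d) - 2 * real d * ln (1 + l))"
      proof -
        have "2 powr real d = exp (real d * ln 2)" by (simp add: powr_def)
        moreover have "(real d)\<^sup>2 = exp (2 * ln (real d))" using d exp_of_nat_mult[of 2 "ln (real d)"] by simp
        ultimately show ?thesis by (simp add: exp_add exp_diff exp_minus divide_inverse)
      qed
      also have "\<dots> \<le> exp (1 - \<epsilon> * ln (real d))" using L by (simp add: algebra_simps)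
      also have "\<dots> = s d" unfolding s_def by (simp add: exp_diff exp_minus divide_inverse)
      finally show ?thesis .
    qed
    define x where "x = l / (1 + l) ^ d"
    have x0: "x \<ge> 0" unfolding x_def using l by simp
    have xexp: "x = l * exp (- (real d * ln (1 + l)))"
    proof -
      have "(1 + l) ^ d = exp (real d * ln (1 + l))" by (rule power_eq_exp) (use l in linarith)
      then show ?thesis unfolding x_def by (simp only: exp_minus divide_inverse)
    qed
    have S0: "first_order l d \<ge> 0" unfolding first_order_def using l by simp
    have corr: "correction l d \<le> r d"
    proof -
      have "correction l d = 1 / 2 * (l\<^sup>2 * (1 + l)\<^sup>2) * (2 powr real d * ((real d)\<^sup>2 * exp (- (2 * real d * ln (1 + l)))))
         + 2 powr real d / 2 * exp (- (5 / 2 * real d * ln (1 + l)))"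
        using correction_le[of l d] l d by (simp add: algebra_simps)
      also have "\<dots> \<le> 1 / 2 * 36 * s d + 2 powr real d / 2 * exp (- (5 / 4 * real d * ln 2))"
      proof -
        have "l\<^sup>2 * (1 + l)\<^sup>2 \<le> 2\<^sup>2 * 3\<^sup>2" using l by (intro mult_mono power_mono) auto
        then have a: "1 / 2 * (l\<^sup>2 * (1 + l)\<^sup>2) \<le> 1 / 2 * 36" by simp
        have "real d * (ln 2 / 2) \<le> real d * ln (1 + l)" using L2 d by (intro mult_left_mono) auto
        then have b: "exp (- (5 / 2 * real d * ln (1 + l))) \<le> exp (- (5 / 4 * real d * ln 2))" by simp
        show ?thesis by (intro add_mono mult_mono[OF a key] mult_left_mono[OF b]) auto
      qed
      finally show ?thesis unfolding r_def by simp
    qed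
    have lowS: "first_order l d * x * ((real d)\<^sup>2 + 1) \<le> 4 * s d"
    proof -
      define P E where "P = 2 powr real d" and "E = exp (- (2 * real d * ln (1 + l)))"
      have PE: "P \<ge> 0" "E \<ge> 0" unfolding P_def E_def by (rule powr_ge_zero, rule exp_ge_zero)
      have "first_order l d = 2 powr real d / 2 * x" using first_order_eq[of d l] d unfolding x_def M by simp
      then have "first_order l d * x * ((real d)\<^sup>2 + 1) = 2 powr real d / 2 * (x * x) * ((real d)\<^sup>2 + 1)"
        by (simp only: mult.assoc)
      also have "x * x = l\<^sup>2 * exp (- (2 * real d * ln (1 + l)))"
        unfolding xexp by (simp add: power2_eq_square exp_add[symmetric])
      finally have eq: "first_order l d * x * ((real d)\<^sup>2 + 1) = P / 2 * (l\<^sup>2 * E) * ((real d)\<^sup>2 + 1)"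
        unfolding P_def E_def .
      have "l\<^sup>2 \<le> 2\<^sup>2" using l by (intro power_mono) auto
      then have f1: "P / 2 * (l\<^sup>2 * E) \<le> P / 2 * (2\<^sup>2 * E)" using PE by (intro mult_left_mono mult_right_mono) auto
      have "1 \<le> (real d)\<^sup>2" using d by (intro one_le_power) auto
      then have f2: "(real d)\<^sup>2 + 1 \<le> 2 * (real d)\<^sup>2" by linarith
      have "P / 2 * (l\<^sup>2 * E) * ((real d)\<^sup>2 + 1) \<le> P / 2 * (2\<^sup>2 * E) * (2 * (real d)\<^sup>2)"
        by (rule mult_mono[OF f1 f2]) (use PE in auto)
      also have "\<dots> = 4 * (P * ((real d)\<^sup>2 * E))" by simp
      also have "\<dots> \<le> 4 * s d" using key unfolding P_def E_def by (rule mult_left_mono) simp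
      finally show ?thesis unfolding eq .
    qed
    have pos: "(1 + l) ^ 2 ^ (d - 1) > 0" using l by simp
    define K where "K = (1 + l) ^ 2 ^ (d - 1) * exp (first_order l d)"
    have K: "K > 0" unfolding K_def using pos by simp
    have ed: "e d = cube_Z l d / K - 2" unfolding e_def K_def l_def ..
    have "cube_Z l d \<le> 2 * (1 + l) ^ 2 ^ (d - 1) * exp (first_order l d + correction l d)"
    proof -
      have "lam_min d \<le> l" using elim l by linarith
      then show ?thesis using elim by blast
    qed
    also have "\<dots> = 2 * exp (correction l d) * K" unfolding K_def by (simp add: exp_add)
    finally have "cube_Z l d / K \<le> 2 * exp (correction l d)" using K by (simp add: divide_le_eq)
    also have "\<dots> \<le> 2 * exp (r d)" using corr by simp
    finally have up: "e d \<le> 2 * exp (r d) - 2" unfolding ed by simp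
    have "2 * (1 + l) ^ 2 ^ (d - 1) * exp (first_order l d - first_order l d * x * ((real d)\<^sup>2 + 1))
       \<le> 2 * (1 + l) ^ 2 ^ (d - 1) * (1 + x / (1 + x) ^ (d * d)) ^ 2 ^ (d - 1)"
      using separated_product_lower[of d l] d l pos unfolding x_def by (intro mult_left_mono) auto
    also have "\<dots> \<le> cube_Z l d + exp (2 * (2 ^ (d - 1) / real d * (ln (real d) + 2)))"
      using cube_Z_lower(3)[of d l] d l unfolding x_def by simp
    also have "2 * (1 + l) ^ 2 ^ (d - 1) * exp (first_order l d - first_order l d * x * ((real d)\<^sup>2 + 1))
       = 2 * exp (- (first_order l d * x * ((real d)\<^sup>2 + 1))) * K"
      unfolding K_def exp_diff exp_minus divide_inverse by (simp only: mult_ac)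
    finally have "2 * exp (- (first_order l d * x * ((real d)\<^sup>2 + 1))) * K
       \<le> cube_Z l d + exp (2 * (2 ^ (d - 1) / real d * (ln (real d) + 2)))" .
    then have "2 * exp (- (first_order l d * x * ((real d)\<^sup>2 + 1)))
       \<le> (cube_Z l d + exp (2 * (2 ^ (d - 1) / real d * (ln (real d) + 2)))) / K"
      using K by (simp add: pos_le_divide_eq)
    moreover have "2 * exp (- (4 * s d)) \<le> 2 * exp (- (first_order l d * x * ((real d)\<^sup>2 + 1)))"
      using lowS by simp
    moreover have "exp (2 * (2 ^ (d - 1) / real d * (ln (real d) + 2))) / K \<le> q d"
    proof -
      have "(1 + l) ^ 2 ^ (d - 1) = exp (real (2 ^ (d - 1)) * ln (1 + l))" using l by (intro power_eq_exp) auto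
      also have "real (2 ^ (d - 1)) = 2 powr real d / 2" using M by simp
      finally have p: "(1 + l) ^ 2 ^ (d - 1) = exp (2 powr real d / 2 * ln (1 + l))" .
      have "exp (2 powr real d / 2 * (ln 2 / 2)) \<le> (1 + l) ^ 2 ^ (d - 1) * 1"
        unfolding p using L2 by (simp add: mult_left_mono)
      also have "\<dots> \<le> K" unfolding K_def using pos S0 by (intro mult_left_mono) auto
      finally have "exp (2 * (2 powr real d / 2 / real d * (ln (real d) + 2))) / K
        \<le> exp (2 * (2 powr real d / 2 / real d * (ln (real d) + 2))) / exp (2 powr real d / 2 * (ln 2 / 2))"
        using K by (intro divide_left_mono) auto
      then show ?thesis unfolding M q_def exp_diff .
    qed
    ultimately have "2 * exp (- (4 * s d)) - q d - 2 \<le> e d"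
      unfolding ed add_divide_distrib by linarith
    then show ?case using up l unfolding l_def by blast
  qed
  have s0: "s \<longlonglongrightarrow> 0"
  proof -
    have "filterlim (\<lambda>d. \<epsilon> * ln (real d)) at_top sequentially"
      using eps by (intro filterlim_tendsto_pos_mult_at_top[OF tendsto_const]) (auto intro!: filterlim_compose[OF ln_at_top filterlim_real_sequentially])
    then have "(\<lambda>d. exp (- (\<epsilon> * ln (real d)))) \<longlonglongrightarrow> 0"
      by (intro filterlim_compose[OF exp_at_bot]) (simp add: filterlim_uminus_at_bot_at_top filterlim_uminus_at_bot)
    then have "(\<lambda>d. exp 1 * exp (- (\<epsilon> * ln (real d)))) \<longlonglongrightarrow> exp 1 * 0" by (intro tendsto_intros)
    then show ?thesis unfolding s_def[abs_def] by simp
  qed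
  have "(\<lambda>d. 2 powr real d / 2 * exp (- (5 / 4 * real d * ln 2))) \<longlonglongrightarrow> 0" by real_asymp
  then have "r \<longlonglongrightarrow> 18 * 0 + 0" unfolding r_def[abs_def] using s0 by (intro tendsto_intros)
  then have "(\<lambda>d. 2 * exp (r d) - 2) \<longlonglongrightarrow> 2 * exp 0 - 2" by (intro tendsto_intros) simp
  then have u: "(\<lambda>d. 2 * exp (r d) - 2) \<longlonglongrightarrow> 0" by simp
  have q0: "q \<longlonglongrightarrow> 0" unfolding q_def[abs_def] by real_asymp
  have "(\<lambda>d. 2 * exp (- (4 * s d)) - q d - 2) \<longlonglongrightarrow> 2 * exp (- (4 * 0)) - 0 - 2"
    using s0 q0 by (intro tendsto_intros)
  then have lo: "(\<lambda>d. 2 * exp (- (4 * s d)) - q d - 2) \<longlonglongrightarrow> 0" by simp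
  have "e \<longlonglongrightarrow> 0"
    by (rule tendsto_sandwich[OF _ _ lo u]) (use ev in \<open>auto elim: eventually_mono\<close>)
  moreover have "\<forall>\<^sub>F d in sequentially. cube_Z (lam d) d = (2 + e d) * (1 + lam d) ^ 2 ^ (d - 1) * exp (first_order (lam d) d)"
    using ev by eventually_elim (auto simp: e_def)
  ultimately show ?thesis by blast
qed

text \<open>Here the first-order exponent \<open>S\<close> grows exponentially, so
  \<open>ln 2 / S\<close> and \<open>correction / S\<close> both tend to 0, and the one-sided lower
  bound is sharp enough. The error \<open>e\<close> is the relative error of the logarithm, bounded
  below by \<open>- A\<close> and above by \<open>B\<close>.\<close>

lemma cube_Z_below:
  fixes lam h :: "nat \<Rightarrow> real"
  assumes h: "h \<longlonglongrightarrow> 0"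
    and lam: "\<forall>\<^sub>F d in sequentially. lam_min d \<le> lam d \<and> lam d \<le> sqrt 2 - 1 + (sqrt 2 + h d) * ln (real d) / real d"
  shows "\<exists>e. e \<longlonglongrightarrow> 0 \<and> (\<forall>\<^sub>F d in sequentially. cube_Z (lam d) d =
     (1 + lam d) ^ 2 ^ (d - 1) * exp (first_order (lam d) d * (1 + e d)))"
proof -
  define e where "e d = (ln (cube_Z (lam d) d / (1 + lam d) ^ 2 ^ (d - 1)) - first_order (lam d) d) / first_order (lam d) d" for d
  define m where "m d = real d * (lam_min d / 2)" for d
  define A where "A d = ((real d)\<^sup>2 + 1) * exp (- m d)" for d
  define B where "B d = ln 2 / (lam_min d / 2 * exp (real d * ln 2 / 2 - 2 * ln (real d))) + (4 * (real d)\<^sup>2 * exp (- m d) + exp (- (3 / 2 * m d)) / lam_min d)" for d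
  have "\<forall>\<^sub>F d in sequentially. h d < 1 / 10" using h by (rule order_tendstoD) simp
  moreover have "\<forall>\<^sub>F d in sequentially. (sqrt 2 + 1 / 10) * ln (real d) / real d < 1 / 2" by real_asymp
  ultimately have ev: "\<forall>\<^sub>F d in sequentially. lam d > 0 \<and> first_order (lam d) d > 0 \<and> cube_Z (lam d) d > 0 \<and> - A d \<le> e d \<and> e d \<le> B d"
    using lam ln_ge_lam_min upper_eventually eventually_ge_at_top[of 2]
  proof eventually_elim
    case (elim d)
    define l where "l = lam d"
    have d: "d \<ge> 2" "real d > 0" "real d \<ge> 1" "ln (real d) \<ge> 0" using elim by auto
    have f0: "lam_min d > 0" using elim by simp
    have lf: "lam_min d \<le> l" using elim unfolding l_def by simp
    have l0: "l > 0" using lf f0 by linarith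
    have "(sqrt 2 + h d) * ln (real d) / real d \<le> (sqrt 2 + 1 / 10) * ln (real d) / real d"
      using elim d by (intro divide_right_mono mult_right_mono) auto
    moreover have lu: "l \<le> sqrt 2 - 1 + (sqrt 2 + h d) * ln (real d) / real d" using elim unfolding l_def by simp
    moreover have s2: "sqrt 2 \<le> 3 / 2" by (rule real_le_lsqrt) (auto simp: power2_eq_square)
    ultimately have l1: "l \<le> 1" and lu': "1 + l \<le> sqrt 2 + (sqrt 2 + 1 / 10) * ln (real d) / real d" using elim by linarith+
    have L: "lam_min d / 2 \<le> ln (1 + l)" using elim lf by blast
    then have dL: "m d \<le> real d * ln (1 + l)" unfolding m_def using d by (intro mult_left_mono) auto
    define x where "x = l / (1 + l) ^ d"
    have xexp: "x = l * exp (- (real d * ln (1 + l)))"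
    proof -
      have "(1 + l) ^ d = exp (real d * ln (1 + l))" by (rule power_eq_exp) (use l0 in linarith)
      then show ?thesis unfolding x_def by (simp only: exp_minus divide_inverse)
    qed
    have x0: "x > 0" unfolding xexp using l0 by simp
    define S where "S = first_order l d"
    have "S = 2 ^ (d - 1) * x" unfolding S_def x_def by (rule first_order_eq[symmetric]) (use d in auto)
    also have "(2::real) ^ (d - 1) = 2 powr real d / 2" by (rule two_power_eq) (use d in auto)
    finally have Sx: "S = 2 powr real d / 2 * x" .
    have S0: "S > 0" unfolding Sx using x0 by simp
    have pos: "(1 + l) ^ 2 ^ (d - 1) > 0" using l0 by simp
    have xA: "x * ((real d)\<^sup>2 + 1) \<le> A d"
    proof -
      have "x \<le> 1 * exp (- m d)" unfolding xexp using l0 l1 dL by (intro mult_mono) auto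
      then have "x * ((real d)\<^sup>2 + 1) \<le> 1 * exp (- m d) * ((real d)\<^sup>2 + 1)" by (rule mult_right_mono) simp
      then show ?thesis unfolding A_def by (simp only: mult_1_left mult.commute)
    qed
    \<comment> \<open>\<open>1 + l\<close> is at most \<open>sqrt 2 * (1 + u)\<close> with
      \<open>d * u \<le> 2 * ln d\<close>, so \<open>2^d (1 + l)^(-d)\<close> is still at least
      \<open>2^(d/2) d^(-2)\<close>.\<close>
    have Slow: "lam_min d / 2 * exp (real d * ln 2 / 2 - 2 * ln (real d)) \<le> S"
    proof -
      define u where "u = (sqrt 2 + 1 / 10) / sqrt 2 * (ln (real d) / real d)"
      have u: "u \<ge> 0" unfolding u_def using d by simp
      have "sqrt 2 * u = (sqrt 2 + 1 / 10) * ln (real d) / real d" unfolding u_def by simp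
      then have "sqrt 2 * (1 + u) = sqrt 2 + (sqrt 2 + 1 / 10) * ln (real d) / real d"
        by (simp only: distrib_left mult_1_right)
      then have "ln (1 + l) \<le> ln (sqrt 2 * (1 + u))" using lu' l0 by simp
      also have "\<dots> = ln 2 / 2 + ln (1 + u)" using u by (simp add: ln_mult ln_sqrt)
      also have "ln (1 + u) \<le> u" using u by (rule ln_add_one_self_le_self)
      finally have "real d * ln (1 + l) \<le> real d * (ln 2 / 2 + u)" using d by (intro mult_left_mono) auto
      moreover have "real d * u \<le> 2 * ln (real d)"
      proof -
        have "1 \<le> sqrt (2::real)" by simp
        then have "sqrt 2 + 1 / 10 \<le> 2 * sqrt (2::real)" by linarith
        then have "(sqrt 2 + 1 / 10) / sqrt 2 \<le> 2 * sqrt 2 / sqrt (2::real)" by (rule divide_right_mono) simp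
        then have "(sqrt 2 + 1 / 10) / sqrt 2 \<le> (2::real)" by simp
        then have "(sqrt 2 + 1 / 10) / sqrt 2 * ln (real d) \<le> 2 * ln (real d)" using d by (intro mult_right_mono) auto
        then show ?thesis unfolding u_def using d by simp
      qed
      ultimately have "real d * ln 2 / 2 - 2 * ln (real d) \<le> real d * ln 2 - real d * ln (1 + l)"
        by (simp add: algebra_simps)
      then have "lam_min d / 2 * exp (real d * ln 2 / 2 - 2 * ln (real d)) \<le> l / 2 * exp (real d * ln 2 - real d * ln (1 + l))"
        using lf f0 by (intro mult_mono) auto
      also have "\<dots> = S"
      proof -
        have "2 powr real d = exp (real d * ln 2)" by (simp add: powr_def)
        then show ?thesis unfolding Sx xexp exp_diff exp_minus divide_inverse by (simp only: mult_ac)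
      qed
      finally show ?thesis .
    qed
    \<comment> \<open>\<open>S\<close> contains \<open>(1 + l)^(-d)\<close>, so the pairs retain one
      more such factor and the larger polymers retain \<open>(1 + l)^(-3d/2)\<close>. Each is
      bounded through \<open>m d\<close>, whose growth of order \<open>d^(2/3) ln d\<close> beats
      every power of \<open>d\<close>.\<close>
    have corr: "correction l d / S \<le> 4 * (real d)\<^sup>2 * exp (- m d) + exp (- (3 / 2 * m d)) / lam_min d"
    proof -
      have "correction l d = S * ((real d)\<^sup>2 * (l * (1 + l)\<^sup>2) * exp (- (real d * ln (1 + l)))
          + exp (- (3 / 2 * (real d * ln (1 + l)))) / l)"
      proof -
        have a: "exp (- (2 * real d * ln (1 + l))) = exp (- (real d * ln (1 + l))) * exp (- (real d * ln (1 + l)))"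
          by (simp add: exp_add[symmetric])
        have b: "exp (- (5 / 2 * real d * ln (1 + l))) = exp (- (real d * ln (1 + l))) * exp (- (3 / 2 * (real d * ln (1 + l))))"
          by (simp add: exp_add[symmetric])
        have "d \<ge> 1" using d by simp
        show ?thesis unfolding correction_le[OF l0 \<open>d \<ge> 1\<close>] Sx xexp a b
          using l0 by (simp add: field_simps power2_eq_square)
      qed
      then have "correction l d / S = (real d)\<^sup>2 * (l * (1 + l)\<^sup>2) * exp (- (real d * ln (1 + l)))
          + exp (- (3 / 2 * (real d * ln (1 + l)))) / l"
        using S0 by simp
      also have "\<dots> \<le> (real d)\<^sup>2 * (1 * 2\<^sup>2) * exp (- m d) + exp (- (3 / 2 * m d)) / lam_min d"
        using l0 l1 dL lf f0 by (intro add_mono mult_mono power_mono mult_left_mono frac_le) auto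
      finally show ?thesis by simp
    qed
    have zlow: "(1 + l) ^ 2 ^ (d - 1) * exp (S - S * x * ((real d)\<^sup>2 + 1)) \<le> cube_Z l d"
    proof -
      have "(1 + l) ^ 2 ^ (d - 1) * exp (S - S * x * ((real d)\<^sup>2 + 1)) \<le>
        (1 + l) ^ 2 ^ (d - 1) * (1 + x / (1 + x) ^ (d * d)) ^ 2 ^ (d - 1)"
        using separated_product_lower[of d l] d l0 pos unfolding x_def S_def by (intro mult_left_mono) auto
      also have "\<dots> \<le> cube_Z l d" using cube_Z_lower(2)[of d l] d l0 unfolding x_def by simp
      finally show ?thesis .
    qed
    moreover have "0 < (1 + l) ^ 2 ^ (d - 1) * exp (S - S * x * ((real d)\<^sup>2 + 1))" using pos by simp
    ultimately have Z0: "cube_Z l d > 0" by linarith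
    define z where "z = ln (cube_Z l d / (1 + l) ^ 2 ^ (d - 1))"
    have ed: "e d = (z - S) / S" unfolding e_def z_def S_def l_def ..
    have "exp (S - S * x * ((real d)\<^sup>2 + 1)) \<le> cube_Z l d / (1 + l) ^ 2 ^ (d - 1)"
      using zlow pos by (simp add: pos_le_divide_eq mult.commute)
    then have "S - S * x * ((real d)\<^sup>2 + 1) \<le> z" unfolding z_def using Z0 pos by (simp add: ln_ge_iff)
    then have "S * (- (x * ((real d)\<^sup>2 + 1))) \<le> z - S" by (simp add: algebra_simps)
    then have "- (x * ((real d)\<^sup>2 + 1)) \<le> e d" unfolding ed using S0 by (simp add: pos_le_divide_eq mult.commute)
    then have lo: "- A d \<le> e d" using xA by linarith
    have "cube_Z l d \<le> 2 * (1 + l) ^ 2 ^ (d - 1) * exp (S + correction l d)"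
      using elim lf unfolding S_def by blast
    then have "cube_Z l d / (1 + l) ^ 2 ^ (d - 1) \<le> 2 * exp (S + correction l d)"
      using pos by (simp add: divide_le_eq mult.commute mult.left_commute)
    then have "z \<le> ln (2 * exp (S + correction l d))" unfolding z_def using Z0 pos by simp
    also have "\<dots> = ln 2 + (S + correction l d)" by (simp add: ln_mult)
    finally have "(z - S) / S \<le> (ln 2 + correction l d) / S" using S0 by (intro divide_right_mono) auto
    then have "e d \<le> ln 2 / S + correction l d / S" unfolding ed by (simp add: add_divide_distrib)
    moreover have "ln 2 / S \<le> ln 2 / (lam_min d / 2 * exp (real d * ln 2 / 2 - 2 * ln (real d)))"
      using Slow f0 S0 by (intro divide_left_mono) auto
    ultimately have "e d \<le> B d" using corr unfolding B_def by linarith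
    then show ?case using lo Z0 S0 l0 unfolding S_def l_def by blast
  qed
  have lo: "(\<lambda>d. - A d) \<longlonglongrightarrow> 0" unfolding A_def m_def lam_min_def by real_asymp
  have u: "B \<longlonglongrightarrow> 0" unfolding B_def[abs_def] m_def lam_min_def by real_asymp
  have "e \<longlonglongrightarrow> 0"
    by (rule tendsto_sandwich[OF _ _ lo u]) (use ev in \<open>auto elim: eventually_mono\<close>)
  moreover have "\<forall>\<^sub>F d in sequentially. cube_Z (lam d) d =
     (1 + lam d) ^ 2 ^ (d - 1) * exp (first_order (lam d) d * (1 + e d))"
    using ev
  proof eventually_elim
    case (elim d)
    have "first_order (lam d) d * (1 + e d) = ln (cube_Z (lam d) d / (1 + lam d) ^ 2 ^ (d - 1))"
      unfolding e_def using elim by (simp add: field_simps)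
    then show ?case using elim by simp
  qed
  ultimately show ?thesis by blast
qed

theorem theorem1p6:
  "\<exists>c0::real. c0 > 0 \<and> (\<forall>lam :: nat \<Rightarrow> real. (\<forall>d\<ge>1. lam d > 0) \<longrightarrow>
    ((\<exists>w :: nat \<Rightarrow> real. filterlim w at_top sequentially \<and>
        (\<forall>\<^sub>F d in sequentially. lam d \<ge> 1 + w d / real d))
      \<longrightarrow> (\<exists>e :: nat \<Rightarrow> real. e \<longlonglongrightarrow> 0 \<and>
            (\<forall>\<^sub>F d in sequentially.
               cube_Z (lam d) d = (2 + e d) * (1 + lam d) ^ (2 ^ (d - 1))))) \<and>
    ((\<exists>b :: nat \<Rightarrow> real. (\<exists>C. \<forall>d. b d \<le> C) \<and>
        (\<forall>\<^sub>F d in sequentially. \<bar>lam d - 1\<bar> \<le> b d / real d)) \<or>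
     (\<exists>(g :: nat \<Rightarrow> real) (w :: nat \<Rightarrow> real).
        (\<exists>\<epsilon>>0. \<forall>\<^sub>F d in sequentially. g d > \<epsilon>) \<and>
        filterlim w at_top sequentially \<and>
        (\<forall>\<^sub>F d in sequentially.
           sqrt 2 - 1 + (sqrt 2 + g d) * ln (real d) / real d \<le> lam d \<and>
           lam d \<le> 1 - w d / real d))
      \<longrightarrow> (\<exists>e :: nat \<Rightarrow> real. e \<longlonglongrightarrow> 0 \<and>
            (\<forall>\<^sub>F d in sequentially.
               cube_Z (lam d) d = (2 + e d) * (1 + lam d) ^ (2 ^ (d - 1)) *
                 exp (lam d / 2 * (2 / (1 + lam d)) ^ d)))) \<and>
    ((\<exists>h :: nat \<Rightarrow> real. h \<longlonglongrightarrow> 0 \<and>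
        (\<forall>\<^sub>F d in sequentially.
           c0 * ln (real d) / real d powr (1 / 3) \<le> lam d \<and>
           lam d \<le> sqrt 2 - 1 + (sqrt 2 + h d) * ln (real d) / real d))
      \<longrightarrow> (\<exists>e :: nat \<Rightarrow> real. e \<longlonglongrightarrow> 0 \<and>
            (\<forall>\<^sub>F d in sequentially.
               cube_Z (lam d) d = (1 + lam d) ^ (2 ^ (d - 1)) *
                 exp (lam d / 2 * (2 / (1 + lam d)) ^ d * (1 + e d))))))"
proof (intro exI[of _ 300] conjI allI impI)
  fix lam :: "nat \<Rightarrow> real"
  assume "\<exists>w :: nat \<Rightarrow> real. filterlim w at_top sequentially \<and>
        (\<forall>\<^sub>F d in sequentially. lam d \<ge> 1 + w d / real d)"
  then show "\<exists>e :: nat \<Rightarrow> real. e \<longlonglongrightarrow> 0 \<and> (\<forall>\<^sub>F d in sequentially.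
               cube_Z (lam d) d = (2 + e d) * (1 + lam d) ^ (2 ^ (d - 1)))"
    using cube_Z_above_one by blast
next
  fix lam :: "nat \<Rightarrow> real"
  assume "(\<exists>b :: nat \<Rightarrow> real. (\<exists>C. \<forall>d. b d \<le> C) \<and>
        (\<forall>\<^sub>F d in sequentially. \<bar>lam d - 1\<bar> \<le> b d / real d)) \<or>
     (\<exists>(g :: nat \<Rightarrow> real) (w :: nat \<Rightarrow> real).
        (\<exists>\<epsilon>>0. \<forall>\<^sub>F d in sequentially. g d > \<epsilon>) \<and>
        filterlim w at_top sequentially \<and>
        (\<forall>\<^sub>F d in sequentially.
           sqrt 2 - 1 + (sqrt 2 + g d) * ln (real d) / real d \<le> lam d \<and>
           lam d \<le> 1 - w d / real d))"
  \<comment> \<open>Near 1 any fixed margin works, because sqrt 2 - 1 stays away from 1 and ln d / d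
    tends to 0; the choice is 1. In the other alternative the margin is the eventual lower bound of
    \<open>g\<close>.\<close>
  then have "\<exists>\<epsilon>>0. \<forall>\<^sub>F d in sequentially.
      sqrt 2 - 1 + (sqrt 2 + \<epsilon>) * ln (real d) / real d \<le> lam d \<and> lam d \<le> 2"
  proof (elim disjE exE conjE)
    fix b :: "nat \<Rightarrow> real" and C
    assume b: "\<forall>d. b d \<le> C" and lam: "\<forall>\<^sub>F d in sequentially. \<bar>lam d - 1\<bar> \<le> b d / real d"
    have s2: "sqrt 2 \<le> 3 / 2" by (rule real_le_lsqrt) (auto simp: power2_eq_square)
    have "(\<lambda>d. C / real d) \<longlonglongrightarrow> 0" by (rule lim_const_over_n)
    then have "\<forall>\<^sub>F d in sequentially. C / real d < 1 / 10" by (rule order_tendstoD) simp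
    moreover have "\<forall>\<^sub>F d in sequentially. (sqrt 2 + 1) * ln (real d) / real d \<le> 1 / 10" by real_asymp
    ultimately have "\<forall>\<^sub>F d in sequentially.
      sqrt 2 - 1 + (sqrt 2 + 1) * ln (real d) / real d \<le> lam d \<and> lam d \<le> 2"
      using lam
    proof eventually_elim
      case (elim d)
      have "b d / real d \<le> C / real d" using b by (intro divide_right_mono) auto
      then show ?case using elim s2 by linarith
    qed
    then show ?thesis by (intro exI[of _ 1]) simp
  next
    fix g w :: "nat \<Rightarrow> real" and \<epsilon> :: real
    assume eps: "\<epsilon> > 0" and g: "\<forall>\<^sub>F d in sequentially. g d > \<epsilon>" and w: "filterlim w at_top sequentially"
      and lam: "\<forall>\<^sub>F d in sequentially. sqrt 2 - 1 + (sqrt 2 + g d) * ln (real d) / real d \<le> lam d \<and>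
           lam d \<le> 1 - w d / real d"
    have "\<forall>\<^sub>F d in sequentially. w d > 0" using w by (simp add: filterlim_at_top_dense)
    then have "\<forall>\<^sub>F d in sequentially.
      sqrt 2 - 1 + (sqrt 2 + \<epsilon>) * ln (real d) / real d \<le> lam d \<and> lam d \<le> 2"
      using g lam eventually_ge_at_top[of 1]
    proof eventually_elim
      case (elim d)
      have "(sqrt 2 + \<epsilon>) * ln (real d) / real d \<le> (sqrt 2 + g d) * ln (real d) / real d"
        using elim by (intro divide_right_mono mult_right_mono) auto
      moreover have "w d / real d \<ge> 0" using elim by simp
      ultimately show ?case using elim by linarith
    qed
    then show ?thesis using eps by blast
  qed
  then show "\<exists>e :: nat \<Rightarrow> real. e \<longlonglongrightarrow> 0 \<and> (\<forall>\<^sub>F d in sequentially.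
               cube_Z (lam d) d = (2 + e d) * (1 + lam d) ^ (2 ^ (d - 1)) *
                 exp (lam d / 2 * (2 / (1 + lam d)) ^ d))"
    using cube_Z_between unfolding first_order_def by blast
next
  fix lam :: "nat \<Rightarrow> real"
  assume "\<exists>h :: nat \<Rightarrow> real. h \<longlonglongrightarrow> 0 \<and>
        (\<forall>\<^sub>F d in sequentially.
           300 * ln (real d) / real d powr (1 / 3) \<le> lam d \<and>
           lam d \<le> sqrt 2 - 1 + (sqrt 2 + h d) * ln (real d) / real d)"
  then show "\<exists>e :: nat \<Rightarrow> real. e \<longlonglongrightarrow> 0 \<and> (\<forall>\<^sub>F d in sequentially.
               cube_Z (lam d) d = (1 + lam d) ^ (2 ^ (d - 1)) *
                 exp (lam d / 2 * (2 / (1 + lam d)) ^ d * (1 + e d)))"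
    using cube_Z_below unfolding first_order_def lam_min_def by blast
qed simp

end
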